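(* If $F$ is a finite-rank free group, $R$ is a finite subset of $\{g,\ {}^Fg : g\in F\setminus\{1\}\}$, and $X$ is an $R$-cutvertex-free $F$-basis, then $\ast_{Y\in\mathcal{P}(X;R)}\langle Y\rangle$ is an atomic $R$-allocating $F$-factorization.
   Context: For $f,g\in F$, ${}^fg:=fgf^{-1}$ and ${}^Fg:=\{{}^fg: f\in F\}$. An $F$-basis is a free-generating set of $F$. An $F$-element is an element of $F$; an $F$-class is a conjugacy class ${}^Fg$. Thus $R$ is a finite set of nontrivial $F$-elements and nontrivial $F$-classes. An $F$-factorization is a multiset $\mathcal{H}$ of subgroups of $F$ such that the induced map $\ast_{H\in\mathcal{H}}H\to F$ is an isomorphism (one also calls the expression $\ast_{H\in\mathcal{H}}H$ an $F$-factorization). It is $R$-allocating if each $H\in\mathcal{H}$ is nontrivial and $R\subseteq\{h,{}^Fh : h\in H,\ H\in\mathcal{H}\}$. An $R$-allocating $F$-factorization $\mathcal{H}$ is atomic if no proper free-product refinement of $\ast_{H\in\mathcal{H}}H$ (obtained by further decomposing factors as nontrivial free products) is $R$-allocating. For an $F$-basis $X$ put $X^{\pm1}:=X\cup X^{-1}$ and $X^{0,\pm1}:=\{1\}\cup X^{\pm1}$. Let $r$ be a nontrivial $F$-element (resp. nontrivial $F$-class). There is a finite sequence $(x_1,\ldots,x_n)$ in $X^{\pm1}$, unique (resp. unique up to cyclic permutation), such that $r$ equals (resp. contains) $x_1\cdots x_n$ and $x_i^{-1}\ne x_{i+1}$ for all $i\in\{0,1,\ldots,n\}$, where $x_0:=x_{n+1}:=1$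 (resp. $x_0:=x_n$, $x_{n+1}:=x_1$). The set of $X$-turns of $r$ is $\{(x_i^{-1},x_{i+1}) : 0\le i\le n\}\subseteq X^{0,\pm1}\times X^{0,\pm1}$, and $X\text{-support}(r):=\{x_1,\ldots,x_n\}^{\pm1}\cap X$. The $X$-turns of $R$ are the $X$-turns of the elements of $R$. $\mathcal{P}(X;R)$ denotes the finest partition of $X$ such that for each $r\in R$ some element of the partition includes $X\text{-support}(r)$. For $Y\in\mathcal{P}(X;R)$, $R_{|Y,X}:=\{r\in R : X\text{-support}(r)\subseteq Y\}$, viewed as a set of $\langle Y\rangle$-elements and $\langle Y\rangle$-classes. A graph $\Gamma$ is a vertex-set $V$ together with an edge-set $E\subseteq V\times V$; an edge $(v,w)$ meets $v$ and $w$ and meets every subset of $V$ containing $v$ or $w$. A vertex $v_\dag$ is a cutvertex of $\Gamma$ if $V\setminus\{v_\dag\}$ is the union of two disjoint nonempty subsets $V_1,V_2$ such that no edge meets both $V_1$ and $V_2$ (connectivity of $\Gamma$ is not assumed). $\mathbb{W}(X,R)$ is the graph whose edges are the $X$-turns of $R$ and whose vertices are the elements of $X^{0,\pm1}$ met by some $X$-turn of $R$. An $X$-cutvertex of $\mathbb{W}(X,R)$ is a cutvertex lying in $X^{\pm1}$ (i.e. different from $1$). The basis $X$ is $R$-cutvertex-free if, for each $Y\in\mathcal{P}(X;R)$, the graph $\mathbb{W}(Y,R_{|Y,X})$ (formed for the free group $\langle Y\rangle$ with basis $Y$) has no $Y$-cutvertices. *)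

theory Defs
  imports
    "HOL-Algebra.Generated_Groups"
    "HOL-Library.Multiset"
    "HOL-Library.Disjoint_Sets"
begin

section \<open>Free groups and bases\<close>

text \<open>
  The free group on a set \<open>X\<close> of formal symbols: its elements are the reduced words in the
  letters \<open>(x, True)\<close> (standing for \<open>x\<close>) and \<open>(x, False)\<close> (standing for the inverse of \<open>x\<close>);
  two words are multiplied by concatenation followed by free reduction.
\<close>

definition cancelling :: "'x \<times> bool \<Rightarrow> 'x \<times> bool \<Rightarrow> bool" where
  "cancelling l m \<longleftrightarrow> fst l = fst m \<and> snd l \<noteq> snd m"

fun letter_cons :: "'x \<times> bool \<Rightarrow> ('x \<times> bool) list \<Rightarrow> ('x \<times> bool) list" where
  "letter_cons l [] = [l]"
| "letter_cons l (m # w) = (if cancelling l m then w else l # m # w)"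

definition free_group_on :: "'x set \<Rightarrow> ('x \<times> bool) list monoid" where
  "free_group_on X =
     \<lparr>carrier = {w. set w \<subseteq> X \<times> UNIV \<and> successively (\<lambda>l m. \<not> cancelling l m) w},
      monoid.mult = foldr letter_cons,
      one = []\<rparr>"

definition list_prod :: "('a, 'b) monoid_scheme \<Rightarrow> 'a list \<Rightarrow> 'a" where
  "list_prod G xs = foldr (\<otimes>\<^bsub>G\<^esub>) xs \<one>\<^bsub>G\<^esub>"

definition word_value :: "('a, 'b) monoid_scheme \<Rightarrow> ('a \<times> bool) list \<Rightarrow> 'a" where
  "word_value G w = list_prod G (map (\<lambda>(x, e). if e then x else inv\<^bsub>G\<^esub> x) w)"

definition is_basis :: "('a, 'b) monoid_scheme \<Rightarrow> 'a set \<Rightarrow> bool" where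
  "is_basis G X \<longleftrightarrow> X \<subseteq> carrier G \<and> word_value G \<in> iso (free_group_on X) G"

definition finite_rank_free_group :: "('a, 'b) monoid_scheme \<Rightarrow> bool" where
  "finite_rank_free_group G \<longleftrightarrow> group G \<and> (\<exists>B. finite B \<and> is_basis G B)"


section \<open>Free products and factorizations\<close>

text \<open>
  The free product of the groups \<open>Gs i\<close> with \<open>i \<in> I\<close>: its elements are the reduced sequences of
  syllables \<open>(i, a)\<close> with \<open>a\<close> a nontrivial element of \<open>Gs i\<close>, consecutive syllables having distinct
  indices; two sequences are multiplied by concatenation followed by reduction.
\<close>

fun syllable_cons ::
  "('i \<Rightarrow> ('a, 'b) monoid_scheme) \<Rightarrow> 'i \<times> 'a \<Rightarrow> ('i \<times> 'a) list \<Rightarrow> ('i \<times> 'a) list" where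
  "syllable_cons Gs s [] = [s]"
| "syllable_cons Gs (i, a) ((j, b) # w) =
     (if i \<noteq> j then (i, a) # (j, b) # w
      else if a \<otimes>\<^bsub>Gs i\<^esub> b = \<one>\<^bsub>Gs i\<^esub> then w
      else (i, a \<otimes>\<^bsub>Gs i\<^esub> b) # w)"

definition free_product :: "'i set \<Rightarrow> ('i \<Rightarrow> ('a, 'b) monoid_scheme) \<Rightarrow> ('i \<times> 'a) list monoid" where
  "free_product I Gs =
     \<lparr>carrier = {w. (\<forall>(i, a)\<in>set w. i \<in> I \<and> a \<in> carrier (Gs i) \<and> a \<noteq> \<one>\<^bsub>Gs i\<^esub>) \<and>
                    distinct_adj (map fst w)},
      monoid.mult = foldr (syllable_cons Gs),
      one = []\<rparr>"

text \<open>
  In a multiset \<open>\<H>\<close> of subgroups, the copies of \<open>H\<close> are told apart by the pairs \<open>(H, k)\<close> with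
  \<open>k < count \<H> H\<close>. Library multisets are finite; this excludes no factorization of a finitely
  generated group into nontrivial factors, and only such factorizations are considered below.
\<close>

definition is_factorization :: "('a, 'b) monoid_scheme \<Rightarrow> 'a set multiset \<Rightarrow> bool" where
  "is_factorization G \<H> \<longleftrightarrow>
     (\<forall>H\<in>#\<H>. subgroup H G) \<and>
     (\<lambda>w. list_prod G (map snd w)) \<in>
       iso (free_product {(H, k). k < count \<H> H} (\<lambda>(H, k). G\<lparr>carrier := H\<rparr>)) G"


section \<open>Elements and conjugacy classes\<close>

datatype 'a elt_or_class = Elt 'a | Cls "'a set"

definition conj_class :: "('a, 'b) monoid_scheme \<Rightarrow> 'a \<Rightarrow> 'a set" where
  "conj_class G g = {f \<otimes>\<^bsub>G\<^esub> g \<otimes>\<^bsub>G\<^esub> inv\<^bsub>G\<^esub> f | f. f \<in> carrier G}"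

definition elts_and_classes :: "('a, 'b) monoid_scheme \<Rightarrow> 'a set \<Rightarrow> 'a elt_or_class set" where
  "elts_and_classes G S = Elt ` S \<union> (\<lambda>g. Cls (conj_class G g)) ` S"

definition is_allocating ::
  "('a, 'b) monoid_scheme \<Rightarrow> 'a elt_or_class set \<Rightarrow> 'a set multiset \<Rightarrow> bool" where
  "is_allocating G R \<H> \<longleftrightarrow>
     is_factorization G \<H> \<and>
     (\<forall>H\<in>#\<H>. H \<noteq> {\<one>\<^bsub>G\<^esub>}) \<and>
     R \<subseteq> elts_and_classes G (\<Union>H\<in>set_mset \<H>. H)"

text \<open>
  A proper refinement of \<open>\<H>\<close> arises by choosing, for each occurrence of a factor \<open>H\<close> in \<open>\<H>\<close>, a
  factorization \<open>\<K>\<close> of \<open>H\<close> into nontrivial subgroups, at least one of these choices being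
  different from \<open>{#H#}\<close>. The multiset \<open>\<C>\<close> records the pairs \<open>(H, \<K>)\<close>.
\<close>

definition proper_refinement ::
  "('a, 'b) monoid_scheme \<Rightarrow> 'a set multiset \<Rightarrow> 'a set multiset \<Rightarrow> bool" where
  "proper_refinement G \<H> \<H>' \<longleftrightarrow>
     (\<exists>\<C> :: ('a set \<times> 'a set multiset) multiset.
        image_mset fst \<C> = \<H> \<and>
        \<H>' = \<Sum>\<^sub># (image_mset snd \<C>) \<and>
        (\<forall>(H, \<K>)\<in>set_mset \<C>. is_factorization (G\<lparr>carrier := H\<rparr>) \<K> \<and> (\<forall>K\<in>#\<K>. K \<noteq> {\<one>\<^bsub>G\<^esub>})) \<and>
        (\<exists>(H, \<K>)\<in>set_mset \<C>. \<K> \<noteq> {#H#}))"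

definition is_atomic_allocating ::
  "('a, 'b) monoid_scheme \<Rightarrow> 'a elt_or_class set \<Rightarrow> 'a set multiset \<Rightarrow> bool" where
  "is_atomic_allocating G R \<H> \<longleftrightarrow>
     is_allocating G R \<H> \<and>
     (\<nexists>\<H>'. proper_refinement G \<H> \<H>' \<and> is_allocating G R \<H>')"


section \<open>Turns and supports\<close>

definition pm :: "('a, 'b) monoid_scheme \<Rightarrow> 'a set \<Rightarrow> 'a set" where
  "pm G X = X \<union> m_inv G ` X"

definition zero_pm :: "('a, 'b) monoid_scheme \<Rightarrow> 'a set \<Rightarrow> 'a set" where
  "zero_pm G X = insert \<one>\<^bsub>G\<^esub> (pm G X)"

text \<open>
  For a sequence \<open>xs = [x\<^sub>1, \<dots>, x\<^sub>n]\<close>, the sequence of the \<open>x\<^sub>i\<close> with \<open>i\<close> from \<open>0\<close> to \<open>n+1\<close>, where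
  the two outer entries depend on whether an element or a class is being described.
\<close>

fun padded :: "('a, 'b) monoid_scheme \<Rightarrow> 'a elt_or_class \<Rightarrow> 'a list \<Rightarrow> 'a list" where
  "padded G (Elt g) xs = \<one>\<^bsub>G\<^esub> # xs @ [\<one>\<^bsub>G\<^esub>]"
| "padded G (Cls C) xs = last xs # xs @ [hd xs]"

definition seq_turns :: "('a, 'b) monoid_scheme \<Rightarrow> 'a elt_or_class \<Rightarrow> 'a list \<Rightarrow> ('a \<times> 'a) set" where
  "seq_turns G r xs =
     {(inv\<^bsub>G\<^esub> (padded G r xs ! i), padded G r xs ! (i + 1)) | i. i \<le> length xs}"

fun value_matches :: "'a elt_or_class \<Rightarrow> 'a \<Rightarrow> bool" where
  "value_matches (Elt g) h \<longleftrightarrow> h = g"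
| "value_matches (Cls C) h \<longleftrightarrow> h \<in> C"

definition expresses ::
  "('a, 'b) monoid_scheme \<Rightarrow> 'a set \<Rightarrow> 'a elt_or_class \<Rightarrow> 'a list \<Rightarrow> bool" where
  "expresses G X r xs \<longleftrightarrow>
     set xs \<subseteq> pm G X \<and>
     value_matches r (list_prod G xs) \<and>
     (\<forall>(a, b)\<in>seq_turns G r xs. a \<noteq> b)"

text \<open>
  The sequence expressing \<open>r\<close> is unique, for classes up to cyclic permutation, which affects neither
  the turns nor the support; the unions over all such sequences below are thus over equal sets.
\<close>

definition turns :: "('a, 'b) monoid_scheme \<Rightarrow> 'a set \<Rightarrow> 'a elt_or_class \<Rightarrow> ('a \<times> 'a) set" where
  "turns G X r = (\<Union>xs\<in>{xs. expresses G X r xs}. seq_turns G r xs)"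

definition support :: "('a, 'b) monoid_scheme \<Rightarrow> 'a set \<Rightarrow> 'a elt_or_class \<Rightarrow> 'a set" where
  "support G X r = (\<Union>xs\<in>{xs. expresses G X r xs}. pm G (set xs) \<inter> X)"


section \<open>The partition determined by the supports\<close>

definition support_partition ::
  "('a, 'b) monoid_scheme \<Rightarrow> 'a set \<Rightarrow> 'a elt_or_class set \<Rightarrow> 'a set set \<Rightarrow> bool" where
  "support_partition G X R P \<longleftrightarrow>
     partition_on X P \<and> (\<forall>r\<in>R. \<exists>Y\<in>P. support G X r \<subseteq> Y)"

definition finest_partition ::
  "('a, 'b) monoid_scheme \<Rightarrow> 'a set \<Rightarrow> 'a elt_or_class set \<Rightarrow> 'a set set" where
  "finest_partition G X R =
     (THE P. support_partition G X R P \<and>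
        (\<forall>Q. support_partition G X R Q \<longrightarrow> (\<forall>Y\<in>P. \<exists>Z\<in>Q. Y \<subseteq> Z)))"

text \<open>
  For a basis \<open>X\<close> and \<open>Y \<subseteq> X\<close>, a class \<open>C\<close> of \<open>G\<close> whose support lies in \<open>Y\<close> meets the free factor
  \<open>generate G Y\<close> in exactly one conjugacy class of that subgroup, and is viewed as the latter.
\<close>

fun view_in :: "'a set \<Rightarrow> 'a elt_or_class \<Rightarrow> 'a elt_or_class" where
  "view_in H (Elt g) = Elt g"
| "view_in H (Cls C) = Cls (C \<inter> H)"

definition restricted_to ::
  "('a, 'b) monoid_scheme \<Rightarrow> 'a set \<Rightarrow> 'a elt_or_class set \<Rightarrow> 'a set \<Rightarrow> 'a elt_or_class set" where
  "restricted_to G X R Y = view_in (generate G Y) ` {r \<in> R. support G X r \<subseteq> Y}"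


section \<open>Whitehead graphs and cutvertices\<close>

type_synonym 'v graph = "'v set \<times> ('v \<times> 'v) set"

definition meets :: "'v \<times> 'v \<Rightarrow> 'v set \<Rightarrow> bool" where
  "meets e S \<longleftrightarrow> fst e \<in> S \<or> snd e \<in> S"

definition cutvertex :: "'v graph \<Rightarrow> 'v \<Rightarrow> bool" where
  "cutvertex \<Gamma> v \<longleftrightarrow>
     v \<in> fst \<Gamma> \<and>
     (\<exists>V\<^sub>1 V\<^sub>2. fst \<Gamma> - {v} = V\<^sub>1 \<union> V\<^sub>2 \<and> V\<^sub>1 \<inter> V\<^sub>2 = {} \<and> V\<^sub>1 \<noteq> {} \<and> V\<^sub>2 \<noteq> {} \<and>
        (\<forall>e\<in>snd \<Gamma>. \<not> (meets e V\<^sub>1 \<and> meets e V\<^sub>2)))"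

definition whitehead_graph ::
  "('a, 'b) monoid_scheme \<Rightarrow> 'a set \<Rightarrow> 'a elt_or_class set \<Rightarrow> 'a graph" where
  "whitehead_graph G X R =
     (let E = (\<Union>r\<in>R. turns G X r) in ({v \<in> zero_pm G X. \<exists>e\<in>E. meets e {v}}, E))"

definition cutvertex_free_basis ::
  "('a, 'b) monoid_scheme \<Rightarrow> 'a elt_or_class set \<Rightarrow> 'a set \<Rightarrow> bool" where
  "cutvertex_free_basis G R X \<longleftrightarrow>
     is_basis G X \<and>
     (\<forall>Y\<in>finest_partition G X R. \<forall>v.
        let H = G\<lparr>carrier := generate G Y\<rparr>
        in v \<in> pm H Y \<longrightarrow> \<not> cutvertex (whitehead_graph H Y (restricted_to G X R Y)) v)"

end

theory Submission
  imports Defs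
begin

text \<open>
  The subgroups generated by the blocks of a partition of a basis are the factors of a free product
  decomposition (\<open>factorization_by_blocks\<close>), and a reduced or cyclically reduced word for a member of
  \<open>R\<close> uses letters of one block only, so the decomposition is allocating. The point is that it cannot be
  refined, and this reduces to one block \<open>Y\<close>: if the free group on \<open>Y\<close> splits as a nontrivial free
  product allocating the members of \<open>R\<close> supported in \<open>Y\<close>, and the Whitehead graph has no cutvertex
  besides possibly \<open>\<one>\<close>, then \<open>Y\<close> can be divided into smaller parts that still separate the
  supports (\<open>splitting_separates_basis\<close>), which is impossible for the finest partition.

  Let \<open>\<phi> g\<close> be the index of the factor containing the first syllable of \<open>g\<close> in a given splitting. It
  does not change under right multiplication by elements of factors. Consider the Cayley tree of the
  basis, whose vertices are the reduced words. Between all but finitely many neighbours \<open>\<phi>\<close> is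
  constant, so far out it is constant on each cone, a cone being the set of all extensions
  of a fixed word \<open>w\<close>. A word \<open>r\<close> of an element in a factor, read so that it passes through \<open>w\<close>, begins and
  ends at elements with the same \<open>\<phi>\<close> (\<open>elt_turn\<close>). A cyclic word conjugate into a factor spells a
  line through \<open>w\<close> whose two ends have the same \<open>\<phi>\<close> (\<open>cyc_turn\<close>). Hence a turn of \<open>r\<close> at \<open>w\<close> that avoids
  the direction back to the trivial element identifies the values of \<open>\<phi>\<close> on the two cones into which it
  leads. All directions at \<open>w\<close> but this one are connected by turns, since a vertex of the Whitehead
  graph that is not \<open>\<one>\<close> is not a cutvertex. Descending induction on the length shows that \<open>\<phi>\<close> is
  constant on the cone of every nonempty \<open>w\<close> (\<open>cone_const\<close>).

  Consequently the first letter of an element determines its first factor, there is no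
  cancellation between the syllables of a normal form, and every letter, having length one, lies in a
  factor (\<open>letter_in_factor\<close>). Looking at the turns at the trivial element, all letters of a word of \<open>r\<close>
  lie in the same factor. The letters of one factor form the desired part of \<open>Y\<close>.

  Two configurations need extra care. If \<open>R\<close> has no elements but only classes, then \<open>\<one>\<close> is not
  a vertex of the Whitehead graph and the induction would lose control of \<open>\<phi>\<close> at \<open>w\<close> itself; a
  representative of a class is then adjoined as an element after conjugating the splitting
  (\<open>no_cutvertex_imp_factors\<close>). If some \<open>y\<close> in \<open>Y\<close> occurs in no support, then \<open>Y\<close> is \<open>{y}\<close>, and an
  infinite cyclic group does not split.
\<close>

section \<open>Words and their values\<close>

context group
begin

lemma list_prod_Nil [simp]: "list_prod G [] = \<one>"
  by (simp add: list_prod_def)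

lemma list_prod_Cons [simp]: "list_prod G (x # xs) = x \<otimes> list_prod G xs"
  by (simp add: list_prod_def)

lemma list_prod_closed [simp]: "set xs \<subseteq> carrier G \<Longrightarrow> list_prod G xs \<in> carrier G"
  by (induction xs) auto

lemma list_prod_append:
  "set xs \<subseteq> carrier G \<Longrightarrow> set ys \<subseteq> carrier G \<Longrightarrow>
    list_prod G (xs @ ys) = list_prod G xs \<otimes> list_prod G ys"
  by (induction xs) (auto simp: m_assoc)

lemma list_prod_rev_inv:
  "set xs \<subseteq> carrier G \<Longrightarrow> list_prod G (map (m_inv G) (rev xs)) = inv (list_prod G xs)"
proof (induction xs)
  case (Cons x xs)
  then have "set (map (m_inv G) (rev xs)) \<subseteq> carrier G" by auto
  with Cons show ?case by (simp add: list_prod_append inv_mult_group)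
qed simp

lemma list_prod_concat:
  "\<forall>xs\<in>set xss. set xs \<subseteq> carrier G \<Longrightarrow>
    list_prod G (concat xss) = list_prod G (map (list_prod G) xss)"
  by (induction xss) (auto simp: list_prod_append UN_subset_iff)

lemma list_prod_replicate:
  "x \<in> carrier G \<Longrightarrow> list_prod G (replicate k x) = x [^] k"
proof (induction k)
  case (Suc k)
  then show ?case using nat_pow_Suc2[of x k] by simp
qed simp

lemma list_prod_conj:
  assumes "c \<in> carrier G" "set xs \<subseteq> carrier G"
  shows "list_prod G (map (\<lambda>x. c \<otimes> x \<otimes> inv c) xs) = c \<otimes> list_prod G xs \<otimes> inv c"
  using assms(2)
proof (induction xs)
  case (Cons x xs)
  have cancel: "inv c \<otimes> (c \<otimes> y) = y" if "y \<in> carrier G" for y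
    using that assms(1) by (simp flip: m_assoc)
  from Cons show ?case using assms(1) by (simp add: m_assoc cancel)
qed (use assms in auto)

lemma list_prod_in_subgroup:
  assumes "subgroup H G"
  shows "set xs \<subseteq> H \<Longrightarrow> list_prod G xs \<in> H"
  by (induction xs) (use assms in \<open>auto intro: subgroup.one_closed subgroup.m_closed\<close>)

end

lemma list_prod_carrier_update [simp]: "list_prod (G\<lparr>carrier := H\<rparr>) xs = list_prod G xs"
  by (simp add: list_prod_def)

text \<open>
  For \<open>j\<close> the identity this is \<open>word_value\<close>; other choices of \<open>j\<close> realize the universal property of
  the free group, from which retractions onto the subgroups generated by parts of a basis arise.
\<close>

definition eval_word :: "('b, 'c) monoid_scheme \<Rightarrow> ('a \<Rightarrow> 'b) \<Rightarrow> ('a \<times> bool) list \<Rightarrow> 'b" where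
  "eval_word G j w = list_prod G (map (\<lambda>(x, e). if e then j x else inv\<^bsub>G\<^esub> (j x)) w)"

lemma set_letter_cons: "set (letter_cons l w) \<subseteq> insert l (set w)"
  by (cases w) auto

lemma set_foldr_letter_cons: "set (foldr letter_cons u v) \<subseteq> set u \<union> set v"
proof (induction u)
  case (Cons l u)
  then show ?case using set_letter_cons[of l "foldr letter_cons u v"] by auto
qed simp

lemma letter_cons_reduced:
  "successively (\<lambda>l m. \<not> cancelling l m) w \<Longrightarrow>
    successively (\<lambda>l m. \<not> cancelling l m) (letter_cons l w)"
  by (cases w; cases "tl w") (simp_all add: successively_Cons)

lemma foldr_letter_cons_reduced:
  "successively (\<lambda>l m. \<not> cancelling l m) v \<Longrightarrow>
    successively (\<lambda>l m. \<not> cancelling l m) (foldr letter_cons u v)"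
  by (induction u) (auto intro: letter_cons_reduced)

lemma (in group) eval_word_closed:
  assumes j: "\<And>x. x \<in> A \<Longrightarrow> j x \<in> carrier G" and w: "set w \<subseteq> A \<times> UNIV"
  shows "eval_word G j w \<in> carrier G"
  unfolding eval_word_def
proof (rule list_prod_closed, rule subsetI)
  fix g assume "g \<in> set (map (\<lambda>(x, e). if e then j x else inv (j x)) w)"
  then obtain x e where "(x, e) \<in> set w" "g = (if e then j x else inv (j x))" by auto
  moreover from this w have "j x \<in> carrier G" by (intro j) auto
  ultimately show "g \<in> carrier G" by simp
qed

text \<open>
  Reduction replaces only adjacent pairs \<open>x\<close>, \<open>x\<close>-inverse, whose images under any \<open>j\<close> cancel as well.
\<close>

lemma (in group) eval_word_mult:
  assumes j: "\<And>x. x \<in> A \<Longrightarrow> j x \<in> carrier G" and u: "set u \<subseteq> A \<times> UNIV" and v: "set v \<subseteq> A \<times> UNIV"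
  shows "eval_word G j (foldr letter_cons u v) = eval_word G j u \<otimes> eval_word G j v"
  using u
proof (induction u)
  case Nil
  have "eval_word G j v \<in> carrier G" using j v by (rule eval_word_closed)
  then show ?case by (simp add: eval_word_def)
next
  case (Cons l u)
  have closed: "eval_word G j w \<in> carrier G" if "set w \<subseteq> A \<times> UNIV" for w
    using j that by (rule eval_word_closed)
  define L where "L = (\<lambda>(x, e::bool). if e then j x else inv (j x))"
  have L: "L l \<in> carrier G" if "l \<in> A \<times> UNIV" for l
  proof (cases l)
    case (Pair x e)
    then have "j x \<in> carrier G" using that by (intro j) simp
    then show ?thesis by (simp add: L_def Pair)
  qed
  have eval_Cons: "eval_word G j (l # w) = L l \<otimes> eval_word G j w" for l w
    by (simp only: eval_word_def L_def list.map list_prod_Cons)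
  have step: "eval_word G j (letter_cons l w) = L l \<otimes> eval_word G j w" if w: "set w \<subseteq> A \<times> UNIV" for w
  proof (cases "w \<noteq> [] \<and> cancelling l (hd w)")
    case True
    then obtain m w' where w': "w = m # w'" and c: "cancelling l m" by (cases w) auto
    have carrier: "L l \<in> carrier G" "L m \<in> carrier G" "eval_word G j w' \<in> carrier G"
      using L[of l] L[of m] closed[of w'] Cons.prems w unfolding w' by simp_all
    obtain x e where l: "l = (x, e)" "m = (x, \<not> e)" "x \<in> A"
      using c Cons.prems by (cases l; cases m) (auto simp: cancelling_def)
    have "L l \<otimes> L m = \<one>"
      using j[OF l(3)] by (simp add: L_def l)
    then show ?thesis
      using carrier c by (simp add: w' eval_Cons flip: m_assoc)
  next
    case False
    then have "letter_cons l w = l # w" by (cases w) auto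
    then show ?thesis by (simp only: eval_Cons)
  qed
  have "set (foldr letter_cons u v) \<subseteq> A \<times> UNIV"
    using set_foldr_letter_cons[of u v] Cons.prems v by auto
  then have "eval_word G j (foldr letter_cons (l # u) v) = L l \<otimes> eval_word G j (foldr letter_cons u v)"
    using step by simp
  also have "\<dots> = L l \<otimes> eval_word G j u \<otimes> eval_word G j v"
    using Cons closed[of u] closed[of v] L[of l] v by (simp add: m_assoc)
  finally show ?case by (simp only: eval_Cons)
qed

section \<open>Groups with a basis\<close>

text \<open>
  From here on words are lists of group elements taken from the basis and its inverses, rather than
  lists of formal letters: turns are pairs of group elements, so this is the form in which Whitehead
  graphs see words. The translation is faithful because distinct formal letters have distinct values.
\<close>

locale based_group = group G for G (structure) +
  fixes X
  assumes basis: "is_basis G X"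
begin

definition letters where "letters = pm G X"

definition reduced :: "'a list \<Rightarrow> bool" where
  "reduced xs \<longleftrightarrow> set xs \<subseteq> letters \<and> successively (\<lambda>a b. inv a \<noteq> b) xs"

lemma basis_carrier: "X \<subseteq> carrier G"
  using basis by (auto simp: is_basis_def)

lemma letters_carrier: "letters \<subseteq> carrier G"
  using basis_carrier by (auto simp: letters_def pm_def)

lemma letter_carrier [simp]: "x \<in> letters \<Longrightarrow> x \<in> carrier G"
  using letters_carrier by auto

lemma letters_inv [simp]: "x \<in> letters \<Longrightarrow> inv x \<in> letters"
  using basis_carrier by (auto simp: letters_def pm_def)

lemma reduced_carrier: "reduced xs \<Longrightarrow> set xs \<subseteq> carrier G"
  using letters_carrier by (auto simp: reduced_def)

abbreviation lval :: "'a \<times> bool \<Rightarrow> 'a" where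
  "lval \<equiv> \<lambda>(x, e). if e then x else inv x"

lemma word_value_lval: "word_value G w = list_prod G (map lval w)"
  by (simp add: word_value_def)

lemma word_value_inj:
  assumes "set u \<subseteq> X \<times> UNIV" "successively (\<lambda>l m. \<not> cancelling l m) u"
    and "set v \<subseteq> X \<times> UNIV" "successively (\<lambda>l m. \<not> cancelling l m) v"
    and "word_value G u = word_value G v"
  shows "u = v"
  using basis assms inj_onD[of "word_value G" "carrier (free_group_on X)" u v]
  by (auto simp: is_basis_def iso_def bij_betw_def free_group_on_def)

lemma lval_closed: "l \<in> X \<times> UNIV \<Longrightarrow> lval l \<in> letters"
  by (auto simp: letters_def pm_def)

lemma lval_inj:
  assumes "l \<in> X \<times> UNIV" "m \<in> X \<times> UNIV" "lval l = lval m"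
  shows "l = m"
  using word_value_inj[of "[l]" "[m]"] assms
  by (auto simp: word_value_lval split: prod.splits)

lemma lval_surj: "x \<in> letters \<Longrightarrow> \<exists>l\<in>X \<times> UNIV. x = lval l"
  unfolding letters_def pm_def
proof (elim UnE imageE)
  assume "x \<in> X" then show ?thesis by (intro bexI[of _ "(x, True)"]) auto
next
  fix y assume "x = inv y" "y \<in> X" then show ?thesis by (intro bexI[of _ "(y, False)"]) auto
qed

lemma cancelling_iff:
  assumes "l \<in> X \<times> UNIV" "m \<in> X \<times> UNIV"
  shows "cancelling l m \<longleftrightarrow> inv (lval l) = lval m"
proof -
  obtain x e where l: "l = (x, e)" by (cases l)
  have x: "x \<in> carrier G" using assms l basis_carrier by auto
  have "inv (lval l) = lval (x, \<not> e)" using x by (simp add: l)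
  then have "inv (lval l) = lval m \<longleftrightarrow> (x, \<not> e) = m"
    using lval_inj[of "(x, \<not> e)" m] assms l by auto
  then show ?thesis by (cases m) (auto simp: l cancelling_def)
qed

lemma letter_neq_one [simp]: "x \<in> letters \<Longrightarrow> x \<noteq> \<one>"
proof
  assume "x \<in> letters" "x = \<one>"
  then obtain l where l: "l \<in> X \<times> UNIV" "\<one> = lval l" using lval_surj by metis
  from l(2) have "word_value G [] = word_value G [l]"
    using l(1) basis_carrier by (simp add: word_value_lval flip: l(2))
  then show False using word_value_inj[of "[]" "[l]"] l by auto
qed

lemma letter_inv_neq [simp]: "x \<in> letters \<Longrightarrow> inv x \<noteq> x"
proof
  assume "x \<in> letters" "inv x = x"
  then obtain l where l: "l \<in> X \<times> UNIV" "x = lval l" using lval_surj by metis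
  with \<open>inv x = x\<close> have "cancelling l l" using cancelling_iff[of l l] by metis
  then show False by (simp add: cancelling_def)
qed

lemma reduced_map_lval:
  assumes "set w \<subseteq> X \<times> UNIV"
  shows "reduced (map lval w) \<longleftrightarrow> successively (\<lambda>l m. \<not> cancelling l m) w"
proof -
  have "set (map lval w) \<subseteq> letters"
    using assms lval_closed by fastforce
  moreover have "successively (\<lambda>a b. inv a \<noteq> b) (map lval w) \<longleftrightarrow>
      successively (\<lambda>l m. \<not> cancelling l m) w"
    unfolding successively_map
  proof (rule successively_cong)
    fix l m assume "l \<in> set w" "m \<in> set w"
    then have "cancelling l m \<longleftrightarrow> inv (lval l) = lval m"
      using assms by (intro cancelling_iff) auto
    then show "(inv (lval l) \<noteq> lval m) = (\<not> cancelling l m)" by simp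
  qed simp
  ultimately show ?thesis by (simp add: reduced_def)
qed

lemma letters_list_lval: "set xs \<subseteq> letters \<Longrightarrow> \<exists>w. set w \<subseteq> X \<times> UNIV \<and> xs = map lval w"
proof (induction xs)
  case (Cons x xs)
  then obtain w l where "set w \<subseteq> X \<times> UNIV" "xs = map lval w" "l \<in> X \<times> UNIV" "x = lval l"
    using lval_surj[of x] by auto
  then show ?case by (intro exI[of _ "l # w"]) auto
qed simp

lemma reduced_unique:
  assumes "reduced xs" "reduced ys" "list_prod G xs = list_prod G ys"
  shows "xs = ys"
proof -
  obtain u where u: "set u \<subseteq> X \<times> UNIV" "xs = map lval u"
    using letters_list_lval[of xs] assms(1) by (auto simp: reduced_def)
  obtain v where v: "set v \<subseteq> X \<times> UNIV" "ys = map lval v"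
    using letters_list_lval[of ys] assms(2) by (auto simp: reduced_def)
  show ?thesis
    using word_value_inj[of u v] u v assms reduced_map_lval[of u] reduced_map_lval[of v]
    by (simp add: word_value_lval)
qed

lemma reduced_exists:
  assumes "g \<in> carrier G"
  shows "\<exists>xs. reduced xs \<and> list_prod G xs = g"
proof -
  have "word_value G ` carrier (free_group_on X) = carrier G"
    using basis by (auto simp: is_basis_def iso_def bij_betw_def)
  then obtain w where "w \<in> carrier (free_group_on X)" "word_value G w = g"
    using assms by (metis (no_types, lifting) imageE)
  then show ?thesis
    using reduced_map_lval[of w]
    by (intro exI[of _ "map lval w"]) (auto simp: free_group_on_def word_value_lval)
qed

definition nword :: "'a \<Rightarrow> 'a list" where
  "nword g = (THE xs. reduced xs \<and> list_prod G xs = g)"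

lemma nword:
  assumes "g \<in> carrier G"
  shows "reduced (nword g)" "list_prod G (nword g) = g"
proof -
  have "\<exists>!xs. reduced xs \<and> list_prod G xs = g"
    using reduced_exists[OF assms] reduced_unique by blast
  from theI'[OF this] show "reduced (nword g)" "list_prod G (nword g) = g"
    by (auto simp: nword_def)
qed

lemma nword_list_prod [simp]: "reduced xs \<Longrightarrow> nword (list_prod G xs) = xs"
  using reduced_unique[OF nword(1) _ nword(2)] list_prod_closed[OF reduced_carrier] by simp

lemma reduced_Nil [simp]: "reduced []"
  by (simp add: reduced_def)

lemma reduced_Cons: "reduced (x # xs) \<longleftrightarrow>
    x \<in> letters \<and> reduced xs \<and> (xs \<noteq> [] \<longrightarrow> inv x \<noteq> hd xs)"
  by (auto simp: reduced_def successively_Cons)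

lemma reduced_append: "reduced (xs @ ys) \<longleftrightarrow>
    reduced xs \<and> reduced ys \<and> (xs \<noteq> [] \<longrightarrow> ys \<noteq> [] \<longrightarrow> inv (last xs) \<noteq> hd ys)"
  by (auto simp: reduced_def successively_append_iff)

lemma reduced_singleton [simp]: "reduced [x] \<longleftrightarrow> x \<in> letters"
  by (simp add: reduced_Cons)

lemma reduced_prod_one_iff: "reduced xs \<Longrightarrow> list_prod G xs = \<one> \<longleftrightarrow> xs = []"
  using reduced_unique[of xs "[]"] by auto

lemma letters_inv_iff: "a \<in> letters \<Longrightarrow> b \<in> letters \<Longrightarrow> inv a = b \<longleftrightarrow> a = inv b"
  using letter_carrier by (metis inv_inv)

lemma reduced_rev_inv:
  assumes "reduced xs"
  shows "reduced (map (m_inv G) (rev xs))"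
proof -
  have "set xs \<subseteq> letters" using assms by (simp add: reduced_def)
  moreover have "successively (\<lambda>a b. inv a \<noteq> b) xs" using assms by (simp add: reduced_def)
  then have "successively (\<lambda>a b. inv (inv b) \<noteq> inv a) xs"
    by (rule successively_mono) (use \<open>set xs \<subseteq> letters\<close> letter_carrier in \<open>auto simp: subset_iff\<close>)
  ultimately show ?thesis
    by (auto simp: reduced_def successively_map)
qed

lemma nword_inv: "g \<in> carrier G \<Longrightarrow> nword (inv g) = map (m_inv G) (rev (nword g))"
  using nword[of g] reduced_rev_inv[of "nword g"] list_prod_rev_inv[of "nword g"]
    nword_list_prod[of "map (m_inv G) (rev (nword g))"] reduced_carrier[of "nword g"] by simp

lemma nword_Nil_iff: "g \<in> carrier G \<Longrightarrow> nword g = [] \<longleftrightarrow> g = \<one>"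
  using nword[of g] reduced_prod_one_iff[of "nword g"] by auto

end

section \<open>Splittings\<close>

text \<open>
  A factorization enters the argument only through the map \<open>\<phi>\<close> that sends a nontrivial element to the
  index of the first syllable of its normal form. Right multiplication by an element of a factor does
  not touch the first syllable, unless the product or the element itself is trivial; this is the
  assumption \<open>\<phi>_mult\<close>. In terms of the Bass-Serre tree of the factorization, \<open>\<phi> f\<close> is the direction in
  which the translate by \<open>f\<close> of the base vertex lies. Keeping \<open>\<phi>\<close> abstract makes conjugating
  all the factors simultaneously (\<open>conj_split\<close> below) a mere change of variables.
\<close>

locale split_group = group G for G (structure) +
  fixes I :: "'i set" and Hs :: "'i \<Rightarrow> 'a set" and \<phi> :: "'a \<Rightarrow> 'i"
  assumes factor: "i \<in> I \<Longrightarrow> subgroup (Hs i) G"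
    and \<phi>_factor: "i \<in> I \<Longrightarrow> h \<in> Hs i \<Longrightarrow> h \<noteq> \<one> \<Longrightarrow> \<phi> h = i"
    and \<phi>_mult: "f \<in> carrier G \<Longrightarrow> f \<noteq> \<one> \<Longrightarrow> i \<in> I \<Longrightarrow> h \<in> Hs i \<Longrightarrow> f \<otimes> h \<noteq> \<one> \<Longrightarrow> \<phi> (f \<otimes> h) = \<phi> f"
    and normal_form: "f \<in> carrier G \<Longrightarrow> \<exists>s. (\<forall>(i, a)\<in>set s. i \<in> I \<and> a \<in> Hs i \<and> a \<noteq> \<one>) \<and>
          distinct_adj (map fst s) \<and> list_prod G (map snd s) = f"
begin

lemma factor_carrier: "i \<in> I \<Longrightarrow> h \<in> Hs i \<Longrightarrow> h \<in> carrier G"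
  using factor subgroup.mem_carrier by metis

text \<open>
  Write \<open>c\<close> as a product of elements of factors. Appending one of them to an element changes the index
  only if the element or the product is trivial, so each syllable of \<open>c\<close> is responsible for at most
  two elements.
\<close>

lemma finite_index_changes:
  assumes "c \<in> carrier G"
  shows "finite {f \<in> carrier G. \<phi> f \<noteq> \<phi> (f \<otimes> c)}"
proof -
  have *: "finite {f \<in> carrier G. \<phi> f \<noteq> \<phi> (f \<otimes> list_prod G gs)}"
    if "set gs \<subseteq> (\<Union>i\<in>I. Hs i)" for gs
    using that
  proof (induction gs)
    case (Cons g gs)
    then obtain i where i: "i \<in> I" "g \<in> Hs i" by auto
    have g: "g \<in> carrier G" using i factor_carrier by blast
    have gs: "list_prod G gs \<in> carrier G" using Cons.prems factor_carrier by (intro list_prod_closed) auto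
    let ?B = "{f \<in> carrier G. \<phi> f \<noteq> \<phi> (f \<otimes> list_prod G gs)}"
    have "{f \<in> carrier G. \<phi> f \<noteq> \<phi> (f \<otimes> list_prod G (g # gs))} \<subseteq>
        {\<one>, inv g} \<union> (\<lambda>f. f \<otimes> inv g) ` ?B"
    proof
      fix f assume f: "f \<in> {f \<in> carrier G. \<phi> f \<noteq> \<phi> (f \<otimes> list_prod G (g # gs))}"
      then have fc: "f \<in> carrier G" by simp
      show "f \<in> {\<one>, inv g} \<union> (\<lambda>f. f \<otimes> inv g) ` ?B"
      proof (cases "f = \<one> \<or> f \<otimes> g = \<one>")
        case True
        then show ?thesis using fc g inv_equality by fastforce
      next
        case False
        then have "\<phi> (f \<otimes> g) = \<phi> f" using \<phi>_mult fc i by blast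
        then have "f \<otimes> g \<in> ?B" using f fc g gs by (simp add: m_assoc)
        moreover have "f = f \<otimes> g \<otimes> inv g" using fc g by (simp add: m_assoc)
        ultimately show ?thesis by blast
      qed
    qed
    moreover have "finite ?B" using Cons by simp
    ultimately show ?case by (meson finite.emptyI finite.insertI finite_UnI finite_imageI finite_subset)
  next
    case Nil
    have "{f \<in> carrier G. \<phi> f \<noteq> \<phi> (f \<otimes> list_prod G [])} = {}" by auto
    then show ?case by (simp only: finite.emptyI)
  qed
  obtain s where "\<forall>(i, a)\<in>set s. i \<in> I \<and> a \<in> Hs i \<and> a \<noteq> \<one>" "list_prod G (map snd s) = c"
    using normal_form[OF assms] by blast
  then show ?thesis using *[of "map snd s"] by fastforce
qed

lemma conj_pow:
  assumes "c \<in> carrier G" "h \<in> carrier G"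
  shows "(c \<otimes> h \<otimes> inv c) [^] (k::nat) = c \<otimes> h [^] k \<otimes> inv c"
  using list_prod_conj[OF assms(1), of "replicate k h"] assms
  by (simp add: list_prod_replicate set_replicate_conv_if)

lemma inj_pow_conj:
  assumes "c \<in> carrier G" "h \<in> carrier G" "g \<in> carrier G"
    and "inj (\<lambda>k::nat. (c \<otimes> h \<otimes> inv c) [^] k)"
  shows "inj (\<lambda>k::nat. g \<otimes> h [^] k)"
  using assms by (auto simp: inj_on_def conj_pow)

text \<open>
  The sequence \<open>g r\<^sup>k\<close>, for integers \<open>k\<close>, is a line whose two ends lie on the same side of the
  splitting if \<open>r\<close> is conjugate into a factor: up to finitely many exceptions, \<open>\<phi> (g c h\<^sup>k (inv c))\<close> equals
  \<open>\<phi> (g c h\<^sup>k)\<close>, and the elements \<open>g c h\<^sup>k\<close> differ from each other by elements of a factor.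
\<close>

lemma line_ends:
  assumes c: "c \<in> carrier G" and h: "i \<in> I" "h \<in> Hs i" and r: "r = c \<otimes> h \<otimes> inv c"
    and inj: "inj (\<lambda>k::nat. r [^] k)" and g: "g \<in> carrier G"
  shows "\<exists>k. \<phi> (g \<otimes> r [^] Suc k) = \<phi> (g \<otimes> (inv r) [^] Suc k)"
proof -
  have hc: "h \<in> carrier G" using h factor_carrier by blast
  interpret H: subgroup "Hs i" G using factor h by simp
  have inv_r: "inv r = c \<otimes> inv h \<otimes> inv c"
    using c hc by (simp add: r inv_mult_group m_assoc)
  have inj': "inj (\<lambda>k::nat. (inv r) [^] k)"
  proof (rule injI)
    fix k l :: nat assume "inv r [^] k = inv r [^] l"
    then have "inv (r [^] k) = inv (r [^] l)" using c hc by (simp add: r nat_pow_inv)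
    moreover have "r [^] k \<in> carrier G" "r [^] l \<in> carrier G" using c hc by (simp_all add: r)
    ultimately have "r [^] k = r [^] l" using inv_inv by metis
    then show "k = l" using injD[OF inj] by simp
  qed
  define B where "B = insert \<one> {f \<in> carrier G. \<phi> f \<noteq> \<phi> (f \<otimes> inv c)}"
  have "finite B" unfolding B_def using finite_index_changes c by simp
  have "inj (\<lambda>k::nat. g \<otimes> c \<otimes> h [^] k)"
    using inj_pow_conj[of c h "g \<otimes> c"] c hc g inj by (simp add: r)
  with \<open>finite B\<close> have f1: "finite ((\<lambda>k::nat. g \<otimes> c \<otimes> h [^] k) -` B)"
    by (rule finite_vimageI)
  have "inj (\<lambda>k::nat. g \<otimes> c \<otimes> (inv h) [^] k)"
    using inj_pow_conj[of c "inv h" "g \<otimes> c"] c hc g inj' by (simp add: inv_r)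
  with \<open>finite B\<close> have f2: "finite ((\<lambda>k::nat. g \<otimes> c \<otimes> (inv h) [^] k) -` B)"
    by (rule finite_vimageI)
  have "infinite ({0::nat<..} - ((\<lambda>k::nat. g \<otimes> c \<otimes> h [^] k) -` B \<union> (\<lambda>k::nat. g \<otimes> c \<otimes> (inv h) [^] k) -` B))"
    using f1 f2 by (intro Diff_infinite_finite) (auto simp: infinite_Ioi)
  then obtain k :: nat where "k \<in> {0<..} - ((\<lambda>k::nat. g \<otimes> c \<otimes> h [^] k) -` B \<union> (\<lambda>k::nat. g \<otimes> c \<otimes> (inv h) [^] k) -` B)"
    using infinite_imp_nonempty by blast
  then have k: "k > 0" "g \<otimes> c \<otimes> h [^] k \<notin> B" "g \<otimes> c \<otimes> (inv h) [^] k \<notin> B"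
    by auto
  then obtain k' where k': "k = Suc k'" by (cases k) auto
  let ?f = "g \<otimes> c \<otimes> h [^] k" and ?f' = "g \<otimes> c \<otimes> (inv h) [^] k"
  have car: "?f \<in> carrier G" "?f' \<in> carrier G" "h [^] k \<in> carrier G" "(inv h) [^] k \<in> carrier G"
    using g c hc by auto
  have r_pow: "r [^] k = c \<otimes> h [^] k \<otimes> inv c" "(inv r) [^] k = c \<otimes> (inv h) [^] k \<otimes> inv c"
    using c hc by (simp_all only: r inv_r[unfolded r] conj_pow inv_closed)
  have "\<phi> (g \<otimes> r [^] k) = \<phi> (?f \<otimes> inv c)" using g c hc by (simp add: r_pow m_assoc)
  also have "\<dots> = \<phi> ?f" using k car by (auto simp: B_def)
  also have "\<phi> ?f = \<phi> ?f'"
  proof -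
    have "?f' = ?f \<otimes> (inv (h [^] k) \<otimes> (inv h) [^] k)"
    proof -
      have "h [^] k \<otimes> (inv (h [^] k) \<otimes> (inv h) [^] k) = (inv h) [^] k"
        using car(3,4) by (simp flip: m_assoc)
      then show ?thesis using car(3,4) g c by (simp add: m_assoc)
    qed
    moreover have "h [^] k \<in> Hs i" "(inv h) [^] k \<in> Hs i"
      using h hc list_prod_in_subgroup[OF H.subgroup_axioms, of "replicate k x" for x]
      by (simp_all add: list_prod_replicate[symmetric] set_replicate_conv_if)
    then have "inv (h [^] k) \<otimes> (inv h) [^] k \<in> Hs i" by simp
    ultimately show ?thesis
      using \<phi>_mult[OF car(1) _ h(1)] k by (auto simp: B_def)
  qed
  also have "\<phi> ?f' = \<phi> (?f' \<otimes> inv c)" using k car by (auto simp: B_def)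
  also have "\<dots> = \<phi> (g \<otimes> (inv r) [^] k)"
    using g c hc by (simp add: r_pow m_assoc)
  finally show ?thesis unfolding k' by blast
qed

lemma conj_split:
  assumes c: "c \<in> carrier G"
  shows "split_group G I (\<lambda>i. (\<lambda>x. c \<otimes> x \<otimes> inv c) ` Hs i) (\<lambda>f. \<phi> (inv c \<otimes> f \<otimes> c))"
proof -
  define K where "K = (\<lambda>x. c \<otimes> x \<otimes> inv c)"
  have K_inv: "inv c \<otimes> K x \<otimes> c = x" if "x \<in> carrier G" for x
    using that c by (simp add: K_def m_assoc) (simp flip: m_assoc)
  have K_inv': "K (inv c \<otimes> x \<otimes> c) = x" if "x \<in> carrier G" for x
    using that c by (simp add: K_def m_assoc) (simp flip: m_assoc)
  have K_one: "K \<one> = \<one>" using c by (simp add: K_def)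
  have K_hom: "K (x \<otimes> y) = K x \<otimes> K y" if "x \<in> carrier G" "y \<in> carrier G" for x y
    using that c by (simp add: K_def m_assoc) (simp flip: m_assoc[of "inv c" c])
  have K_closed: "K x \<in> carrier G" if "x \<in> carrier G" for x
    using that c by (simp add: K_def)
  interpret K: group_hom G G K
    by unfold_locales (auto simp: hom_def K_closed K_hom)
  have "split_group G I (\<lambda>i. K ` Hs i) (\<lambda>f. \<phi> (inv c \<otimes> f \<otimes> c))"
  proof (intro split_group.intro group_axioms split_group_axioms.intro)
    show "subgroup (K ` Hs i) G" if "i \<in> I" for i
      using K.subgroup_img_is_subgroup factor[OF that] by blast
    show "\<phi> (inv c \<otimes> h \<otimes> c) = i" if h: "i \<in> I" "h \<in> K ` Hs i" "h \<noteq> \<one>" for i h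
    proof -
      obtain x where x: "x \<in> Hs i" "h = K x" using imageE[OF h(2)] .
      then have "x \<noteq> \<one>" using h(3) K_one by auto
      then show ?thesis
        using x K_inv[of x] factor_carrier[OF h(1) x(1)] \<phi>_factor[OF h(1) x(1)] by simp
    qed
    show "\<phi> (inv c \<otimes> (f \<otimes> h) \<otimes> c) = \<phi> (inv c \<otimes> f \<otimes> c)"
      if f: "f \<in> carrier G" "f \<noteq> \<one>" and i: "i \<in> I" "h \<in> K ` Hs i" and fh: "f \<otimes> h \<noteq> \<one>" for f i h
    proof -
      obtain x where x: "x \<in> Hs i" "h = K x" using imageE[OF i(2)] .
      have xc: "x \<in> carrier G" using x i factor_carrier by auto
      define f' where "f' = inv c \<otimes> f \<otimes> c"
      have f': "f' \<in> carrier G" "f = K f'" using f c K_inv' by (auto simp: f'_def)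
      have "f \<otimes> h = K (f' \<otimes> x)" using f' x xc K_hom by simp
      then have "inv c \<otimes> (f \<otimes> h) \<otimes> c = f' \<otimes> x" by (simp only:) (use f' xc K_inv in blast)
      moreover have "f' \<otimes> x \<noteq> \<one>" "f' \<noteq> \<one>"
        using fh f(2) \<open>f \<otimes> h = K (f' \<otimes> x)\<close> f'(2) K_one by metis+
      then have "\<phi> (f' \<otimes> x) = \<phi> f'"
        using \<phi>_mult[OF f'(1) _ i(1) x(1)] by simp
      ultimately show ?thesis by (simp only: f'_def)
    qed
    show "\<exists>s. (\<forall>(i, a)\<in>set s. i \<in> I \<and> a \<in> K ` Hs i \<and> a \<noteq> \<one>) \<and>
        distinct_adj (map fst s) \<and> list_prod G (map snd s) = f" if f: "f \<in> carrier G" for f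
    proof -
      obtain s where s: "\<forall>(i, a)\<in>set s. i \<in> I \<and> a \<in> Hs i \<and> a \<noteq> \<one>" "distinct_adj (map fst s)"
        "list_prod G (map snd s) = inv c \<otimes> f \<otimes> c"
        using normal_form[of "inv c \<otimes> f \<otimes> c"] f c by auto
      let ?s = "map (\<lambda>(i, a). (i, K a)) s"
      have sc: "set (map snd s) \<subseteq> carrier G" using s(1) factor_carrier by fastforce
      have K_neq: "K a \<noteq> \<one>" if "a \<in> carrier G" "a \<noteq> \<one>" for a
      proof
        assume "K a = \<one>"
        then show False using K_inv[OF that(1)] that(2) c by simp
      qed
      have "i \<in> I \<and> a \<in> K ` Hs i \<and> a \<noteq> \<one>" if ia: "(i, a) \<in> set ?s" for i a
      proof -
        obtain b where b: "(i, b) \<in> set s" "a = K b" using ia by auto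
        then have "i \<in> I" "b \<in> Hs i" "b \<noteq> \<one>" using s(1) by auto
        then show ?thesis using b K_neq[of b] factor_carrier[of i b] by auto
      qed
      then have "\<forall>(i, a)\<in>set ?s. i \<in> I \<and> a \<in> K ` Hs i \<and> a \<noteq> \<one>" by blast
      moreover have "map fst ?s = map fst s" by auto
      moreover have "map snd ?s = map K (map snd s)" by auto
      then have "list_prod G (map snd ?s) = K (list_prod G (map snd s))"
        by (simp only: K_def list_prod_conj[OF c sc])
      then have "list_prod G (map snd ?s) = f" using K_inv' f s(3) by simp
      ultimately show ?thesis using s(2) by (intro exI[of _ ?s] conjI) (simp_all only:)
    qed
  qed
  then show ?thesis by (simp add: K_def)
qed

end

section \<open>The first-factor index on cones\<close>

definition (in based_group) cyc_reduced :: "'a list \<Rightarrow> bool" where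
  "cyc_reduced xs \<longleftrightarrow> xs \<noteq> [] \<and> reduced xs \<and> inv (last xs) \<noteq> hd xs"

text \<open>
  The turns of an element, indexed by the ways of cutting its word in two instead of by positions: the
  parts \<open>p\<close> and \<open>q\<close> are the paths leading from the cut to the two ends of the word.
\<close>

definition (in group) lin_turns :: "'a list \<Rightarrow> ('a \<times> 'a) set" where
  "lin_turns xs = {(if p = [] then \<one> else inv (last p), if q = [] then \<one> else hd q) | p q. xs = p @ q}"

definition (in group) cyc_turns :: "'a list \<Rightarrow> ('a \<times> 'a) set" where
  "cyc_turns xs = {(inv (last (rotate k xs)), hd (rotate k xs)) | k. True}"

context based_group
begin

lemma cyc_reduced_rotate1: "cyc_reduced xs \<Longrightarrow> cyc_reduced (rotate1 xs)"
  by (cases xs) (auto simp: cyc_reduced_def reduced_append reduced_Cons split: if_splits)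

lemma cyc_reduced_rev_inv:
  assumes "cyc_reduced xs"
  shows "cyc_reduced (map (m_inv G) (rev xs))"
proof -
  have xs: "xs \<noteq> []" "reduced xs" "inv (last xs) \<noteq> hd xs" using assms by (auto simp: cyc_reduced_def)
  then have "last xs \<in> letters" "hd xs \<in> letters" by (auto simp: reduced_def)
  then show ?thesis
    using xs reduced_rev_inv[OF xs(2)] letters_inv_iff[of "last xs" "hd xs"]
    by (auto simp: cyc_reduced_def last_map hd_map last_rev hd_rev)
qed

lemma concat_replicate_ends:
  assumes "xs \<noteq> []"
  shows "concat (replicate (Suc k) xs) \<noteq> []" "hd (concat (replicate (Suc k) xs)) = hd xs"
  using assms by auto

lemma cyc_reduced_power:
  assumes "cyc_reduced xs"
  shows "reduced (concat (replicate k xs))"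
proof (induction k)
  case (Suc k)
  then show ?case
    using assms concat_replicate_ends(2)[of xs "k - 1"] by (cases k) (auto simp: cyc_reduced_def reduced_append)
qed simp

lemma list_prod_power:
  assumes "reduced xs"
  shows "list_prod G (concat (replicate k xs)) = list_prod G xs [^] k"
  using list_prod_concat[of "replicate k xs"] list_prod_replicate[of "list_prod G xs" k]
    reduced_carrier[OF assms] by (simp add: set_replicate_conv_if map_replicate)

lemma cyc_reduced_inj_pow:
  assumes "cyc_reduced xs"
  shows "inj (\<lambda>k::nat. list_prod G xs [^] k)"
proof (rule injI)
  fix k l :: nat
  have r: "reduced xs" "xs \<noteq> []" using assms by (auto simp: cyc_reduced_def)
  assume "list_prod G xs [^] k = list_prod G xs [^] l"
  then have "concat (replicate k xs) = concat (replicate l xs)"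
    by (intro reduced_unique cyc_reduced_power assms) (simp only: list_prod_power[OF r(1)])
  then have "length (concat (replicate k xs)) = length (concat (replicate l xs))" by simp
  then show "k = l" using r(2) by (simp add: length_concat sum_list_replicate)
qed

end

locale based_split = based_group G X + split_group G I Hs \<phi>
  for G (structure) and X and I :: "'i set" and Hs \<phi> +
  assumes finite_X: "finite X"
begin

lemma finite_letters: "finite letters"
  using finite_X by (simp add: letters_def pm_def)

text \<open>
  The cone of \<open>w\<close> consists of the elements whose reduced word extends \<open>w\<close>: the part of the Cayley tree
  beyond \<open>w\<close>.
\<close>

definition cone_const :: "'a list \<Rightarrow> bool" where
  "cone_const w \<longleftrightarrow> (\<forall>u. reduced (w @ u) \<longrightarrow> \<phi> (list_prod G (w @ u)) = \<phi> (list_prod G w))"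

text \<open>
  Moving from an element to a neighbour in the Cayley tree changes the index at finitely many elements
  only, and sufficiently far out there is none of them.
\<close>

lemma long_cone_const: "\<exists>N. \<forall>w. reduced w \<longrightarrow> N \<le> length w \<longrightarrow> cone_const w"
proof -
  define B where "B = (\<Union>l\<in>letters. {f \<in> carrier G. \<phi> f \<noteq> \<phi> (f \<otimes> l)})"
  have "finite B"
    unfolding B_def using finite_letters finite_index_changes by (intro finite_UN_I) auto
  define N where "N = Suc (Max (insert 0 (length ` nword ` B)))"
  have N: "length (nword f) < N" if "f \<in> B" for f
    using that \<open>finite B\<close> by (auto simp: N_def less_Suc_eq_le)
  have "cone_const w" if w: "reduced w" "N \<le> length w" for w
    unfolding cone_const_def
  proof (intro allI impI)
    fix u assume "reduced (w @ u)"
    then show "\<phi> (list_prod G (w @ u)) = \<phi> (list_prod G w)"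
    proof (induction u rule: rev_induct)
      case (snoc l u)
      then have r: "reduced (w @ u)" "l \<in> letters"
        using reduced_append[of "w @ u" "[l]"] by auto
      have c: "list_prod G (w @ u) \<in> carrier G"
        using list_prod_closed[OF reduced_carrier[OF r(1)]] .
      have "list_prod G (w @ u) \<notin> B"
        using N[of "list_prod G (w @ u)"] r w(2) by auto
      then have "\<phi> (list_prod G (w @ u) \<otimes> l) = \<phi> (list_prod G (w @ u))"
        using c r by (auto simp: B_def)
      moreover have "list_prod G ((w @ u) @ [l]) = list_prod G (w @ u) \<otimes> l"
        using r reduced_carrier[OF r(1)] by (subst list_prod_append) auto
      ultimately show ?case using snoc.IH[OF r(1)] by simp
    qed simp
  qed
  then show ?thesis by blast
qed

lemma cone_hd:
  assumes "reduced (w @ v)" "v \<noteq> []" "cone_const (w @ [hd v])"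
  shows "\<phi> (list_prod G (w @ v)) = \<phi> (list_prod G w \<otimes> hd v)"
proof -
  have v: "w @ v = (w @ [hd v]) @ tl v" using assms(2) by simp
  have "set (w @ [hd v]) \<subseteq> carrier G"
    using reduced_carrier[OF assms(1)] assms(2) by auto
  then show ?thesis
    using assms(1,3) unfolding v cone_const_def by (simp add: list_prod_append)
qed

definition elt_word :: "'a list \<Rightarrow> bool" where
  "elt_word xs \<longleftrightarrow> xs \<noteq> [] \<and> reduced xs \<and> (\<exists>i\<in>I. list_prod G xs \<in> Hs i)"

definition cls_word :: "'a list \<Rightarrow> bool" where
  "cls_word xs \<longleftrightarrow> cyc_reduced xs \<and>
     (\<exists>i\<in>I. \<exists>c\<in>carrier G. \<exists>h\<in>Hs i. list_prod G xs = c \<otimes> h \<otimes> inv c)"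

lemma cls_word_rotate1: "cls_word xs \<Longrightarrow> cls_word (rotate1 xs)"
proof -
  assume xs: "cls_word xs"
  then obtain i c h where h: "i \<in> I" "c \<in> carrier G" "h \<in> Hs i" "list_prod G xs = c \<otimes> h \<otimes> inv c"
    by (auto simp: cls_word_def)
  have cyc: "cyc_reduced xs" using xs by (simp add: cls_word_def)
  then obtain x zs where zs: "xs = x # zs" by (cases xs) (auto simp: cyc_reduced_def)
  have car: "x \<in> carrier G" "set zs \<subseteq> carrier G" "h \<in> carrier G"
    using cyc reduced_carrier[of xs] factor_carrier[OF h(1,3)] by (auto simp: cyc_reduced_def zs)
  have "list_prod G (rotate1 xs) = inv x \<otimes> list_prod G xs \<otimes> x"
    using car by (simp add: zs list_prod_append flip: m_assoc)
  also have "\<dots> = (inv x \<otimes> c) \<otimes> h \<otimes> inv (inv x \<otimes> c)"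
    using car h(2) by (simp add: h(4) m_assoc inv_mult_group)
  finally show ?thesis
    using h car cyc_reduced_rotate1[OF cyc] unfolding cls_word_def
    by (intro conjI bexI[of _ i] bexI[of _ "inv x \<otimes> c"] bexI[of _ h]) auto
qed

lemma cls_word_rotate: "cls_word xs \<Longrightarrow> cls_word (rotate k xs)"
  by (induction k) (auto intro: cls_word_rotate1)

text \<open>
  Seen from \<open>w\<close>, the direction \<open>a\<close> leads away from the trivial element, and \<open>\<phi>\<close> is constant on the part of
  the Cayley tree lying in that direction. The direction \<open>\<one>\<close> means staying at \<open>w\<close>; it is excluded for
  the empty \<open>w\<close> because the index of the trivial element has no meaning.
\<close>

definition separated :: "'a list \<Rightarrow> 'a \<Rightarrow> bool" where
  "separated w a \<longleftrightarrow> (if w = [] then a \<noteq> \<one> else a \<noteq> inv (last w)) \<and> (a \<noteq> \<one> \<longrightarrow> cone_const (w @ [a]))"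

lemma separated_end:
  assumes w: "reduced w" and v: "reduced v" and sep: "separated w (if v = [] then \<one> else hd v)"
  shows "\<phi> (list_prod G (w @ v)) = \<phi> (list_prod G w \<otimes> (if v = [] then \<one> else hd v))"
    and "list_prod G (w @ v) \<noteq> \<one>"
proof -
  have ne: "w @ v \<noteq> []" using sep by (auto simp: separated_def split: if_splits)
  have r: "reduced (w @ v)"
    using assms by (auto simp: separated_def reduced_append split: if_splits)
  show "list_prod G (w @ v) \<noteq> \<one>"
    using reduced_prod_one_iff[OF r] ne by simp
  show "\<phi> (list_prod G (w @ v)) = \<phi> (list_prod G w \<otimes> (if v = [] then \<one> else hd v))"
  proof (cases "v = []")
    case True
    then show ?thesis using reduced_carrier[OF w] by simp
  next
    case False
    moreover have "hd v \<in> letters" using v False by (auto simp: reduced_def)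
    ultimately have "cone_const (w @ [hd v])" using sep by (simp add: separated_def)
    then show ?thesis using cone_hd[OF r False] False by simp
  qed
qed

text \<open>
  Reading \<open>xs = p @ q\<close> through \<open>w\<close>, with the cut placed at \<open>w\<close>, one comes from \<open>w (inv p)\<close> and arrives at
  \<open>w q\<close>. These differ by the value of \<open>xs\<close>, an element of a factor, so they have the same index. They
  lie in the two directions of the turn.
\<close>

lemma elt_turn:
  assumes xs: "elt_word xs" and ab: "(a, b) \<in> lin_turns xs" and w: "reduced w"
    and sep: "separated w a" "separated w b"
  shows "\<phi> (list_prod G w \<otimes> a) = \<phi> (list_prod G w \<otimes> b)"
proof -
  obtain p q where pq: "xs = p @ q" "a = (if p = [] then \<one> else inv (last p))"
    "b = (if q = [] then \<one> else hd q)" using ab by (auto simp: lin_turns_def)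
  obtain i where i: "i \<in> I" "list_prod G xs \<in> Hs i" and "reduced xs"
    using xs by (auto simp: elt_word_def)
  then have r: "reduced p" "reduced q" by (auto simp: pq reduced_append)
  define p' where "p' = map (m_inv G) (rev p)"
  have p': "reduced p'" "a = (if p' = [] then \<one> else hd p')"
    using reduced_rev_inv[OF r(1)] by (auto simp: p'_def pq(2) hd_map hd_rev)
  note car = reduced_carrier[OF r(1)] reduced_carrier[OF r(2)] reduced_carrier[OF w] reduced_carrier[OF p'(1)]
  have "list_prod G (w @ p') \<otimes> list_prod G xs = list_prod G (w @ q)"
  proof -
    have "list_prod G p' \<otimes> (list_prod G p \<otimes> list_prod G q) = list_prod G q"
      using car by (simp add: p'_def list_prod_rev_inv flip: m_assoc)
    then show ?thesis using car by (simp add: pq(1) list_prod_append m_assoc)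
  qed
  moreover note e1 = separated_end[OF w p'(1), folded p'(2), OF sep(1)]
  moreover note e2 = separated_end[OF w r(2), folded pq(3), OF sep(2)]
  moreover have "list_prod G (w @ p') \<in> carrier G" using car by simp
  ultimately have "\<phi> (list_prod G (w @ q)) = \<phi> (list_prod G (w @ p'))"
    using \<phi>_mult[of "list_prod G (w @ p')" i "list_prod G xs"] i by simp
  then show ?thesis using e1(1) e2(1) by simp
qed

text \<open>
  The two ends of the periodic line through \<open>w\<close> spelled by \<open>xs\<close> leave \<open>w\<close> in the two directions of
  the turn; by \<open>line_ends\<close> they have the same index.
\<close>

lemma cyc_turn:
  assumes xs: "cls_word xs" and w: "reduced w"
    and sep: "separated w (inv (last xs))" "separated w (hd xs)"
  shows "\<phi> (list_prod G w \<otimes> inv (last xs)) = \<phi> (list_prod G w \<otimes> hd xs)"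
proof -
  obtain i c h where h: "i \<in> I" "c \<in> carrier G" "h \<in> Hs i" "list_prod G xs = c \<otimes> h \<otimes> inv c"
    using xs by (auto simp: cls_word_def)
  have cyc: "cyc_reduced xs" using xs by (simp add: cls_word_def)
  define ys where "ys = map (m_inv G) (rev xs)"
  have cyc': "cyc_reduced ys" using cyc_reduced_rev_inv[OF cyc] by (simp add: ys_def)
  have ne: "xs \<noteq> []" "reduced xs" "ys \<noteq> []" "reduced ys" using cyc cyc' by (auto simp: cyc_reduced_def)
  have ends: "hd ys = inv (last xs)" using ne by (simp add: ys_def hd_map hd_rev)
  have prod_ys: "list_prod G ys = inv (list_prod G xs)"
    using reduced_carrier[OF ne(2)] by (simp add: ys_def list_prod_rev_inv)
  have pow: "\<phi> (list_prod G w \<otimes> list_prod G zs [^] Suc k) = \<phi> (list_prod G w \<otimes> hd zs)"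
    if zs: "cyc_reduced zs" "separated w (hd zs)" for zs k
  proof -
    have zs': "zs \<noteq> []" "reduced zs" using zs by (auto simp: cyc_reduced_def)
    let ?v = "concat (replicate (Suc k) zs)"
    have v: "?v \<noteq> []" "hd ?v = hd zs" using concat_replicate_ends[OF zs'(1)] by auto
    have "\<phi> (list_prod G (w @ ?v)) = \<phi> (list_prod G w \<otimes> (if ?v = [] then \<one> else hd ?v))"
      by (rule separated_end(1)[OF w cyc_reduced_power[OF zs(1)]]) (use v zs(2) in \<open>simp only: if_False\<close>)
    moreover have "list_prod G (w @ ?v) = list_prod G w \<otimes> list_prod G zs [^] Suc k"
      by (simp only: list_prod_power[OF zs'(2)]
          list_prod_append[OF reduced_carrier[OF w] reduced_carrier[OF cyc_reduced_power[OF zs(1)]]])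
    ultimately show ?thesis using v by (simp only: if_False)
  qed
  obtain k where k: "\<phi> (list_prod G w \<otimes> list_prod G xs [^] Suc k) =
      \<phi> (list_prod G w \<otimes> (inv (list_prod G xs)) [^] Suc k)"
    using line_ends[OF h(2,1,3,4) cyc_reduced_inj_pow[OF cyc], of "list_prod G w"] reduced_carrier[OF w]
    by auto
  have "\<phi> (list_prod G w \<otimes> hd xs) = \<phi> (list_prod G w \<otimes> list_prod G xs [^] Suc k)"
    using pow[OF cyc sep(2)] by simp
  also have "\<dots> = \<phi> (list_prod G w \<otimes> list_prod G ys [^] Suc k)"
    using k by (simp only: prod_ys)
  also have "\<dots> = \<phi> (list_prod G w \<otimes> hd ys)"
    using pow[OF cyc'] sep(1) by (simp only: ends)
  finally show ?thesis by (simp only: ends)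
qed

end

section \<open>Connected turns force the letters into the factors\<close>

lemma successively_eq_imp_hd:
  "successively (\<lambda>x y. f x = f y) xs \<Longrightarrow> x \<in> set xs \<Longrightarrow> f x = f (hd xs)"
  by (induction xs) (auto simp: successively_Cons)

context based_group
begin

lemma hd_letter: "set xs \<subseteq> letters \<Longrightarrow> xs \<noteq> [] \<Longrightarrow> hd xs \<in> letters"
  and last_letter: "set xs \<subseteq> letters \<Longrightarrow> xs \<noteq> [] \<Longrightarrow> last xs \<in> letters"
  by (meson hd_in_set last_in_set subsetD)+

end

text \<open>
  The assumption \<open>connected\<close> says that the graph of the turns stays connected when the vertex \<open>y\<close> is
  removed: a function that is constant along the remaining edges is constant. It is used for functions
  of the form \<open>u \<mapsto> \<phi> (w u)\<close>, whence the type of \<open>\<psi>\<close>.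
\<close>

locale based_turns = based_split G X I Hs \<phi>
  for G (structure) and X and I :: "'i set" and Hs \<phi> +
  fixes WE WC :: "'a list set"
  assumes elt_words: "xs \<in> WE \<Longrightarrow> elt_word xs"
    and cls_words: "xs \<in> WC \<Longrightarrow> cls_word xs"
    and connected: "y \<in> letters \<Longrightarrow>
      (\<And>a b. (a, b) \<in> \<Union>(lin_turns ` WE) \<union> \<Union>(cyc_turns ` WC) \<Longrightarrow> a \<noteq> y \<Longrightarrow> b \<noteq> y \<Longrightarrow> \<psi> a = (\<psi> b :: 'i)) \<Longrightarrow>
      u \<in> insert \<one> letters \<Longrightarrow> u \<noteq> y \<Longrightarrow> \<psi> u = \<psi> \<one>"
begin

abbreviation all_turns where
  "all_turns \<equiv> \<Union>(lin_turns ` WE) \<union> \<Union>(cyc_turns ` WC)"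

lemma turn_letters: "(a, b) \<in> all_turns \<Longrightarrow> a \<in> insert \<one> letters \<and> b \<in> insert \<one> letters"
proof (elim UnE UN_E)
  fix xs assume "xs \<in> WE" "(a, b) \<in> lin_turns xs"
  then have "set xs \<subseteq> letters" using elt_words[of xs] by (auto simp: elt_word_def reduced_def)
  moreover obtain p q where "xs = p @ q" "a = (if p = [] then \<one> else inv (last p))"
    "b = (if q = [] then \<one> else hd q)"
    using \<open>(a, b) \<in> lin_turns xs\<close> by (auto simp: lin_turns_def)
  ultimately show ?thesis using last_letter[of p] hd_letter[of q] by auto
next
  fix xs assume xs: "xs \<in> WC" "(a, b) \<in> cyc_turns xs"
  then have ne: "xs \<noteq> []" "set xs \<subseteq> letters"
    using cls_words[of xs] by (auto simp: cls_word_def cyc_reduced_def reduced_def)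
  obtain k where k: "a = inv (last (rotate k xs))" "b = hd (rotate k xs)"
    using xs by (auto simp: cyc_turns_def)
  have "rotate k xs \<noteq> []" using ne by simp
  from hd_in_set[OF this] last_in_set[OF this] have "b \<in> letters" "a \<in> letters"
    using ne(2) by (auto simp: k)
  then show ?thesis by simp
qed

lemma turn_index:
  assumes "(a, b) \<in> all_turns" "reduced w" "separated w a" "separated w b"
  shows "\<phi> (list_prod G w \<otimes> a) = \<phi> (list_prod G w \<otimes> b)"
  using assms(1)
proof (elim UnE UN_E)
  fix xs assume "xs \<in> WE" "(a, b) \<in> lin_turns xs"
  then show ?thesis using elt_turn elt_words assms by blast
next
  fix xs assume "xs \<in> WC" "(a, b) \<in> cyc_turns xs"
  then obtain k where "a = inv (last (rotate k xs))" "b = hd (rotate k xs)" "cls_word (rotate k xs)"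
    using cls_words cls_word_rotate by (auto simp: cyc_turns_def)
  then show ?thesis using cyc_turn[of "rotate k xs" w] assms by simp
qed

text \<open>
  Descending induction on the length of \<open>w\<close>, started by \<open>long_cone_const\<close>. If \<open>\<phi>\<close> is constant on the cones
  of all one-letter extensions of \<open>w\<close>, then \<open>elt_turn\<close> and \<open>cyc_turn\<close> identify the constants, as well as
  the index of \<open>w\<close> itself, along every turn avoiding the direction back to the trivial element. Removing
  that single direction leaves the graph connected, so all these values agree.
\<close>

lemma cone_const:
  assumes "reduced w" "w \<noteq> []"
  shows "cone_const w"
proof -
  obtain N where N: "\<And>w. reduced w \<Longrightarrow> N \<le> length w \<Longrightarrow> cone_const w"
    using long_cone_const by blast
  have "cone_const w" if "N \<le> length w + k" "reduced w" "w \<noteq> []" for k w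
    using that
  proof (induction k arbitrary: w)
    case 0
    then show ?case using N by simp
  next
    case (Suc k)
    have next_const: "cone_const (w @ [l])" if "reduced (w @ [l])" for l
      using Suc.IH[of "w @ [l]"] Suc.prems that by simp
    define y where "y = inv (last w)"
    have y: "y \<in> letters"
      using Suc.prems last_letter[of w] by (auto simp: y_def reduced_def)
    \<comment> \<open>the letter \<open>y\<close> leads back from \<open>w\<close> to the trivial element; all other directions lead outwards\<close>
    have sep: "separated w a" if "a \<in> insert \<one> letters" "a \<noteq> y" for a
      using that Suc.prems next_const[of a]
      by (auto simp: separated_def y_def reduced_append)
    have const: "\<phi> (list_prod G w \<otimes> u) = \<phi> (list_prod G w \<otimes> \<one>)"
      if "u \<in> insert \<one> letters" "u \<noteq> y" for u
      using y _ that
    proof (rule connected[where \<psi> = "\<lambda>u. \<phi> (list_prod G w \<otimes> u)"])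
      fix a b assume ab: "(a, b) \<in> all_turns" "a \<noteq> y" "b \<noteq> y"
      then show "\<phi> (list_prod G w \<otimes> a) = \<phi> (list_prod G w \<otimes> b)"
        using turn_letters[OF ab(1)] turn_index[OF ab(1) Suc.prems(2)] sep by blast
    qed
    show ?case
      unfolding cone_const_def
    proof (intro allI impI)
      fix u assume u: "reduced (w @ u)"
      show "\<phi> (list_prod G (w @ u)) = \<phi> (list_prod G w)"
      proof (cases "u = []")
        case False
        have "hd u \<in> letters" using u hd_letter[OF _ False] by (simp add: reduced_def)
        moreover from this have "hd u \<noteq> y" "reduced (w @ [hd u])"
          using u False Suc.prems by (auto simp: reduced_append y_def)
        ultimately have "hd u \<in> letters" "hd u \<noteq> y" "reduced (w @ [hd u])" by auto
        then have "\<phi> (list_prod G (w @ u)) = \<phi> (list_prod G w \<otimes> hd u)"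
          using cone_hd[OF u False] next_const by blast
        also have "\<dots> = \<phi> (list_prod G w \<otimes> \<one>)"
          using const \<open>hd u \<in> letters\<close> \<open>hd u \<noteq> y\<close> by blast
        also have "list_prod G w \<otimes> \<one> = list_prod G w"
          using reduced_carrier[OF Suc.prems(2)] by simp
        finally show ?thesis .
      qed simp
    qed
  qed
  from this[of w N] assms show ?thesis by simp
qed

lemma index_hd:
  assumes "reduced xs" "xs \<noteq> []"
  shows "\<phi> (list_prod G xs) = \<phi> (hd xs)"
proof -
  have "hd xs \<in> letters" using assms by (auto simp: reduced_def)
  then show ?thesis
    using cone_hd[of "[]" xs] cone_const[of "[hd xs]"] assms by simp
qed

lemma index_hd_nword: "g \<in> carrier G \<Longrightarrow> g \<noteq> \<one> \<Longrightarrow> \<phi> g = \<phi> (hd (nword g))"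
  using index_hd[of "nword g"] nword[of g] nword_Nil_iff[of g] by simp

text \<open>
  The first letter of a nontrivial element determines the index of its first syllable, and the inverse of
  the last letter that of the last one. Consecutive syllables have different indices, so no
  letters cancel between them.
\<close>

lemma nword_normal_form:
  assumes "\<forall>(i, a)\<in>set s. i \<in> I \<and> a \<in> Hs i \<and> a \<noteq> \<one>" "distinct_adj (map fst s)"
  shows "nword (list_prod G (map snd s)) = concat (map (\<lambda>ia. nword (snd ia)) s)"
  using assms
proof (induction s)
  case Nil
  then show ?case by (simp add: nword_Nil_iff)
next
  case (Cons ia s)
  obtain i a where ia: "ia = (i, a)" by (cases ia)
  have a: "i \<in> I" "a \<in> Hs i" "a \<noteq> \<one>" "a \<in> carrier G"
    using Cons.prems factor_carrier by (auto simp: ia)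
  interpret H: subgroup "Hs i" G using factor a by simp
  have s: "\<forall>(i, a)\<in>set s. i \<in> I \<and> a \<in> Hs i \<and> a \<noteq> \<one>" "distinct_adj (map fst s)"
    using Cons.prems by (auto dest: distinct_adj_ConsD)
  have sc: "set (map snd s) \<subseteq> carrier G"
    using s(1) factor_carrier by fastforce
  define g where "g = list_prod G (map snd s)"
  have g: "g \<in> carrier G" using sc by (simp add: g_def)
  have IH: "nword g = concat (map (\<lambda>ia. nword (snd ia)) s)" using Cons.IH s by (simp add: g_def comp_def)
  have na: "nword a \<noteq> []" using a nword_Nil_iff by simp
  have "reduced (nword a @ nword g)"
    unfolding reduced_append
  proof (intro conjI impI)
    show "reduced (nword a)" "reduced (nword g)" using nword a g by auto
    assume "nword g \<noteq> []"
    then have "s \<noteq> []" using IH by auto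
    then obtain j b s' where s': "s = (j, b) # s'" by (cases s) auto
    have b: "j \<in> I" "b \<in> Hs j" "b \<noteq> \<one>" "b \<in> carrier G" "i \<noteq> j"
      using s(1) factor_carrier Cons.prems(2) by (auto simp: s' ia)
    have "\<phi> (hd (nword (inv a))) = i"
      using index_hd_nword[of "inv a"] a \<phi>_factor[of i "inv a"] by simp
    moreover have "hd (nword (inv a)) = inv (last (nword a))"
      using na a by (simp add: nword_inv hd_map hd_rev)
    moreover have "\<phi> (hd (nword b)) = j"
      using index_hd_nword[of b] b \<phi>_factor[of j b] by simp
    moreover have "nword b \<noteq> []" using b nword_Nil_iff by simp
    then have "hd (nword g) = hd (nword b)" using IH by (simp add: s')
    ultimately show "inv (last (nword a)) \<noteq> hd (nword g)" using b(5) by auto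
  qed
  from nword_list_prod[OF this] have "nword (a \<otimes> g) = nword a @ nword g"
    using nword a g reduced_carrier by (simp add: list_prod_append)
  then show ?case by (simp add: ia g_def[symmetric] IH)
qed

text \<open>
  By \<open>nword_normal_form\<close> word lengths add up over the syllables, and a letter has length one.
\<close>

lemma letter_in_factor:
  assumes "x \<in> letters"
  shows "\<exists>i\<in>I. x \<in> Hs i"
proof -
  obtain s where s: "\<forall>(i, a)\<in>set s. i \<in> I \<and> a \<in> Hs i \<and> a \<noteq> \<one>" "distinct_adj (map fst s)"
    "list_prod G (map snd s) = x"
    using normal_form[of x] assms by auto
  have "nword x = [x]" using nword_list_prod[of "[x]"] assms by simp
  then have eq: "concat (map (\<lambda>ia. nword (snd ia)) s) = [x]"
    using nword_normal_form[OF s(1,2)] s(3) by simp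
  have ne: "nword (snd ia) \<noteq> []" if "ia \<in> set s" for ia
    using that s(1) nword_Nil_iff[of "snd ia"] factor_carrier[of "fst ia" "snd ia"] by (cases ia) auto
  obtain i a s' where s': "s = (i, a) # s'" using eq by (cases s) auto
  moreover have "s' = []"
  proof (rule ccontr)
    assume "s' \<noteq> []"
    then obtain ja s'' where "s' = ja # s''" by (cases s') auto
    then show False using eq ne[of "(i, a)"] ne[of ja] by (auto simp: s' append_eq_Cons_conv)
  qed
  ultimately have "a = x" "i \<in> I" "a \<in> Hs i"
    using s factor_carrier[of i a] by auto
  then show ?thesis by blast
qed

lemma index_inv:
  assumes "x \<in> letters"
  shows "\<phi> (inv x) = \<phi> x"
proof -
  obtain i where i: "i \<in> I" "x \<in> Hs i" using letter_in_factor assms by blast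
  interpret H: subgroup "Hs i" G using factor i by simp
  show ?thesis using \<phi>_factor[of i x] \<phi>_factor[of i "inv x"] i assms by simp
qed

text \<open>
  The turns at the trivial element: now that letters lie in factors, a word that turns from one letter to
  another stays within letters of one factor.
\<close>

lemma turn_index_letters:
  assumes "(a, b) \<in> all_turns" "a \<in> letters" "b \<in> letters"
  shows "\<phi> a = \<phi> b"
  using turn_index[OF assms(1), of "[]"] assms cone_const[of "[a]"] cone_const[of "[b]"]
  by (simp add: separated_def)

lemma elt_word_index:
  assumes "xs \<in> WE" "x \<in> set xs"
  shows "\<phi> x = \<phi> (hd xs)"
proof -
  have "set xs \<subseteq> letters" using elt_words[OF assms(1)] by (simp add: elt_word_def reduced_def)
  then have letter: "xs ! i \<in> letters" if "i < length xs" for i using that by auto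
  have "successively (\<lambda>x y. \<phi> x = \<phi> y) xs"
    unfolding successively_conv_nth
  proof (intro allI impI)
    fix i assume i: "Suc i < length xs"
    have "take (Suc i) xs \<noteq> []" "drop (Suc i) xs \<noteq> []"
      "last (take (Suc i) xs) = xs ! i" "hd (drop (Suc i) xs) = xs ! Suc i"
      using i by (auto simp: hd_drop_conv_nth take_Suc_conv_app_nth)
    then have "(inv (xs ! i), xs ! Suc i) \<in> lin_turns xs"
      using append_take_drop_id[of "Suc i" xs] unfolding lin_turns_def by (smt (verit) mem_Collect_eq)
    then have "\<phi> (inv (xs ! i)) = \<phi> (xs ! Suc i)"
      using turn_index_letters[of "inv (xs ! i)" "xs ! Suc i"] letter i assms(1) by auto
    then show "\<phi> (xs ! i) = \<phi> (xs ! Suc i)" using index_inv[of "xs ! i"] letter i by simp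
  qed
  from successively_eq_imp_hd[OF this assms(2)] show ?thesis .
qed

lemma cls_word_index:
  assumes "xs \<in> WC" "x \<in> set xs"
  shows "\<phi> x = \<phi> (hd xs)"
proof -
  have "set xs \<subseteq> letters"
    using cls_words[OF assms(1)] by (simp add: cls_word_def cyc_reduced_def reduced_def)
  then have letter: "xs ! i \<in> letters" if "i < length xs" for i using that by auto
  have "successively (\<lambda>x y. \<phi> x = \<phi> y) xs"
    unfolding successively_conv_nth
  proof (intro allI impI)
    fix i assume i: "Suc i < length xs"
    have "rotate (Suc i) xs = drop (Suc i) xs @ take (Suc i) xs"
      using i rotate_drop_take[of "Suc i" xs] by simp
    then have "last (rotate (Suc i) xs) = xs ! i" "hd (rotate (Suc i) xs) = xs ! Suc i"
      using i by (auto simp: hd_append hd_drop_conv_nth take_Suc_conv_app_nth)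
    then have "(inv (xs ! i), xs ! Suc i) \<in> cyc_turns xs"
      unfolding cyc_turns_def by (smt (verit) mem_Collect_eq)
    then have "\<phi> (inv (xs ! i)) = \<phi> (xs ! Suc i)"
      using turn_index_letters[of "inv (xs ! i)" "xs ! Suc i"] letter i assms(1) by auto
    then show "\<phi> (xs ! i) = \<phi> (xs ! Suc i)" using index_inv[of "xs ! i"] letter i by simp
  qed
  from successively_eq_imp_hd[OF this assms(2)] show ?thesis .
qed

end

section \<open>Generated subgroups and retractions\<close>

lemma (in group) pm_carrier: "Y \<subseteq> carrier G \<Longrightarrow> pm G Y \<subseteq> carrier G"
  by (auto simp: pm_def)

lemma (in group) pm_inv: "Y \<subseteq> carrier G \<Longrightarrow> x \<in> pm G Y \<Longrightarrow> inv x \<in> pm G Y"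
  by (auto simp: pm_def)

lemma (in group) generate_iff_list:
  assumes Y: "Y \<subseteq> carrier G"
  shows "g \<in> generate G Y \<longleftrightarrow> (\<exists>xs. set xs \<subseteq> pm G Y \<and> list_prod G xs = g)"
proof
  assume "g \<in> generate G Y"
  then show "\<exists>xs. set xs \<subseteq> pm G Y \<and> list_prod G xs = g"
  proof induction
    case one
    show ?case by (intro exI[of _ "[]"]) simp
  next
    case (incl h)
    then show ?case using Y by (intro exI[of _ "[h]"]) (auto simp: pm_def)
  next
    case (inv h)
    then show ?case using Y by (intro exI[of _ "[inv h]"]) (auto simp: pm_def)
  next
    case (eng h1 h2)
    then obtain xs ys where "set xs \<subseteq> pm G Y" "list_prod G xs = h1"
      "set ys \<subseteq> pm G Y" "list_prod G ys = h2" by blast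
    then show ?case
      using pm_carrier[OF Y] by (intro exI[of _ "xs @ ys"]) (auto simp: list_prod_append)
  qed
next
  assume "\<exists>xs. set xs \<subseteq> pm G Y \<and> list_prod G xs = g"
  then obtain xs where xs: "set xs \<subseteq> pm G Y" "list_prod G xs = g" by blast
  have "set xs \<subseteq> generate G Y"
    using xs(1) generate.incl[of _ Y G] generate.inv[of _ Y G] by (fastforce simp: pm_def)
  then show "g \<in> generate G Y"
    using list_prod_in_subgroup[OF generate_is_subgroup[OF Y], of xs] xs(2) by simp
qed

context based_group
begin

lemma subset_basis_carrier: "Y \<subseteq> X \<Longrightarrow> Y \<subseteq> carrier G"
  using basis_carrier by blast

lemma inv_basis_notin: "x \<in> X \<Longrightarrow> inv x \<notin> X"
proof
  assume x: "x \<in> X" "inv x \<in> X"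
  then have "lval (x, False) = lval (inv x, True)" by simp
  then show False using lval_inj[of "(x, False)" "(inv x, True)"] x by simp
qed

lemma pm_Int_basis: "Y \<subseteq> X \<Longrightarrow> pm G Y \<inter> X = Y"
  using inv_basis_notin by (auto simp: pm_def)

lemma mem_pm_iff_inv: "Y \<subseteq> X \<Longrightarrow> x \<in> letters \<Longrightarrow> inv x \<in> pm G Y \<longleftrightarrow> x \<in> pm G Y"
  using pm_inv[OF subset_basis_carrier, of Y x] pm_inv[OF subset_basis_carrier, of Y "inv x"] by auto

lemma pm_Int_subset_iff:
  assumes "Y \<subseteq> X" "S \<subseteq> letters"
  shows "pm G S \<inter> X \<subseteq> Y \<longleftrightarrow> S \<subseteq> pm G Y"
proof
  assume *: "pm G S \<inter> X \<subseteq> Y"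
  show "S \<subseteq> pm G Y"
  proof
    fix s assume s: "s \<in> S"
    then have "s \<in> letters" using assms by auto
    then have "s \<in> X \<or> inv s \<in> X" by (auto simp: letters_def pm_def basis_carrier subsetD)
    then show "s \<in> pm G Y"
    proof
      assume "s \<in> X" then show ?thesis using * s by (auto simp: pm_def)
    next
      assume "inv s \<in> X"
      then have "inv s \<in> Y" using * s by (auto simp: pm_def)
      then show ?thesis using \<open>s \<in> letters\<close> by (force simp: pm_def)
    qed
  qed
next
  assume *: "S \<subseteq> pm G Y"
  then have "pm G S \<subseteq> pm G Y"
    using pm_inv[OF subset_basis_carrier[OF assms(1)]] by (auto simp: pm_def[of G S])
  then show "pm G S \<inter> X \<subseteq> Y" using pm_Int_basis[OF assms(1)] by blast
qed

lemma nword_generate: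
  assumes Y: "Y \<subseteq> X" and g: "g \<in> generate G Y"
  shows "set (nword g) \<subseteq> pm G Y"
proof -
  obtain xs where xs: "set xs \<subseteq> pm G Y" "list_prod G xs = g"
    using generate_iff_list[OF subset_basis_carrier[OF Y]] g by blast
  have "\<exists>w. set w \<subseteq> Y \<times> UNIV \<and> xs = map lval w"
    using xs(1)
  proof (induction xs)
    case (Cons x xs)
    then obtain w where w: "set w \<subseteq> Y \<times> UNIV" "xs = map lval w" by auto
    have "x \<in> Y \<or> (\<exists>y\<in>Y. x = inv y)" using Cons.prems by (auto simp: pm_def)
    then obtain l where "l \<in> Y \<times> UNIV" "x = lval l"
    proof (elim disjE bexE)
      assume "x \<in> Y" then show ?thesis by (intro that[of "(x, True)"]) auto
    next
      fix y assume "y \<in> Y" "x = inv y" then show ?thesis by (intro that[of "(y, False)"]) auto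
    qed
    then show ?case using w by (intro exI[of _ "l # w"]) auto
  qed simp
  then obtain w where w: "set w \<subseteq> Y \<times> UNIV" "xs = map lval w" by blast
  define v where "v = foldr letter_cons w []"
  have v: "set v \<subseteq> Y \<times> UNIV" using set_foldr_letter_cons[of w "[]"] w by (auto simp: v_def)
  have "eval_word G (\<lambda>x. x) v = eval_word G (\<lambda>x. x) w \<otimes> eval_word G (\<lambda>x. x) []"
    unfolding v_def using w subset_basis_carrier[OF Y] by (intro eval_word_mult[of Y]) auto
  moreover have "eval_word G (\<lambda>x. x) w = g" using xs w by (simp add: eval_word_def)
  moreover have "g \<in> carrier G" using g subset_basis_carrier[OF Y] generate_incl by blast
  ultimately have "list_prod G (map lval v) = g" by (simp add: eval_word_def)
  moreover have "reduced (map lval v)"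
    using reduced_map_lval[of v] v Y foldr_letter_cons_reduced[of "[]" w] by (auto simp: v_def)
  ultimately have "nword g = map lval v" using nword_list_prod by blast
  moreover have "lval l \<in> pm G Y" if "l \<in> Y \<times> UNIV" for l using that by (auto simp: pm_def)
  ultimately show ?thesis using v by (auto simp del: split_paired_All)
qed

text \<open>
  Killing the basis elements outside \<open>A\<close>. The retraction is what makes the conjugacy statements below
  independent of any analysis of conjugate words.
\<close>

lemma retraction_exists:
  assumes A: "A \<subseteq> X"
  shows "\<exists>\<pi>\<in>hom G G. (\<forall>x\<in>A. \<pi> x = x) \<and> (\<forall>x\<in>X - A. \<pi> x = \<one>)"
proof -
  let ?F = "free_group_on X"
  define j where "j x = (if x \<in> A then x else \<one>)" for x
  define word where "word = inv_into (carrier ?F) (word_value G)"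
  define \<pi> where "\<pi> g = eval_word G j (word g)" for g
  have bij: "bij_betw (word_value G) (carrier ?F) (carrier G)"
    and mult: "\<And>u v. u \<in> carrier ?F \<Longrightarrow> v \<in> carrier ?F \<Longrightarrow>
      word_value G (foldr letter_cons u v) = word_value G u \<otimes> word_value G v"
    using basis by (auto simp: is_basis_def iso_def hom_def free_group_on_def)
  have word_in: "word g \<in> carrier ?F" if "g \<in> carrier G" for g
    using that bij unfolding word_def bij_betw_def by (auto intro: inv_into_into)
  have value_word: "word_value G (word g) = g" if "g \<in> carrier G" for g
    using that bij unfolding word_def bij_betw_def by (auto intro: f_inv_into_f)
  have word_value: "word (word_value G w) = w" if "w \<in> carrier ?F" for w
    using that bij unfolding word_def bij_betw_def by auto
  have j: "j x \<in> carrier G" for x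
    using A basis_carrier by (auto simp: j_def)
  have sub: "set w \<subseteq> X \<times> UNIV" if "w \<in> carrier ?F" for w
    using that by (auto simp: free_group_on_def)
  have closed: "foldr letter_cons u v \<in> carrier ?F" if "u \<in> carrier ?F" "v \<in> carrier ?F" for u v
    using that foldr_letter_cons_reduced[of v u] set_foldr_letter_cons[of u v]
    by (auto simp: free_group_on_def)
  have "\<pi> \<in> hom G G"
  proof (rule homI)
    fix g assume g: "g \<in> carrier G"
    show "\<pi> g \<in> carrier G"
      unfolding \<pi>_def using j sub[OF word_in[OF g]] by (rule eval_word_closed)
  next
    fix g h assume gh: "g \<in> carrier G" "h \<in> carrier G"
    have "word (g \<otimes> h) = foldr letter_cons (word g) (word h)"
      using word_value[OF closed[OF word_in[OF gh(1)] word_in[OF gh(2)]]]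
        mult[OF word_in[OF gh(1)] word_in[OF gh(2)]] value_word gh by simp
    then show "\<pi> (g \<otimes> h) = \<pi> g \<otimes> \<pi> h"
      unfolding \<pi>_def using eval_word_mult[OF j sub[OF word_in[OF gh(1)]] sub[OF word_in[OF gh(2)]]]
      by simp
  qed
  moreover have "\<pi> x = j x" if "x \<in> X" for x
  proof -
    have "[(x, True)] \<in> carrier ?F" using that by (simp add: free_group_on_def)
    moreover have "word_value G [(x, True)] = x"
      using that basis_carrier by (auto simp: word_value_def)
    ultimately have "word x = [(x, True)]" using word_value by metis
    then show ?thesis using j by (simp add: \<pi>_def eval_word_def)
  qed
  ultimately show ?thesis
    using A by (intro bexI[of _ \<pi>]) (auto simp: j_def)
qed

lemma retraction_list:
  assumes "\<pi> \<in> hom G G" "Y \<subseteq> X" "set xs \<subseteq> pm G Y"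
  shows "\<forall>x\<in>Y. \<pi> x = x \<Longrightarrow> \<pi> (list_prod G xs) = list_prod G xs"
    and "\<forall>x\<in>Y. \<pi> x = \<one> \<Longrightarrow> \<pi> (list_prod G xs) = \<one>"
proof -
  interpret \<pi>: group_hom G G \<pi>
    using assms(1) by unfold_locales
  have Yc: "Y \<subseteq> carrier G" using subset_basis_carrier assms(2) by blast
  note car = pm_carrier[OF Yc]
  show "\<pi> (list_prod G xs) = list_prod G xs" if id: "\<forall>x\<in>Y. \<pi> x = x"
  proof -
    have "\<pi> x = x" if "x \<in> pm G Y" for x
      using that id Yc by (auto simp: pm_def)
    then show ?thesis using assms(3)
    proof (induction xs)
      case (Cons x xs)
      then have "x \<in> carrier G" "set xs \<subseteq> carrier G" using car by auto
      with Cons show ?case by simp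
    qed simp
  qed
  show "\<pi> (list_prod G xs) = \<one>" if one: "\<forall>x\<in>Y. \<pi> x = \<one>"
  proof -
    have "\<pi> x = \<one>" if "x \<in> pm G Y" for x
      using that one Yc by (auto simp: pm_def)
    then show ?thesis using assms(3)
    proof (induction xs)
      case (Cons x xs)
      then have "x \<in> carrier G" "set xs \<subseteq> carrier G" using car by auto
      with Cons show ?case by simp
    qed simp
  qed
qed

text \<open>
  The retraction onto \<open>Y\<close> fixes \<open>g\<close> and kills \<open>h\<close>.
\<close>

lemma generate_disjoint_conj:
  assumes Y: "Y \<subseteq> X" "Z \<subseteq> X" "Y \<inter> Z = {}"
    and g: "g \<in> generate G Y" and h: "h \<in> generate G Z" and c: "c \<in> carrier G"
    and eq: "g = c \<otimes> h \<otimes> inv c"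
  shows "g = \<one>"
proof -
  obtain \<pi> where \<pi>: "\<pi> \<in> hom G G" "\<forall>x\<in>Y. \<pi> x = x" "\<forall>x\<in>X - Y. \<pi> x = \<one>"
    using retraction_exists[OF Y(1)] by blast
  interpret \<pi>: group_hom G G \<pi> using \<pi>(1) by unfold_locales
  have "\<pi> g = g"
    using g \<pi>(2) retraction_list(1)[OF \<pi>(1) Y(1)] generate_iff_list[OF subset_basis_carrier[OF Y(1)]] by metis
  moreover have "\<forall>x\<in>Z. \<pi> x = \<one>" using \<pi>(3) Y by blast
  then have "\<pi> h = \<one>"
    using h retraction_list(2)[OF \<pi>(1) Y(2)] generate_iff_list[OF subset_basis_carrier[OF Y(2)]] by metis
  moreover have "h \<in> carrier G" using h generate_incl[OF subset_basis_carrier[OF Y(2)]] by blast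
  ultimately show ?thesis using c by (simp add: eq)
qed

text \<open>
  The retraction onto \<open>Y\<close> fixes \<open>g\<close> and \<open>h\<close> and carries a conjugating element into \<open>generate G Y\<close>.
\<close>

lemma generate_conj:
  assumes Y: "Y \<subseteq> X" and g: "g \<in> generate G Y" and h: "h \<in> generate G Y" and c: "c \<in> carrier G"
    and eq: "g = c \<otimes> h \<otimes> inv c"
  shows "\<exists>d\<in>generate G Y. g = d \<otimes> h \<otimes> inv d"
proof -
  obtain \<pi> where \<pi>: "\<pi> \<in> hom G G" "\<forall>x\<in>Y. \<pi> x = x" "\<forall>x\<in>X - Y. \<pi> x = \<one>"
    using retraction_exists[OF Y] by blast
  interpret \<pi>: group_hom G G \<pi> using \<pi>(1) by unfold_locales
  note gen = generate_iff_list[OF subset_basis_carrier[OF Y]]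
  have fix_Y: "\<pi> k = k" if "k \<in> generate G Y" for k
    using that \<pi>(2) retraction_list(1)[OF \<pi>(1) Y] gen by metis
  have sub: "subgroup (generate G Y) G" using generate_is_subgroup[OF subset_basis_carrier[OF Y]] .
  have "\<pi> x \<in> generate G Y" if "x \<in> letters" for x
  proof -
    have *: "\<pi> x \<in> generate G Y" if "x \<in> X" for x
      using that \<pi>(2,3) generate.incl[of x Y G] generate.one[of G Y] by (cases "x \<in> Y") auto
    show ?thesis
      using that * sub basis_carrier subgroup.m_inv_closed[OF sub]
      by (auto simp: letters_def pm_def subset_iff)
  qed
  then have "set (map \<pi> (nword c)) \<subseteq> generate G Y"
    using nword(1)[OF c] by (auto simp: reduced_def)
  then have "list_prod G (map \<pi> (nword c)) \<in> generate G Y"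
    using list_prod_in_subgroup[OF sub] by blast
  moreover have "\<pi> (list_prod G xs) = list_prod G (map \<pi> xs)" if "set xs \<subseteq> carrier G" for xs
    using that by (induction xs) auto
  then have "\<pi> c = list_prod G (map \<pi> (nword c))"
    using nword[OF c] reduced_carrier by metis
  ultimately have "\<pi> c \<in> generate G Y" by simp
  moreover have "h \<in> carrier G" using h generate_incl[OF subset_basis_carrier[OF Y]] by blast
  then have "g = \<pi> c \<otimes> h \<otimes> inv (\<pi> c)"
    using fix_Y[OF g] fix_Y[OF h] c by (simp add: eq)
  ultimately show ?thesis by blast
qed

end

section \<open>Turns of elements and classes\<close>

context group
begin

lemma seq_turns_Elt: "seq_turns G (Elt g) xs = lin_turns xs"
proof -
  have nth: "inv ((\<one> # xs @ [\<one>]) ! i) = (if take i xs = [] then \<one> else inv (last (take i xs)))"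
    "(\<one> # xs @ [\<one>]) ! (i + 1) = (if drop i xs = [] then \<one> else hd (drop i xs))"
    if "i \<le> length xs" for i
    using that by (cases i; auto simp: nth_append hd_drop_conv_nth hd_conv_nth take_Suc_conv_app_nth)+
  show ?thesis
  proof (intro equalityI subsetI)
    fix e assume "e \<in> seq_turns G (Elt g) xs"
    then obtain i where "i \<le> length xs" "e = (inv ((\<one> # xs @ [\<one>]) ! i), (\<one> # xs @ [\<one>]) ! (i + 1))"
      by (auto simp: seq_turns_def)
    then show "e \<in> lin_turns xs"
      unfolding lin_turns_def using nth[of i] append_take_drop_id[of i xs] by (smt (verit) mem_Collect_eq)
  next
    fix e assume "e \<in> lin_turns xs"
    then obtain p q where pq: "xs = p @ q"
      "e = (if p = [] then \<one> else inv (last p), if q = [] then \<one> else hd q)"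
      by (auto simp: lin_turns_def)
    then have "e = (inv ((\<one> # xs @ [\<one>]) ! length p), (\<one> # xs @ [\<one>]) ! (length p + 1))"
      using nth[of "length p"] by simp
    then show "e \<in> seq_turns G (Elt g) xs"
      using pq(1) by (auto simp: seq_turns_def intro!: exI[of _ "length p"])
  qed
qed

lemma seq_turns_Cls:
  assumes "xs \<noteq> []"
  shows "seq_turns G (Cls C) xs = cyc_turns xs"
proof -
  have nth: "(last xs # xs @ [hd xs]) ! i = last (rotate i xs)"
    "(last xs # xs @ [hd xs]) ! (i + 1) = hd (rotate i xs)"
    if i: "i \<le> length xs" for i
  proof -
    have "(last xs # xs @ [hd xs]) ! i = last (rotate i xs) \<and>
        (last xs # xs @ [hd xs]) ! (i + 1) = hd (rotate i xs)"
    proof (cases "i < length xs")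
      case True
      then have "rotate i xs = drop i xs @ take i xs" using rotate_drop_take[of i xs] by simp
      then show ?thesis
        using True by (cases i) (auto simp: nth_append hd_conv_nth hd_drop_conv_nth take_Suc_conv_app_nth)
    next
      case False
      then have n: "i = length xs" using i by simp
      then have "rotate i xs = xs" by simp
      moreover have "(last xs # xs @ [hd xs]) ! i = last xs" "(last xs # xs @ [hd xs]) ! (i + 1) = hd xs"
        using n assms by (auto simp: nth_append last_conv_nth nth_Cons' Suc_le_eq)
      ultimately show ?thesis by (simp only:)
    qed
    then show "(last xs # xs @ [hd xs]) ! i = last (rotate i xs)"
      "(last xs # xs @ [hd xs]) ! (i + 1) = hd (rotate i xs)" by auto
  qed
  show ?thesis
  proof (intro equalityI subsetI)
    fix e assume "e \<in> seq_turns G (Cls C) xs"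
    then obtain i where "i \<le> length xs"
      "e = (inv ((last xs # xs @ [hd xs]) ! i), (last xs # xs @ [hd xs]) ! (i + 1))"
      by (auto simp: seq_turns_def)
    then show "e \<in> cyc_turns xs"
      using nth[of i] by (auto simp: cyc_turns_def)
  next
    fix e assume "e \<in> cyc_turns xs"
    then obtain k where k: "e = (inv (last (rotate k xs)), hd (rotate k xs))"
      by (auto simp: cyc_turns_def)
    have "rotate k xs = rotate (k mod length xs) xs" by (rule rotate_conv_mod)
    moreover have "k mod length xs \<le> length xs" using assms by (simp add: less_imp_le)
    ultimately show "e \<in> seq_turns G (Cls C) xs"
      using k nth[of "k mod length xs"] by (auto simp: seq_turns_def intro!: exI[of _ "k mod length xs"])
  qed
qed

end

context based_group
begin

lemma expresses_Elt_iff: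
  "expresses G X (Elt g) xs \<longleftrightarrow> xs \<noteq> [] \<and> reduced xs \<and> list_prod G xs = g"
proof
  assume e: "expresses G X (Elt g) xs"
  then have xs: "set xs \<subseteq> letters" "list_prod G xs = g" "\<And>a b. (a, b) \<in> lin_turns xs \<Longrightarrow> a \<noteq> b"
    by (auto simp: expresses_def letters_def seq_turns_Elt)
  have "xs \<noteq> []" using xs(3)[of \<one> \<one>] by (auto simp: lin_turns_def)
  moreover have "successively (\<lambda>a b. inv a \<noteq> b) xs"
    unfolding successively_conv_nth
  proof (intro allI impI)
    fix i assume i: "Suc i < length xs"
    have "take (Suc i) xs \<noteq> []" "drop (Suc i) xs \<noteq> []"
      "last (take (Suc i) xs) = xs ! i" "hd (drop (Suc i) xs) = xs ! Suc i"
      using i by (auto simp: hd_drop_conv_nth take_Suc_conv_app_nth)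
    then have "(inv (xs ! i), xs ! Suc i) \<in> lin_turns xs"
      using append_take_drop_id[of "Suc i" xs] unfolding lin_turns_def by (smt (verit) mem_Collect_eq)
    then show "inv (xs ! i) \<noteq> xs ! Suc i" by (rule xs(3))
  qed
  ultimately show "xs \<noteq> [] \<and> reduced xs \<and> list_prod G xs = g" using xs by (simp add: reduced_def)
next
  assume xs: "xs \<noteq> [] \<and> reduced xs \<and> list_prod G xs = g"
  have "a \<noteq> b" if ab: "(a, b) \<in> lin_turns xs" for a b
  proof -
    obtain p q where pq: "xs = p @ q"
      "a = (if p = [] then \<one> else inv (last p))" "b = (if q = [] then \<one> else hd q)"
      using ab by (auto simp: lin_turns_def)
    have l: "set p \<subseteq> letters" "set q \<subseteq> letters" using xs by (auto simp: pq reduced_def)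
    have "p \<noteq> [] \<Longrightarrow> inv (last p) \<in> letters" "q \<noteq> [] \<Longrightarrow> hd q \<in> letters"
      using l last_in_set[of p] hd_in_set[of q] by (meson letters_inv subsetD)+
    then have "p \<noteq> [] \<Longrightarrow> inv (last p) \<noteq> \<one>" "q \<noteq> [] \<Longrightarrow> \<one> \<noteq> hd q"
      by (metis letter_neq_one)+
    then show ?thesis
      using xs pq by (cases "p = []"; cases "q = []") (auto simp: reduced_append)
  qed
  then show "expresses G X (Elt g) xs"
    using xs by (auto simp: expresses_def seq_turns_Elt reduced_def letters_def)
qed

lemma expresses_Cls_iff:
  assumes "\<one> \<notin> C"
  shows "expresses G X (Cls C) xs \<longleftrightarrow> cyc_reduced xs \<and> list_prod G xs \<in> C"
proof
  assume e: "expresses G X (Cls C) xs"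
  have ne: "xs \<noteq> []" using e assms by (auto simp: expresses_def)
  then have xs: "set xs \<subseteq> letters" "list_prod G xs \<in> C" "\<And>a b. (a, b) \<in> cyc_turns xs \<Longrightarrow> a \<noteq> b"
    using e by (auto simp: expresses_def letters_def seq_turns_Cls)
  have "inv (last (rotate k xs)) \<noteq> hd (rotate k xs)" for k
    by (rule xs(3)) (auto simp: cyc_turns_def)
  note turn = this
  have "successively (\<lambda>a b. inv a \<noteq> b) xs"
    unfolding successively_conv_nth
  proof (intro allI impI)
    fix i assume i: "Suc i < length xs"
    have "rotate (Suc i) xs = drop (Suc i) xs @ take (Suc i) xs"
      using i rotate_drop_take[of "Suc i" xs] by simp
    then have "last (rotate (Suc i) xs) = xs ! i" "hd (rotate (Suc i) xs) = xs ! Suc i"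
      using i by (auto simp: hd_append hd_drop_conv_nth take_Suc_conv_app_nth)
    then show "inv (xs ! i) \<noteq> xs ! Suc i" using turn[of "Suc i"] by simp
  qed
  then show "cyc_reduced xs \<and> list_prod G xs \<in> C"
    using xs ne turn[of 0] by (simp add: cyc_reduced_def reduced_def)
next
  assume xs: "cyc_reduced xs \<and> list_prod G xs \<in> C"
  have "cyc_reduced (rotate k xs)" for k
    using xs by (induction k) (auto intro: cyc_reduced_rotate1)
  then have "inv (last (rotate k xs)) \<noteq> hd (rotate k xs)" for k by (simp add: cyc_reduced_def)
  then show "expresses G X (Cls C) xs"
    using xs by (auto simp: expresses_def seq_turns_Cls cyc_reduced_def reduced_def letters_def cyc_turns_def)
qed

text \<open>
  As long as the last letter is inverse to the first, conjugation removes both.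
\<close>

lemma cyc_reduced_exists:
  assumes "reduced xs" "xs \<noteq> []"
  shows "\<exists>ys. cyc_reduced ys \<and> (\<exists>c\<in>carrier G. list_prod G ys = c \<otimes> list_prod G xs \<otimes> inv c)"
  using assms
proof (induction xs rule: length_induct)
  case (1 xs)
  show ?case
  proof (cases "inv (last xs) = hd xs")
    case False
    then have "cyc_reduced xs" using 1 by (simp add: cyc_reduced_def)
    then show ?thesis
      using reduced_carrier[OF "1.prems"(1)] by (intro exI[of _ xs] conjI bexI[of _ \<one>]) auto
  next
    case True
    obtain a zs where a: "xs = a # zs" using "1.prems"(2) by (cases xs) auto
    have "a \<in> letters" using "1.prems"(1) by (simp add: a reduced_Cons)
    then have "zs \<noteq> []" using True letter_inv_neq[of a] by (auto simp: a)
    then obtain ys b where b: "zs = ys @ [b]" by (cases zs rule: rev_cases) auto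
    have r: "reduced ys" "b \<in> letters" "inv b = a" "inv a \<noteq> hd (ys @ [b])"
      using "1.prems"(1) True by (auto simp: a b reduced_Cons reduced_append)
    have "ys \<noteq> []" using r letters_inv_iff[of b a] \<open>a \<in> letters\<close> by auto
    then obtain us c where us: "cyc_reduced us" "c \<in> carrier G"
      "list_prod G us = c \<otimes> list_prod G ys \<otimes> inv c"
      using "1.IH"[rule_format, of ys] r(1) by (auto simp: a b)
    have car: "set ys \<subseteq> carrier G" "a \<in> carrier G" "b \<in> carrier G"
      using reduced_carrier[OF r(1)] r(2) \<open>a \<in> letters\<close> by auto
    have "b = inv a" using r(3) car by auto
    have "inv a \<otimes> (a \<otimes> z) = z" if "z \<in> carrier G" for z
      using that car by (simp flip: m_assoc)
    then have "list_prod G us = (c \<otimes> inv a) \<otimes> list_prod G xs \<otimes> inv (c \<otimes> inv a)"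
      using car us by (simp add: a b \<open>b = inv a\<close> list_prod_append inv_mult_group m_assoc)
    then show ?thesis using us car by (intro exI[of _ us] conjI bexI[of _ "c \<otimes> inv a"]) auto
  qed
qed

end

section \<open>Whitehead graphs without cutvertices\<close>

context group
begin

lemma conj_class_conj:
  assumes "h \<in> carrier G" "g \<in> conj_class G h" "g' \<in> conj_class G h"
  shows "\<exists>d\<in>carrier G. g = d \<otimes> g' \<otimes> inv d"
proof -
  obtain a b where ab: "a \<in> carrier G" "g = a \<otimes> h \<otimes> inv a" "b \<in> carrier G" "g' = b \<otimes> h \<otimes> inv b"
    using assms by (auto simp: conj_class_def)
  have "inv b \<otimes> (b \<otimes> z) = z" if "z \<in> carrier G" for z
    using that ab by (simp flip: m_assoc)
  then have "g = (a \<otimes> inv b) \<otimes> g' \<otimes> inv (a \<otimes> inv b)"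
    using ab assms(1) by (simp add: m_assoc inv_mult_group)
  then show ?thesis using ab by blast
qed

lemma one_in_conj_class:
  assumes "h \<in> carrier G" "\<one> \<in> conj_class G h"
  shows "h = \<one>"
proof -
  obtain c where c: "c \<in> carrier G" "c \<otimes> h \<otimes> inv c = \<one>"
    using assms by (auto simp: conj_class_def)
  then have "inv c \<otimes> (c \<otimes> h \<otimes> inv c) \<otimes> c = \<one>" by simp
  moreover have "inv c \<otimes> (c \<otimes> h \<otimes> inv c) \<otimes> c = h"
    using c(1) assms(1) by (simp add: m_assoc) (simp flip: m_assoc)
  ultimately show ?thesis by simp
qed

lemma self_in_conj_class: "h \<in> carrier G \<Longrightarrow> h \<in> conj_class G h"
  unfolding conj_class_def by (force intro: exI[of _ \<one>])

lemma letter_turns: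
  assumes "z \<in> set xs"
  shows "\<exists>a. (a, z) \<in> seq_turns G r xs" "\<exists>b. (inv z, b) \<in> seq_turns G r xs"
proof -
  obtain k where k: "k < length xs" "xs ! k = z" using assms by (auto simp: in_set_conv_nth)
  then have p: "padded G r xs ! (k + 1) = z" by (cases r) (auto simp: nth_append)
  show "\<exists>a. (a, z) \<in> seq_turns G r xs"
    unfolding seq_turns_def using k p by (auto intro!: exI[of _ k])
  show "\<exists>b. (inv z, b) \<in> seq_turns G r xs"
    unfolding seq_turns_def using k p by (auto intro!: exI[of _ "k + 1"])
qed

lemma whitehead_connected:
  assumes nocut: "\<not> cutvertex (whitehead_graph G X R) y"
    and y: "y \<in> fst (whitehead_graph G X R)"
    and const: "\<And>a b. (a, b) \<in> (\<Union>r\<in>R. turns G X r) \<Longrightarrow> a \<noteq> y \<Longrightarrow> b \<noteq> y \<Longrightarrow> \<psi> a = \<psi> b"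
    and u: "u \<in> fst (whitehead_graph G X R)" "u \<noteq> y"
    and v: "v \<in> fst (whitehead_graph G X R)" "v \<noteq> y"
  shows "\<psi> u = \<psi> v"
proof (rule ccontr)
  assume neq: "\<psi> u \<noteq> \<psi> v"
  let ?V = "fst (whitehead_graph G X R)"
  define V1 where "V1 = {x \<in> ?V - {y}. \<psi> x = \<psi> u}"
  define V2 where "V2 = {x \<in> ?V - {y}. \<psi> x \<noteq> \<psi> u}"
  have "\<not> (meets e V1 \<and> meets e V2)" if "e \<in> snd (whitehead_graph G X R)" for e
  proof -
    obtain a b where e: "e = (a, b)" by (cases e)
    then have "(a, b) \<in> (\<Union>r\<in>R. turns G X r)"
      using that by (simp add: whitehead_graph_def Let_def)
    then have "a \<noteq> y \<Longrightarrow> b \<noteq> y \<Longrightarrow> \<psi> a = \<psi> b" using const by blast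
    then show ?thesis by (auto simp: e meets_def V1_def V2_def)
  qed
  moreover have "?V - {y} = V1 \<union> V2" "V1 \<inter> V2 = {}" by (auto simp: V1_def V2_def)
  moreover have "u \<in> V1" "v \<in> V2" using u v neq by (auto simp: V1_def V2_def)
  then have "V1 \<noteq> {}" "V2 \<noteq> {}" by auto
  ultimately have "cutvertex (whitehead_graph G X R) y"
    using y unfolding cutvertex_def by blast
  then show False using nocut by simp
qed

end

lemma (in based_group) support_vertices:
  assumes "r \<in> R" "x \<in> support G X r"
  shows "x \<in> fst (whitehead_graph G X R)" "inv x \<in> fst (whitehead_graph G X R)"
proof -
  obtain xs where xs: "expresses G X r xs" "x \<in> pm G (set xs)" "x \<in> X"
    using assms(2) by (auto simp: support_def)
  have sub: "set xs \<subseteq> letters" using xs(1) by (simp add: expresses_def letters_def)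
  have z: "z \<in> fst (whitehead_graph G X R)" "inv z \<in> fst (whitehead_graph G X R)" if z: "z \<in> set xs" for z
  proof -
    obtain a b where ab: "(a, z) \<in> seq_turns G r xs" "(inv z, b) \<in> seq_turns G r xs"
      using letter_turns[OF z, of r] by blast
    then have E: "(a, z) \<in> (\<Union>r\<in>R. turns G X r)" "(inv z, b) \<in> (\<Union>r\<in>R. turns G X r)"
      using xs(1) assms(1) by (auto simp: turns_def)
    have l: "z \<in> letters" "inv z \<in> letters" using sub z by auto
    show "z \<in> fst (whitehead_graph G X R)"
      using l(1) E(1) unfolding whitehead_graph_def Let_def zero_pm_def letters_def meets_def by force
    show "inv z \<in> fst (whitehead_graph G X R)"
      using l(2) E(2) unfolding whitehead_graph_def Let_def zero_pm_def letters_def meets_def by force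
  qed
  have "x \<in> set xs \<or> (\<exists>z\<in>set xs. x = inv z)" using xs(2) by (auto simp: pm_def)
  then show "x \<in> fst (whitehead_graph G X R)" "inv x \<in> fst (whitehead_graph G X R)"
    using z sub by auto
qed

context based_turns
begin

lemma word_index:
  assumes "xs \<in> WE \<union> WC" "x \<in> pm G (set xs)"
  shows "\<phi> x = \<phi> (hd xs)"
proof -
  have "set xs \<subseteq> letters"
    using assms(1) elt_words cls_words by (auto simp: elt_word_def cls_word_def cyc_reduced_def reduced_def)
  then show ?thesis
    using assms elt_word_index[of xs] cls_word_index[of xs] index_inv by (auto simp: pm_def)
qed

lemma support_Elt_index:
  assumes "\<And>xs. expresses G X (Elt g) xs \<Longrightarrow> xs \<in> WE"
    and "x \<in> support G X (Elt g)" "y \<in> support G X (Elt g)"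
  shows "\<phi> x = \<phi> y"
proof -
  obtain xs ys where xs: "expresses G X (Elt g) xs" "x \<in> pm G (set xs)"
    and ys: "expresses G X (Elt g) ys" "y \<in> pm G (set ys)"
    using assms(2,3) by (auto simp: support_def)
  then have "xs = ys" using reduced_unique by (auto simp: expresses_Elt_iff)
  then show ?thesis using word_index[of xs x] word_index[of ys y] xs ys assms(1) by auto
qed

text \<open>
  Two cyclically reduced words for the same class might a priori have letters of different
  indices. They would then lie in subgroups generated by disjoint parts of the basis, which share no
  nontrivial conjugacy class.
\<close>

lemma support_Cls_index:
  assumes h: "h \<in> carrier G" "h \<noteq> \<one>"
    and words: "\<And>xs. expresses G X (Cls (conj_class G h)) xs \<Longrightarrow> xs \<in> WC"
    and "x \<in> support G X (Cls (conj_class G h))" "y \<in> support G X (Cls (conj_class G h))"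
  shows "\<phi> x = \<phi> y"
proof (rule ccontr)
  assume neq: "\<phi> x \<noteq> \<phi> y"
  have one: "\<one> \<notin> conj_class G h" using one_in_conj_class h by blast
  obtain xs ys where xs: "expresses G X (Cls (conj_class G h)) xs" "x \<in> pm G (set xs)"
    and ys: "expresses G X (Cls (conj_class G h)) ys" "y \<in> pm G (set ys)"
    using assms(4,5) by (auto simp: support_def)
  \<comment> \<open>the letters of \<open>xs\<close> lie in \<open>A\<close> up to inversion, those of \<open>ys\<close> outside\<close>
  define A where "A = {z \<in> X. \<phi> z = \<phi> x}"
  have A: "A \<subseteq> X" "X - A \<subseteq> X" "A \<inter> (X - A) = {}" by (auto simp: A_def)
  have index: "\<phi> z = \<phi> x" if "z \<in> pm G (set xs)" for z
    using word_index[of xs] xs words that by auto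
  have index': "\<phi> z = \<phi> y" if "z \<in> pm G (set ys)" for z
    using word_index[of ys] ys words that by auto
  have cyc: "cyc_reduced xs" "list_prod G xs \<in> conj_class G h"
    "cyc_reduced ys" "list_prod G ys \<in> conj_class G h"
    using xs ys expresses_Cls_iff[OF one] by auto
  have letters: "set xs \<subseteq> letters" "set ys \<subseteq> letters"
    using cyc by (auto simp: cyc_reduced_def reduced_def)
  have "set xs \<subseteq> pm G A"
    using pm_Int_subset_iff[OF A(1) letters(1)] index by (auto simp: A_def)
  then have gx: "list_prod G xs \<in> generate G A"
    using generate_iff_list[OF subset_basis_carrier[OF A(1)]] by blast
  have "set ys \<subseteq> pm G (X - A)"
    using pm_Int_subset_iff[OF A(2) letters(2)] index' neq by (auto simp: A_def)
  then have gy: "list_prod G ys \<in> generate G (X - A)"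
    using generate_iff_list[OF subset_basis_carrier[OF A(2)]] by blast
  obtain d where d: "d \<in> carrier G" "list_prod G xs = d \<otimes> list_prod G ys \<otimes> inv d"
    using conj_class_conj[OF h(1) cyc(2,4)] by blast
  have "list_prod G xs = \<one>"
    using generate_disjoint_conj[OF A gx gy d] .
  then show False using one cyc(2) by simp
qed

end

context based_group
begin

lemma cover_vertices:
  assumes "X \<subseteq> (\<Union>r\<in>R. support G X r)"
  shows "letters \<subseteq> fst (whitehead_graph G X R)"
  using assms support_vertices[of _ R] by (auto simp: letters_def pm_def)

text \<open>
  The set \<open>WE\<close> may contain words other than those of the elements in \<open>R\<close>, which provides a connection to
  the vertex \<open>\<one>\<close> when \<open>R\<close> consists of classes only.
\<close>

lemma connected_turns_imp_factors:
  fixes I :: "'i set"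
  assumes fin: "finite X" and split: "split_group G I Hs \<phi>"
    and alloc: "\<And>r. r \<in> R \<Longrightarrow> \<exists>i\<in>I. \<exists>h. h \<noteq> \<one> \<and>
       (h \<in> Hs i \<and> r = Elt h \<or> (\<exists>c\<in>carrier G. \<exists>k\<in>Hs i. h = c \<otimes> k \<otimes> inv c) \<and> r = Cls (conj_class G h))"
    and WE: "\<And>g xs. Elt g \<in> R \<Longrightarrow> expresses G X (Elt g) xs \<Longrightarrow> xs \<in> WE"
    and WE': "\<And>xs. xs \<in> WE \<Longrightarrow> xs \<noteq> [] \<and> reduced xs \<and> (\<exists>i\<in>I. list_prod G xs \<in> Hs i)"
    and conn: "\<And>\<psi> u y. y \<in> letters \<Longrightarrow>
      (\<And>a b. (a, b) \<in> \<Union>(lin_turns ` WE) \<union> (\<Union>r\<in>R. turns G X r) \<Longrightarrow> a \<noteq> y \<Longrightarrow> b \<noteq> y \<Longrightarrow> \<psi> a = (\<psi> b :: 'i)) \<Longrightarrow>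
      u \<in> insert \<one> letters \<Longrightarrow> u \<noteq> y \<Longrightarrow> \<psi> u = \<psi> \<one>"
  shows "(\<forall>x\<in>letters. \<exists>i\<in>I. x \<in> Hs i) \<and>
    (\<forall>r\<in>R. \<forall>x\<in>support G X r. \<forall>y\<in>support G X r. \<phi> x = \<phi> y)"
proof -
  interpret S: split_group G I Hs \<phi> by fact
  interpret B: based_split G X I Hs \<phi> by unfold_locales fact
  define WC where "WC = {xs. \<exists>C. Cls C \<in> R \<and> expresses G X (Cls C) xs}"
  have conj_carrier: "h \<in> carrier G" if "i \<in> I" "c \<in> carrier G" "k \<in> Hs i" "h = c \<otimes> k \<otimes> inv c" for h i c k
    using that S.factor_carrier by simp
  have cls_R: "\<exists>i\<in>I. \<exists>h c k. h \<noteq> \<one> \<and> h \<in> carrier G \<and> c \<in> carrier G \<and> k \<in> Hs i \<and>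
      h = c \<otimes> k \<otimes> inv c \<and> C = conj_class G h" if "Cls C \<in> R" for C
    using alloc[OF that] conj_carrier by blast
  have turns_sub: "turns G X r \<subseteq> \<Union>(lin_turns ` WE) \<union> \<Union>(cyc_turns ` WC)" if r: "r \<in> R" for r
  proof (cases r)
    case (Elt g)
    then show ?thesis using r WE by (auto simp: turns_def seq_turns_Elt)
  next
    case (Cls C)
    obtain h where h: "h \<noteq> \<one>" "h \<in> carrier G" "C = conj_class G h"
      using cls_R[of C] r Cls by blast
    have "\<one> \<notin> C" using one_in_conj_class h by blast
    then have "xs \<noteq> []" if "expresses G X (Cls C) xs" for xs
      using that by (auto simp: expresses_Cls_iff cyc_reduced_def)
    then have "turns G X r \<subseteq> \<Union>(cyc_turns ` WC)"
      using r by (auto simp: Cls turns_def WC_def seq_turns_Cls)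
    then show ?thesis by blast
  qed
  interpret T: based_turns G X I Hs \<phi> WE WC
  proof unfold_locales
    fix xs assume "xs \<in> WE"
    then show "B.elt_word xs" using WE' by (simp add: B.elt_word_def)
  next
    fix xs assume "xs \<in> WC"
    then obtain C where C: "Cls C \<in> R" "expresses G X (Cls C) xs" by (auto simp: WC_def)
    obtain i h c k where h: "i \<in> I" "h \<noteq> \<one>" "h \<in> carrier G" "c \<in> carrier G" "k \<in> Hs i"
      "h = c \<otimes> k \<otimes> inv c" "C = conj_class G h"
      using cls_R[OF C(1)] by blast
    have "\<one> \<notin> C" using one_in_conj_class h by blast
    then have xs: "cyc_reduced xs" "list_prod G xs \<in> C" using C(2) expresses_Cls_iff by auto
    then obtain d where d: "d \<in> carrier G" "list_prod G xs = d \<otimes> h \<otimes> inv d"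
      using h by (auto simp: conj_class_def)
    have "k \<in> carrier G" using S.factor_carrier h by blast
    then have "list_prod G xs = (d \<otimes> c) \<otimes> k \<otimes> inv (d \<otimes> c)"
      using d h(4) by (simp add: h(6) m_assoc inv_mult_group)
    moreover have "d \<otimes> c \<in> carrier G" using d h by simp
    ultimately show "B.cls_word xs"
      using xs(1) h(1,5) unfolding B.cls_word_def by blast
  next
    fix y u and \<psi> :: "'a \<Rightarrow> 'i"
    assume y: "y \<in> letters" and u: "u \<in> insert \<one> letters" "u \<noteq> y"
      and \<psi>: "\<And>a b. (a, b) \<in> \<Union>(lin_turns ` WE) \<union> \<Union>(cyc_turns ` WC) \<Longrightarrow> a \<noteq> y \<Longrightarrow> b \<noteq> y \<Longrightarrow> \<psi> a = \<psi> b"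
    show "\<psi> u = \<psi> \<one>"
      using y _ u
    proof (rule conn[where \<psi> = \<psi>])
      fix a b
      assume "(a, b) \<in> \<Union>(lin_turns ` WE) \<union> (\<Union>r\<in>R. turns G X r)" and ab: "a \<noteq> y" "b \<noteq> y"
      then have "(a, b) \<in> \<Union>(lin_turns ` WE) \<union> \<Union>(cyc_turns ` WC)"
        using turns_sub by blast
      then show "\<psi> a = \<psi> b" using \<psi> ab by blast
    qed
  qed
  show ?thesis
  proof (intro conjI ballI)
    fix x assume "x \<in> letters"
    then show "\<exists>i\<in>I. x \<in> Hs i" by (rule T.letter_in_factor)
  next
    fix r x y assume r: "r \<in> R" and xy: "x \<in> support G X r" "y \<in> support G X r"
    show "\<phi> x = \<phi> y"
    proof (cases r)
      case (Elt g)
      then show ?thesis using T.support_Elt_index[of g x y] WE[of g] r xy by blast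
    next
      case (Cls C)
      obtain h where h: "h \<noteq> \<one>" "h \<in> carrier G" "C = conj_class G h"
        using cls_R[of C] r Cls by blast
      then show ?thesis
        using T.support_Cls_index[of h x y] r xy by (auto simp: WC_def Cls)
    qed
  qed
qed

text \<open>
  If \<open>R\<close> contains an element, then \<open>\<one>\<close> is a vertex of the Whitehead graph and the absence of cutvertices
  is the required connectedness. Otherwise choose a cyclically reduced word \<open>ws\<close> for some class and
  conjugate the factorization so that the value of \<open>ws\<close> lies in a factor, which does not affect the
  hypotheses on classes. Adjoining that value as an element joins \<open>\<one>\<close> to two different letters, at least
  one of which remains when a letter is removed.
\<close>

lemma no_cutvertex_imp_factors:
  fixes I :: "'i set"
  assumes fin: "finite X" and "X \<noteq> {}" and split: "split_group G I Hs \<phi>"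
    and alloc: "\<And>r. r \<in> R \<Longrightarrow> \<exists>i\<in>I. \<exists>h\<in>Hs i. h \<noteq> \<one> \<and> (r = Elt h \<or> r = Cls (conj_class G h))"
    and nocut: "\<And>y. y \<in> letters \<Longrightarrow> \<not> cutvertex (whitehead_graph G X R) y"
    and cover: "X \<subseteq> (\<Union>r\<in>R. support G X r)"
  shows "\<exists>Hs' \<phi>'. split_group G I Hs' (\<phi>' :: 'a \<Rightarrow> 'i) \<and> (\<forall>i\<in>I. Hs' i = {\<one>} \<longrightarrow> Hs i = {\<one>}) \<and>
    (\<forall>x\<in>letters. \<exists>i\<in>I. x \<in> Hs' i) \<and>
    (\<forall>r\<in>R. \<forall>x\<in>support G X r. \<forall>y\<in>support G X r. \<phi>' x = \<phi>' y)"
proof -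
  interpret S: split_group G I Hs \<phi> by fact
  let ?V = "fst (whitehead_graph G X R)"
  have V: "letters \<subseteq> ?V" using cover_vertices[OF cover] .
  show ?thesis
  proof (cases "\<exists>g. Elt g \<in> R")
    case True
    then obtain g where g: "Elt g \<in> R" by blast
    obtain i where i: "i \<in> I" "g \<in> Hs i" "g \<noteq> \<one>" using alloc[OF g] by auto
    then have gc: "g \<in> carrier G" using S.factor_carrier by blast
    define WE where "WE = {xs. \<exists>g. Elt g \<in> R \<and> expresses G X (Elt g) xs}"
    have "expresses G X (Elt g) (nword g)"
      using nword[OF gc] nword_Nil_iff[OF gc] i by (simp add: expresses_Elt_iff)
    moreover have "(\<one>, hd (nword g)) \<in> lin_turns (nword g)"
      using nword_Nil_iff[OF gc] i unfolding lin_turns_def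
      by (auto intro!: exI[of _ "[]"])
    ultimately have "(\<one>, hd (nword g)) \<in> turns G X (Elt g)"
      by (auto simp: turns_def seq_turns_Elt)
    then have "(\<one>, hd (nword g)) \<in> (\<Union>r\<in>R. turns G X r)" using g by blast
    then have one: "\<one> \<in> ?V"
      unfolding whitehead_graph_def Let_def zero_pm_def meets_def by force
    have "(\<forall>x\<in>letters. \<exists>i\<in>I. x \<in> Hs i) \<and>
        (\<forall>r\<in>R. \<forall>x\<in>support G X r. \<forall>y\<in>support G X r. \<phi> x = \<phi> y)"
    proof (rule connected_turns_imp_factors[OF fin split, of R WE])
      fix r assume "r \<in> R"
      from alloc[OF this] obtain i h where h: "i \<in> I" "h \<in> Hs i" "h \<noteq> \<one>" "r = Elt h \<or> r = Cls (conj_class G h)"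
        by blast
      moreover have "h = \<one> \<otimes> h \<otimes> inv \<one>" using S.factor_carrier h by simp
      ultimately show "\<exists>i\<in>I. \<exists>h. h \<noteq> \<one> \<and>
       (h \<in> Hs i \<and> r = Elt h \<or> (\<exists>c\<in>carrier G. \<exists>k\<in>Hs i. h = c \<otimes> k \<otimes> inv c) \<and> r = Cls (conj_class G h))"
        by blast
    next
      show "xs \<in> WE" if "Elt g \<in> R" "expresses G X (Elt g) xs" for g xs
        using that by (auto simp: WE_def)
    next
      fix xs assume "xs \<in> WE"
      then obtain g where "Elt g \<in> R" "expresses G X (Elt g) xs" by (auto simp: WE_def)
      then show "xs \<noteq> [] \<and> reduced xs \<and> (\<exists>i\<in>I. list_prod G xs \<in> Hs i)"
        using alloc[of "Elt g"] by (auto simp: expresses_Elt_iff)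
    next
      fix \<psi> :: "'a \<Rightarrow> 'i" and u y
      assume y: "y \<in> letters" and u: "u \<in> insert \<one> letters" "u \<noteq> y"
        and \<psi>: "\<And>a b. (a, b) \<in> \<Union>(lin_turns ` WE) \<union> (\<Union>r\<in>R. turns G X r) \<Longrightarrow> a \<noteq> y \<Longrightarrow> b \<noteq> y \<Longrightarrow> \<psi> a = \<psi> b"
      have "\<one> \<noteq> y" using y letter_neq_one by blast
      then show "\<psi> u = \<psi> \<one>"
        using whitehead_connected[OF nocut[OF y], of \<psi> u \<one>] y u V one \<psi> by blast
    qed
    then show ?thesis using split by blast
  next
    case False
    obtain x where "x \<in> X" using \<open>X \<noteq> {}\<close> by blast
    then obtain r where r: "r \<in> R" "x \<in> support G X r" using cover by blast
    then obtain C where C: "r = Cls C" using False by (cases r) auto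
    obtain i h where h: "i \<in> I" "h \<in> Hs i" "h \<noteq> \<one>" "C = conj_class G h"
      using alloc[OF r(1)] C by auto
    have hc: "h \<in> carrier G" using S.factor_carrier h by blast
    have "\<one> \<notin> C" using one_in_conj_class h hc by blast
    obtain ws where ws: "expresses G X (Cls C) ws" using r(2) C by (auto simp: support_def)
    then have cyc: "cyc_reduced ws" "list_prod G ws \<in> C" using expresses_Cls_iff[OF \<open>\<one> \<notin> C\<close>] by auto
    then obtain c where c: "c \<in> carrier G" "list_prod G ws = c \<otimes> h \<otimes> inv c"
      using h(4) by (auto simp: conj_class_def)
    define K where "K x = c \<otimes> x \<otimes> inv c" for x
    have split': "split_group G I (\<lambda>i. K ` Hs i) (\<lambda>f. \<phi> (inv c \<otimes> f \<otimes> c))"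
      using S.conj_split[OF c(1)] by (simp add: K_def)
    have K_inv: "inv c \<otimes> K x \<otimes> c = x" if "x \<in> carrier G" for x
      using that c(1) by (simp add: K_def m_assoc) (simp flip: m_assoc)
    have "(\<forall>x\<in>letters. \<exists>i\<in>I. x \<in> K ` Hs i) \<and>
        (\<forall>r\<in>R. \<forall>x\<in>support G X r. \<forall>y\<in>support G X r. \<phi> (inv c \<otimes> x \<otimes> c) = \<phi> (inv c \<otimes> y \<otimes> c))"
    proof (rule connected_turns_imp_factors[OF fin split', of R "{ws}"])
      fix r assume "r \<in> R"
      then obtain C where "r = Cls C" using False by (cases r) auto
      with alloc[OF \<open>r \<in> R\<close>] obtain i h where h: "i \<in> I" "h \<in> Hs i" "h \<noteq> \<one>" "r = Cls (conj_class G h)"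
        by blast
      moreover have hc: "h \<in> carrier G" using S.factor_carrier h by blast
      then have "h = inv c \<otimes> K h \<otimes> inv (inv c)" using K_inv c(1) by simp
      ultimately show "\<exists>i\<in>I. \<exists>h. h \<noteq> \<one> \<and>
       (h \<in> K ` Hs i \<and> r = Elt h \<or> (\<exists>c\<in>carrier G. \<exists>k\<in>K ` Hs i. h = c \<otimes> k \<otimes> inv c) \<and> r = Cls (conj_class G h))"
        using c(1) by blast
    next
      show "xs \<in> {ws}" if "Elt g \<in> R" "expresses G X (Elt g) xs" for g xs
        using that False by blast
    next
      fix xs assume "xs \<in> {ws}"
      moreover have "list_prod G ws \<in> K ` Hs i" using h c(2) by (auto simp: K_def)
      ultimately show "xs \<noteq> [] \<and> reduced xs \<and> (\<exists>i\<in>I. list_prod G xs \<in> K ` Hs i)"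
        using cyc h(1) by (auto simp: cyc_reduced_def)
    next
      fix \<psi> :: "'a \<Rightarrow> 'i" and u y
      assume y: "y \<in> letters" and u: "u \<in> insert \<one> letters" "u \<noteq> y"
        and \<psi>: "\<And>a b. (a, b) \<in> \<Union>(lin_turns ` {ws}) \<union> (\<Union>r\<in>R. turns G X r) \<Longrightarrow> a \<noteq> y \<Longrightarrow> b \<noteq> y \<Longrightarrow> \<psi> a = \<psi> b"
      have one: "\<one> \<noteq> y" using y letter_neq_one by blast
      have conn: "\<psi> a = \<psi> b" if "a \<in> letters" "a \<noteq> y" "b \<in> letters" "b \<noteq> y" for a b
        using whitehead_connected[OF nocut[OF y], of \<psi> a b] y that V \<psi> by blast
      have ne: "ws \<noteq> []" "set ws \<subseteq> letters" using cyc by (auto simp: cyc_reduced_def reduced_def)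
      have ends: "inv (last ws) \<in> letters" "hd ws \<in> letters" "inv (last ws) \<noteq> hd ws"
        using hd_letter[OF ne(2,1)] last_letter[OF ne(2,1)] cyc by (auto simp: cyc_reduced_def)
      have "(\<one>, hd ws) \<in> lin_turns ws" "(inv (last ws), \<one>) \<in> lin_turns ws"
        unfolding lin_turns_def using ne(1) by (auto intro: exI[of _ "[]"])
      then have one_hd: "hd ws \<noteq> y \<Longrightarrow> \<psi> \<one> = \<psi> (hd ws)"
        and one_last: "inv (last ws) \<noteq> y \<Longrightarrow> \<psi> (inv (last ws)) = \<psi> \<one>"
        using \<psi> one by blast+
      show "\<psi> u = \<psi> \<one>"
      proof (cases "u = \<one>")
        case False
        then have u': "u \<in> letters" using u by simp
        show ?thesis
        proof (cases "hd ws = y")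
          case True
          then show ?thesis using ends one_last conn[OF u' u(2) ends(1)] by simp
        next
          case False
          then show ?thesis using ends one_hd conn[OF u' u(2) ends(2)] by simp
        qed
      qed simp
    qed
    moreover have "Hs i = {\<one>}" if i: "i \<in> I" and K: "K ` Hs i = {\<one>}" for i
    proof -
      have "x = \<one>" if "x \<in> Hs i" for x
      proof -
        have "K x = \<one>" using that K by blast
        then show ?thesis using K_inv[of x] S.factor_carrier[OF i that] c(1) by simp
      qed
      moreover have "\<one> \<in> Hs i" using S.factor[OF i] by (rule subgroup.one_closed)
      ultimately show ?thesis by blast
    qed
    ultimately show ?thesis using split' by blast
  qed
qed

end

section \<open>Free products\<close>

abbreviation subgroups :: "('a, 'b) monoid_scheme \<Rightarrow> 'a set \<times> nat \<Rightarrow> ('a, 'b) monoid_scheme" where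
  "subgroups G \<equiv> \<lambda>(H, k). G\<lparr>carrier := H\<rparr>"

lemma mem_free_product:
  "w \<in> carrier (free_product I (subgroups G)) \<longleftrightarrow>
    (\<forall>(i, a)\<in>set w. i \<in> I \<and> a \<in> fst i \<and> a \<noteq> \<one>\<^bsub>G\<^esub>) \<and> distinct_adj (map fst w)"
  by (auto simp: free_product_def case_prod_unfold)

lemma mult_free_product: "u \<otimes>\<^bsub>free_product I Gs\<^esub> v = foldr (syllable_cons Gs) u v"
  by (simp add: free_product_def)

lemma syllable_cons_subgroups:
  "syllable_cons (subgroups G) (i, a) ((j, b) # w) =
     (if i \<noteq> j then (i, a) # (j, b) # w
      else if a \<otimes>\<^bsub>G\<^esub> b = \<one>\<^bsub>G\<^esub> then w else (i, a \<otimes>\<^bsub>G\<^esub> b) # w)"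
  by (simp add: case_prod_unfold)

declare syllable_cons.simps(2) [simp del]

context group
begin

lemma syllable_cons_closed:
  assumes sub: "\<And>i. i \<in> I \<Longrightarrow> subgroup (fst i) G"
    and a: "i \<in> I" "a \<in> fst i" "a \<noteq> \<one>" and w: "w \<in> carrier (free_product I (subgroups G))"
  shows "syllable_cons (subgroups G) (i, a) w \<in> carrier (free_product I (subgroups G))"
proof (cases w)
  case Nil
  then show ?thesis using a by (simp add: mem_free_product)
next
  case (Cons jb w')
  obtain j b where jb: "jb = (j, b)" by (cases jb)
  have b: "j \<in> I" "b \<in> fst j" "w' \<in> carrier (free_product I (subgroups G))"
    "w' \<noteq> [] \<longrightarrow> j \<noteq> fst (hd w')"
    using w by (auto simp: Cons jb mem_free_product distinct_adj_Cons hd_map)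
  show ?thesis
  proof (cases "i = j")
    case True
    then have "a \<otimes> b \<in> fst i" using sub[OF a(1)] a b subgroup.m_closed by metis
    then show ?thesis
      using b a True by (auto simp: Cons jb syllable_cons_subgroups mem_free_product distinct_adj_Cons hd_map)
  next
    case False
    then show ?thesis
      using w a by (auto simp: Cons jb syllable_cons_subgroups mem_free_product)
  qed
qed

lemma free_product_closed:
  assumes sub: "\<And>i. i \<in> I \<Longrightarrow> subgroup (fst i) G"
    and u: "u \<in> carrier (free_product I (subgroups G))" and v: "v \<in> carrier (free_product I (subgroups G))"
  shows "foldr (syllable_cons (subgroups G)) u v \<in> carrier (free_product I (subgroups G))"
  using u
proof (induction u)
  case (Cons ia u)
  obtain i a where ia: "ia = (i, a)" by (cases ia)
  have "i \<in> I" "a \<in> fst i" "a \<noteq> \<one>" "u \<in> carrier (free_product I (subgroups G))"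
    using Cons.prems by (auto simp: ia mem_free_product dest: distinct_adj_ConsD)
  then show ?case using syllable_cons_closed[OF sub] Cons.IH by (simp add: ia)
qed (simp add: v)

text \<open>
  Multiplication on the right by a single syllable affects the last syllable only; it can make the first
  one disappear only by making the whole product trivial.
\<close>

lemma hd_free_product_mult:
  assumes "w \<noteq> []" "distinct_adj (map fst w)" "foldr (syllable_cons (subgroups G)) w [(i, h)] \<noteq> []"
  shows "fst (hd (foldr (syllable_cons (subgroups G)) w [(i, h)])) = fst (hd w)"
  using assms
proof (induction w)
  case (Cons ja w)
  obtain j a where ja: "ja = (j, a)" by (cases ja)
  show ?case
  proof (cases "w = []")
    case True
    then show ?thesis using Cons.prems by (auto simp: ja syllable_cons_subgroups)
  next
    case False
    let ?v = "foldr (syllable_cons (subgroups G)) w [(i, h)]"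
    show ?thesis
    proof (cases ?v)
      case Nil
      then show ?thesis by (simp add: ja)
    next
      case (Cons kb v)
      have "fst kb = fst (hd w)"
        using Cons.IH False Cons.prems Cons by (auto dest: distinct_adj_ConsD)
      moreover have "j \<noteq> fst (hd w)"
        using Cons.prems(2) False by (auto simp: ja distinct_adj_Cons hd_map)
      ultimately show ?thesis using Cons by (cases kb) (simp add: ja syllable_cons_subgroups)
    qed
  qed
qed simp

lemma factorization_split:
  assumes fac: "is_factorization G \<K>"
  shows "\<exists>\<phi>. split_group G {(H, k). k < count \<K> H} fst \<phi>"
proof -
  define I where "I = {(H, k). k < count \<K> H}"
  let ?FP = "free_product I (subgroups G)"
  define p where "p w = list_prod G (map snd w)" for w :: "(('a set \<times> nat) \<times> 'a) list"
  have p: "p \<in> iso ?FP G"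
    using fac unfolding is_factorization_def p_def I_def by blast
  have sub: "subgroup (fst i) G" if "i \<in> I" for i
  proof -
    have "snd i < count \<K> (fst i)" using that by (auto simp: I_def)
    then have "0 < count \<K> (fst i)" by linarith
    then show ?thesis using fac by (simp add: is_factorization_def)
  qed
  have bij: "bij_betw p (carrier ?FP) (carrier G)" using p by (simp add: iso_def)
  have mult: "p (foldr (syllable_cons (subgroups G)) u v) = p u \<otimes> p v"
    if "u \<in> carrier ?FP" "v \<in> carrier ?FP" for u v
    using p that by (auto simp: iso_def hom_def mult_free_product)
  define nf where "nf = inv_into (carrier ?FP) p"
  have nf_in: "nf g \<in> carrier ?FP" if "g \<in> carrier G" for g
    using that bij unfolding nf_def bij_betw_def by (auto intro: inv_into_into)
  have p_nf: "p (nf g) = g" if "g \<in> carrier G" for g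
    using that bij unfolding nf_def bij_betw_def by (auto intro: f_inv_into_f)
  have nf_p: "nf (p w) = w" if "w \<in> carrier ?FP" for w
    using that bij unfolding nf_def bij_betw_def by auto
  have nf_Nil: "g = \<one>" if "g \<in> carrier G" "nf g = []" for g
    using p_nf[OF that(1)] that(2) by (simp add: p_def)
  have single: "[(i, h)] \<in> carrier ?FP" "p [(i, h)] = h" if "i \<in> I" "h \<in> fst i" "h \<noteq> \<one>" for i h
    using that sub[OF that(1)] subgroup.mem_carrier[of "fst i" G h] by (auto simp: mem_free_product p_def)
  have "split_group G I fst (\<lambda>g. fst (hd (nf g)))"
  proof (intro split_group.intro group_axioms split_group_axioms.intro)
    show "subgroup (fst i) G" if "i \<in> I" for i using sub that .
    show "fst (hd (nf h)) = i" if h: "i \<in> I" "h \<in> fst i" "h \<noteq> \<one>" for i h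
      using nf_p[OF single(1)[OF h]] single(2)[OF h] by simp
    show "fst (hd (nf (f \<otimes> h))) = fst (hd (nf f))"
      if f: "f \<in> carrier G" "f \<noteq> \<one>" and h: "i \<in> I" "h \<in> fst i" and fh: "f \<otimes> h \<noteq> \<one>" for f i h
    proof (cases "h = \<one>")
      case True
      then show ?thesis using f by simp
    next
      case False
      let ?w = "foldr (syllable_cons (subgroups G)) (nf f) [(i, h)]"
      note s = single[OF h False]
      have hc: "h \<in> carrier G" using s sub[OF h(1)] h(2) subgroup.mem_carrier by metis
      have "?w \<in> carrier ?FP" using free_product_closed[OF sub nf_in[OF f(1)] s(1)] .
      moreover have "p ?w = f \<otimes> h" using mult[OF nf_in[OF f(1)] s(1)] p_nf[OF f(1)] s(2) by simp
      ultimately have w: "nf (f \<otimes> h) = ?w" using nf_p by metis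
      moreover have "?w \<noteq> []" using w nf_Nil[of "f \<otimes> h"] fh f(1) hc by auto
      moreover have "nf f \<noteq> []" using nf_Nil f by blast
      moreover have "distinct_adj (map fst (nf f))" using nf_in[OF f(1)] by (simp add: mem_free_product)
      ultimately show ?thesis using hd_free_product_mult by simp
    qed
    show "\<exists>s. (\<forall>(i, a)\<in>set s. i \<in> I \<and> a \<in> fst i \<and> a \<noteq> \<one>) \<and>
        distinct_adj (map fst s) \<and> list_prod G (map snd s) = f" if f: "f \<in> carrier G" for f
      using nf_in[OF f] p_nf[OF f] unfolding mem_free_product p_def by blast
  qed
  then show ?thesis unfolding I_def by blast
qed

end

text \<open>
  The products in the two orders begin with syllables of different indices.
\<close>

lemma (in split_group) factors_not_commuting:
  assumes "i \<in> I" "j \<in> I" "i \<noteq> j" "h \<in> Hs i" "h \<noteq> \<one>" "k \<in> Hs j" "k \<noteq> \<one>"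
  shows "h \<otimes> k \<noteq> k \<otimes> h"
proof
  assume eq: "h \<otimes> k = k \<otimes> h"
  have car: "h \<in> carrier G" "k \<in> carrier G" using assms factor_carrier by auto
  have "h \<otimes> k \<noteq> \<one>"
  proof
    assume "h \<otimes> k = \<one>"
    then have "h = inv k" using car inv_equality by auto
    then have "h \<in> Hs j" using subgroup.m_inv_closed[OF factor[OF assms(2)] assms(6)] by simp
    then show False using \<phi>_factor[of i h] \<phi>_factor[of j h] assms by simp
  qed
  then have "\<phi> (h \<otimes> k) = \<phi> h" "\<phi> (k \<otimes> h) = \<phi> k"
    using \<phi>_mult[OF car(1) assms(5,2,6)] \<phi>_mult[OF car(2) assms(7,1,4)] eq by auto
  then show False
    using \<phi>_factor[OF assms(1,4,5)] \<phi>_factor[OF assms(2,6,7)] eq assms(3) by simp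
qed

section \<open>Blocks of a basis\<close>

text \<open>
  The reduced word of a product of syllables from different blocks is the concatenation of their
  reduced words, as letters of different blocks do not cancel. The first syllable can be read off as
  the longest initial segment within one block, hence normal forms are unique.
\<close>

lemma (in based_group) factorization_by_blocks:
  assumes fin: "finite P" and sub: "\<And>K. K \<in> P \<Longrightarrow> subgroup K G"
    and words: "\<And>K a. K \<in> P \<Longrightarrow> a \<in> K \<Longrightarrow> set (nword a) \<subseteq> K"
    and disj: "\<And>K L. K \<in> P \<Longrightarrow> L \<in> P \<Longrightarrow> K \<noteq> L \<Longrightarrow> K \<inter> L = {\<one>}"
    and cover: "\<And>x. x \<in> letters \<Longrightarrow> \<exists>K\<in>P. x \<in> K"
  shows "is_factorization G (mset_set P)"
proof -
  define I where "I = {(H, k). k < count (mset_set P) H}"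
  have I: "i \<in> I \<longleftrightarrow> fst i \<in> P \<and> snd i = 0" for i
    using fin by (cases i) (simp add: I_def count_mset_set')
  let ?FP = "free_product I (subgroups G)"
  define p where "p w = list_prod G (map snd w)" for w :: "(('a set \<times> nat) \<times> 'a) list"
  have sub': "subgroup (fst i) G" if "i \<in> I" for i using that I sub by simp
  have car: "a \<in> carrier G" if "i \<in> I" "a \<in> fst i" for i a
    using subgroup.mem_carrier[OF sub'[OF that(1)] that(2)] .
  have p_Cons: "p ((i, a) # w) = a \<otimes> p w" for i a w by (simp add: p_def)
  have tail: "w \<in> carrier ?FP" if "ia # w \<in> carrier ?FP" for ia w
    using that by (auto simp: mem_free_product dest: distinct_adj_ConsD)
  have head: "i \<in> I" "a \<in> fst i" "a \<noteq> \<one>" "a \<in> carrier G" if "(i, a) # w \<in> carrier ?FP" for i a w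
    using that car[of i a] by (auto simp: mem_free_product)
  have p_closed: "p w \<in> carrier G" if "w \<in> carrier ?FP" for w
    unfolding p_def using that car by (intro list_prod_closed) (fastforce simp: mem_free_product)
  have p_cons: "p (syllable_cons (subgroups G) (i, a) w) = a \<otimes> p w"
    if a: "a \<in> carrier G" and w: "w \<in> carrier ?FP" for i a w
  proof (cases w)
    case (Cons jb w')
    obtain j b where jb: "jb = (j, b)" by (cases jb)
    have b: "b \<in> carrier G" "p w' \<in> carrier G"
      using head[of j b w'] tail[of jb w'] p_closed w by (auto simp: Cons jb)
    then have "a \<otimes> b \<otimes> p w' = a \<otimes> (b \<otimes> p w')" using a by (simp add: m_assoc)
    moreover have "a \<otimes> b = \<one> \<Longrightarrow> a \<otimes> b \<otimes> p w' = p w'" using b by simp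
    ultimately show ?thesis by (auto simp: Cons jb syllable_cons_subgroups p_Cons)
  qed (simp add: p_Cons)
  have hom: "p (foldr (syllable_cons (subgroups G)) u v) = p u \<otimes> p v"
    if u: "u \<in> carrier ?FP" and v: "v \<in> carrier ?FP" for u v
    using u
  proof (induction u)
    case Nil
    then show ?case using p_closed[OF v] by (simp add: p_def)
  next
    case (Cons ia u)
    obtain i a where ia: "ia = (i, a)" by (cases ia)
    note u = tail[OF Cons.prems]
    have "a \<in> carrier G" using head Cons.prems unfolding ia by blast
    then show ?case
      using Cons.IH[OF u] p_cons[OF _ free_product_closed[OF sub' u v]] p_closed[OF u] p_closed[OF v]
      by (simp add: ia p_Cons m_assoc)
  qed
  have ne: "nword a \<noteq> []" if "i \<in> I" "a \<in> fst i" "a \<noteq> \<one>" for i a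
    using that car nword_Nil_iff by blast
  have letter_disj: "i = j" if "i \<in> I" "j \<in> I" "x \<in> letters" "x \<in> fst i" "x \<in> fst j" for i j x
  proof (rule ccontr)
    assume "i \<noteq> j"
    then have "fst i \<inter> fst j = {\<one>}" using that I disj[of "fst i" "fst j"] by (auto simp: prod_eq_iff)
    then show False using that letter_neq_one by blast
  qed
  have nword_p: "nword (p ((i, a) # w)) = nword a @ nword (p w) \<and>
      takeWhile (\<lambda>x. x \<in> fst i) (nword (p ((i, a) # w))) = nword a"
    if "(i, a) # w \<in> carrier ?FP" for i a w
    using that
  proof (induction w arbitrary: i a)
    case Nil
    have a: "i \<in> I" "a \<in> fst i" "a \<in> carrier G" using head[OF Nil] by auto
    then have "set (nword a) \<subseteq> fst i" using words I by blast
    then show ?case using a by (auto simp: p_def nword_Nil_iff takeWhile_eq_all_conv)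
  next
    case (Cons jb w)
    obtain j b where jb: "jb = (j, b)" by (cases jb)
    have a: "i \<in> I" "a \<in> fst i" "a \<noteq> \<one>" "a \<in> carrier G" using head[OF Cons.prems] by auto
    have w: "(j, b) # w \<in> carrier ?FP" using tail[OF Cons.prems] by (simp add: jb)
    note b = head[OF w]
    have ij: "i \<noteq> j" using Cons.prems by (simp add: jb mem_free_product)
    let ?g = "p ((j, b) # w)"
    have g: "?g \<in> carrier G" using p_closed[OF w] .
    have nb: "nword ?g = nword b @ nword (p w)" using Cons.IH[OF w] by simp
    have sa: "set (nword a) \<subseteq> fst i" "set (nword a) \<subseteq> letters" "nword a \<noteq> []"
      using words a I nword(1)[of a] ne[OF a(1-3)] by (auto simp: reduced_def)
    have sb: "set (nword b) \<subseteq> fst j" "set (nword b) \<subseteq> letters" "nword b \<noteq> []"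
      using words b I nword(1)[of b] ne[OF b(1-3)] by (auto simp: reduced_def)
    have hd_g: "hd (nword ?g) = hd (nword b)" "nword ?g \<noteq> []" using sb(3) by (simp_all add: nb)
    have hb: "hd (nword b) \<in> fst j" "hd (nword b) \<in> letters" using sb hd_in_set by blast+
    then have notin: "hd (nword b) \<notin> fst i" using letter_disj[OF a(1) b(1)] ij by blast
    have "last (nword a) \<in> fst i" using sa last_in_set by blast
    then have "inv (last (nword a)) \<in> fst i" using subgroup.m_inv_closed[OF sub'[OF a(1)]] by blast
    then have "inv (last (nword a)) \<noteq> hd (nword ?g)" using notin hd_g by metis
    then have "reduced (nword a @ nword ?g)"
      using nword(1)[OF a(4)] nword(1)[OF g] by (simp add: reduced_append)
    from nword_list_prod[OF this] have eq: "nword (a \<otimes> ?g) = nword a @ nword ?g"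
      using nword[OF a(4)] nword[OF g] reduced_carrier by (simp add: list_prod_append)
    have "takeWhile (\<lambda>x. x \<in> fst i) (nword ?g) = []"
      using hd_g notin by (cases "nword ?g") auto
    then have "takeWhile (\<lambda>x. x \<in> fst i) (nword a @ nword ?g) = nword a"
      using sa(1) by (subst takeWhile_append2) auto
    then show ?case using eq by (simp add: jb p_Cons[of i])
  qed
  have n1: "nword \<one> = []" using nword_Nil_iff[of \<one>] by simp
  have inj: "u = v" if "u \<in> carrier ?FP" "v \<in> carrier ?FP" "p u = p v" for u v
    using that
  proof (induction u arbitrary: v)
    case Nil
    show ?case
    proof (cases v)
      case (Cons jb w)
      obtain j b where jb: "jb = (j, b)" by (cases jb)
      have w: "(j, b) # w \<in> carrier ?FP" using Nil by (simp add: Cons jb)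
      have "nword (p ((j, b) # w)) = nword \<one>" using Nil by (simp add: Cons jb p_def)
      then show ?thesis using nword_p[OF w] ne[OF head(1-3)[OF w]] n1 by simp
    qed simp
  next
    case (Cons ia u)
    obtain i a where ia: "ia = (i, a)" by (cases ia)
    have u: "(i, a) # u \<in> carrier ?FP" using Cons.prems by (simp add: ia)
    note a = head[OF u]
    show ?case
    proof (cases v)
      case Nil
      have "nword (p ((i, a) # u)) = nword \<one>" using Cons.prems by (simp add: Nil ia p_def)
      then show ?thesis using nword_p[OF u] ne[OF a(1-3)] n1 by simp
    next
      case v: (Cons jb w)
      obtain j b where jb: "jb = (j, b)" by (cases jb)
      have w: "(j, b) # w \<in> carrier ?FP" using Cons.prems by (simp add: v jb)
      note b = head[OF w]
      have eq: "p ((i, a) # u) = p ((j, b) # w)" using Cons.prems by (simp add: v jb ia)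
      have "nword a @ nword (p u) = nword b @ nword (p w)"
        using nword_p[OF u] nword_p[OF w] eq by simp
      then have hd_eq: "hd (nword a) = hd (nword b)" using ne[OF a(1-3)] ne[OF b(1-3)] by (metis hd_append2)
      have "hd (nword a) \<in> fst i" "hd (nword b) \<in> fst j" "hd (nword a) \<in> letters"
        using words[of "fst i" a] words[of "fst j" b] a b I ne[OF a(1-3)] ne[OF b(1-3)]
          nword(1)[OF a(4)] hd_in_set by (auto simp: reduced_def subset_iff)
      then have "i = j" using letter_disj[OF a(1) b(1)] hd_eq by metis
      moreover from this have "nword a = nword b" using nword_p[OF u] nword_p[OF w] eq by metis
      then have "a = b" using nword(2)[OF a(4)] nword(2)[OF b(4)] by metis
      moreover from this have "p u = p w"
        using eq a(4) p_closed[OF tail[OF u]] p_closed[OF tail[OF w]] by (simp add: p_Cons)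
      then have "u = w" using Cons.IH[OF tail[OF u] tail[OF w]] by blast
      ultimately show ?thesis by (simp add: v jb ia)
    qed
  qed
  have surj: "\<exists>w\<in>carrier ?FP. p w = list_prod G xs" if "set xs \<subseteq> letters" for xs
    using that
  proof (induction xs)
    case Nil
    show ?case by (intro bexI[of _ "[]"]) (auto simp: p_def mem_free_product)
  next
    case (Cons x xs)
    then obtain w K where w: "w \<in> carrier ?FP" "p w = list_prod G xs" and K: "K \<in> P" "x \<in> K"
      using cover[of x] by auto
    have x: "x \<in> carrier G" "x \<noteq> \<one>" using Cons.prems by auto
    have "syllable_cons (subgroups G) ((K, 0), x) w \<in> carrier ?FP"
      using syllable_cons_closed[OF sub' _ _ x(2) w(1), of "(K, 0)"] K I by simp
    moreover have "p (syllable_cons (subgroups G) ((K, 0), x) w) = list_prod G (x # xs)"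
      using p_cons[OF x(1) w(1)] w(2) by simp
    ultimately show ?case by blast
  qed
  have "p \<in> iso ?FP G"
    unfolding iso_def bij_betw_def
  proof (intro CollectI conjI)
    show "p \<in> hom ?FP G"
      using p_closed hom by (auto simp: hom_def mult_free_product)
    show "inj_on p (carrier ?FP)" using inj by (auto intro: inj_onI)
    show "p ` carrier ?FP = carrier G"
    proof
      show "p ` carrier ?FP \<subseteq> carrier G" using p_closed by blast
      show "carrier G \<subseteq> p ` carrier ?FP"
      proof
        fix g assume g: "g \<in> carrier G"
        then obtain w where "w \<in> carrier ?FP" "p w = g"
          using surj[of "nword g"] nword[OF g] by (auto simp: reduced_def)
        then show "g \<in> p ` carrier ?FP" by blast
      qed
    qed
  qed
  then show ?thesis
    using fin sub unfolding is_factorization_def p_def I_def by auto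
qed

section \<open>The finest partition\<close>

lemma support_subset: "support G X r \<subseteq> X"
  by (auto simp: support_def)

text \<open>
  The common refinement of all support partitions is itself a support partition. Nonempty supports are
  essential: one point of the support of \<open>r\<close> determines the block that has to contain all of it.
\<close>

lemma finest_partition:
  assumes ne: "\<And>r. r \<in> R \<Longrightarrow> support G X r \<noteq> {}"
  shows "support_partition G X R (finest_partition G X R)"
    and "support_partition G X R Q \<Longrightarrow> Y \<in> finest_partition G X R \<Longrightarrow> \<exists>Z\<in>Q. Y \<subseteq> Z"
proof -
  define E where "E = {(x, y). x \<in> X \<and> y \<in> X \<and>
    (\<forall>Q. support_partition G X R Q \<longrightarrow> (\<exists>Z\<in>Q. x \<in> Z \<and> y \<in> Z))}"
  have part: "partition_on X Q" if "support_partition G X R Q" for Q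
    using that by (simp add: support_partition_def)
  have "equiv X E"
  proof (rule equivI)
    show "E \<subseteq> X \<times> X" by (auto simp: E_def)
    show "refl_on X E"
      using part by (auto simp: E_def refl_on_def partition_on_def)
    show "sym E" unfolding E_def sym_def by blast
    show "trans E"
    proof (rule transI)
      fix x y z assume xy: "(x, y) \<in> E" and yz: "(y, z) \<in> E"
      have "\<exists>Z\<in>Q. x \<in> Z \<and> z \<in> Z" if Q: "support_partition G X R Q" for Q
      proof -
        obtain Z Z' where Z: "Z \<in> Q" "x \<in> Z" "y \<in> Z" "Z' \<in> Q" "y \<in> Z'" "z \<in> Z'"
          using xy yz Q unfolding E_def by blast
        then have "Z = Z'" using part[OF Q] by (auto simp: partition_on_def disjoint_def)
        then show ?thesis using Z by blast
      qed
      then show "(x, z) \<in> E" using xy yz by (auto simp: E_def)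
    qed
  qed
  define P where "P = X // E"
  have "partition_on X P" unfolding P_def using \<open>equiv X E\<close> by (rule partition_on_quotient)
  moreover have "\<exists>Y\<in>P. support G X r \<subseteq> Y" if r: "r \<in> R" for r
  proof -
    obtain x where x: "x \<in> support G X r" using ne[OF r] by blast
    then have "x \<in> X" using support_subset by fastforce
    then have "E `` {x} \<in> P" by (simp add: P_def quotientI)
    moreover have "(x, y) \<in> E" if "y \<in> support G X r" for y
      using that x r support_subset[of G X r] unfolding E_def support_partition_def by blast
    ultimately show ?thesis by blast
  qed
  ultimately have P: "support_partition G X R P" by (simp add: support_partition_def)
  have fine: "\<forall>Y\<in>P. \<exists>Z\<in>Q. Y \<subseteq> Z" if Q: "support_partition G X R Q" for Q
  proof
    fix Y assume "Y \<in> P"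
    then obtain x where x: "x \<in> X" "Y = E `` {x}" by (auto simp: P_def quotient_def)
    then obtain Z where Z: "Z \<in> Q" "x \<in> Z" using part[OF Q] by (auto simp: partition_on_def)
    have "y \<in> Z" if "y \<in> Y" for y
    proof -
      have "(x, y) \<in> E" using that x by simp
      then obtain Z' where "Z' \<in> Q" "x \<in> Z'" "y \<in> Z'" using Q unfolding E_def by blast
      moreover from this have "Z' = Z" using Z part[OF Q] by (auto simp: partition_on_def disjoint_def)
      ultimately show ?thesis by simp
    qed
    then show "\<exists>Z\<in>Q. Y \<subseteq> Z" using Z by blast
  qed
  have "finest_partition G X R = P"
    unfolding finest_partition_def
  proof (rule the_equality)
    show "support_partition G X R P \<and> (\<forall>Q. support_partition G X R Q \<longrightarrow> (\<forall>Y\<in>P. \<exists>Z\<in>Q. Y \<subseteq> Z))"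
      using P fine by blast
  next
    have sub: "A \<subseteq> B" if A: "support_partition G X R A" and B: "support_partition G X R B"
      and AB: "\<forall>Y\<in>A. \<exists>Z\<in>B. Y \<subseteq> Z" and BA: "\<forall>Y\<in>B. \<exists>Z\<in>A. Y \<subseteq> Z" for A B
    proof
      fix Y assume Y: "Y \<in> A"
      then obtain Z Y' where Z: "Z \<in> B" "Y \<subseteq> Z" "Y' \<in> A" "Z \<subseteq> Y'" using AB BA by blast
      have "Y \<noteq> {}" using Y part[OF A] by (auto simp: partition_on_def)
      then have "Y \<inter> Y' \<noteq> {}" using Z by blast
      then have "Y = Y'" using Y Z(3) part[OF A] unfolding partition_on_def disjoint_def by blast
      then show "Y \<in> B" using Z by (metis subset_antisym)
    qed
    fix P' assume P': "support_partition G X R P' \<and>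
      (\<forall>Q. support_partition G X R Q \<longrightarrow> (\<forall>Y\<in>P'. \<exists>Z\<in>Q. Y \<subseteq> Z))"
    show "P' = P"
      using sub[of P' P] sub[of P P'] P' P fine by blast
  qed
  then show "support_partition G X R (finest_partition G X R)"
    and "support_partition G X R Q \<Longrightarrow> Y \<in> finest_partition G X R \<Longrightarrow> \<exists>Z\<in>Q. Y \<subseteq> Z"
    using P fine by auto
qed

lemma finest_partition_split:
  assumes ne: "\<And>r. r \<in> R \<Longrightarrow> support G X r \<noteq> {}"
    and Y: "Y \<in> finest_partition G X R" and A: "A \<subseteq> Y" "A \<noteq> {}" "A \<noteq> Y"
    and sep: "\<And>r. r \<in> R \<Longrightarrow> support G X r \<subseteq> Y \<Longrightarrow> support G X r \<subseteq> A \<or> support G X r \<subseteq> Y - A"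
  shows False
proof -
  let ?P = "finest_partition G X R"
  have P: "support_partition G X R ?P" by (rule finest_partition(1)[OF ne])
  then have part: "partition_on X ?P" by (simp add: support_partition_def)
  define Q where "Q = (?P - {Y}) \<union> {A, Y - A}"
  have disj: "Z \<inter> Y = {}" if "Z \<in> ?P" "Z \<noteq> Y" for Z
    using that part Y by (auto simp: partition_on_def disjoint_def)
  have "partition_on X Q"
  proof (rule partition_onI)
    show "\<Union>Q = X" using part Y A by (auto simp: Q_def partition_on_def)
    show "{} \<notin> Q"
      using part A by (auto simp: Q_def partition_on_def)
    show "disjnt p q" if "p \<in> Q" "q \<in> Q" "p \<noteq> q" for p q
    proof (cases "p \<in> ?P - {Y} \<and> q \<in> ?P - {Y}")
      case True
      then show ?thesis using that(3) part by (auto simp: partition_on_def disjoint_def disjnt_def)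
    next
      case False
      then show ?thesis
        using that disj[of p] disj[of q] A(1) unfolding Q_def disjnt_def by blast
    qed
  qed
  moreover have "\<exists>Z\<in>Q. support G X r \<subseteq> Z" if r: "r \<in> R" for r
  proof -
    obtain Z where Z: "Z \<in> ?P" "support G X r \<subseteq> Z"
      using P r by (auto simp: support_partition_def)
    then show ?thesis using sep[OF r] by (cases "Z = Y") (auto simp: Q_def)
  qed
  ultimately have "support_partition G X R Q" by (simp add: support_partition_def)
  then obtain Z where Z: "Z \<in> Q" "Y \<subseteq> Z" using finest_partition(2)[OF ne _ Y] by blast
  have "Y \<noteq> {}" using A by auto
  then show False using Z disj[of Z] A by (auto simp: Q_def)
qed

section \<open>Passing to a block\<close>

lemma (in group) basis_generates:
  assumes "is_basis G B"
  shows "generate G B = carrier G"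
proof -
  interpret based_group G B by unfold_locales fact
  show ?thesis
  proof
    show "generate G B \<subseteq> carrier G" using generate_incl[OF basis_carrier] .
    show "carrier G \<subseteq> generate G B"
    proof
      fix g assume "g \<in> carrier G"
      then have "set (nword g) \<subseteq> pm G B" "list_prod G (nword g) = g"
        using nword by (auto simp: reduced_def letters_def)
      then show "g \<in> generate G B" using generate_iff_list[OF basis_carrier] by blast
    qed
  qed
qed

context based_group
begin

lemma basis_neq_one: "x \<in> X \<Longrightarrow> x \<noteq> \<one>"
  by (auto simp: letters_def pm_def)

lemma generate_Int:
  assumes Y: "Y \<subseteq> X" "Z \<subseteq> X" "Y \<inter> Z = {}"
  shows "generate G Y \<inter> generate G Z = {\<one>}"
proof -
  have "g = \<one>" if g: "g \<in> generate G Y" "g \<in> generate G Z" for g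
    using generate_disjoint_conj[OF Y g(1,2) one_closed]
      generate_incl[OF subset_basis_carrier[OF Y(1)]] g by auto
  then show ?thesis using generate.one[of G Y] generate.one[of G Z] by blast
qed

text \<open>
  The words of finitely many generators involve finitely many elements of \<open>X\<close>, and no further element
  of \<open>X\<close> lies in the subgroup generated by these.
\<close>

lemma finite_of_finite_basis:
  assumes B: "is_basis G B" "finite B"
  shows "finite X"
proof -
  interpret B: based_group G B by unfold_locales fact
  define X0 where "X0 = (\<Union>b\<in>B. pm G (set (nword b)) \<inter> X)"
  have X0: "X0 \<subseteq> X" "finite X0" using B(2) by (auto simp: X0_def pm_def)
  have "b \<in> generate G X0" if b: "b \<in> B" for b
  proof -
    have bc: "b \<in> carrier G" using b B.basis_carrier by blast
    have "set (nword b) \<subseteq> letters" using nword(1)[OF bc] by (simp add: reduced_def)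
    moreover have "pm G (set (nword b)) \<inter> X \<subseteq> X0" using b by (auto simp: X0_def)
    ultimately have "set (nword b) \<subseteq> pm G X0" using pm_Int_subset_iff[OF X0(1)] by blast
    then show ?thesis
      using generate_iff_list[OF subset_basis_carrier[OF X0(1)]] nword(2)[OF bc] by blast
  qed
  then have "carrier G \<subseteq> generate G X0"
    using generate_subgroup_incl[of B "generate G X0"] generate_is_subgroup[OF subset_basis_carrier[OF X0(1)]]
      basis_generates[OF B(1)] by blast
  moreover have "x \<notin> generate G X0" if x: "x \<in> X" "x \<notin> X0" for x
  proof
    assume "x \<in> generate G X0"
    moreover have "x \<in> generate G {x}" by (simp add: generate.incl)
    moreover have "generate G X0 \<inter> generate G {x} = {\<one>}"
      using generate_Int[of X0 "{x}"] X0 x by blast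
    ultimately show False using basis_neq_one[OF x(1)] by blast
  qed
  ultimately have "X \<subseteq> X0" using basis_carrier by blast
  then show ?thesis using X0(2) finite_subset by blast
qed

lemma generate_is_basis:
  assumes Y: "Y \<subseteq> X"
  shows "is_basis (G\<lparr>carrier := generate G Y\<rparr>) Y"
proof -
  let ?H = "G\<lparr>carrier := generate G Y\<rparr>" and ?F = "free_group_on Y"
  have sub: "subgroup (generate G Y) G" using generate_is_subgroup[OF subset_basis_carrier[OF Y]] .
  have "inv\<^bsub>?H\<^esub> y = inv y" if "y \<in> Y" for y
    using m_inv_consistent[OF sub, of y] that generate.incl[of y Y G] by simp
  then have lval: "map (\<lambda>(x, e). if e then x else inv\<^bsub>?H\<^esub> x) w = map lval w" if "set w \<subseteq> Y \<times> UNIV" for w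
    using that by (intro map_cong) auto
  have val: "word_value ?H w = word_value G w" if "w \<in> carrier ?F" for w
  proof -
    have "set w \<subseteq> Y \<times> UNIV" using that by (simp add: free_group_on_def)
    then show ?thesis by (simp only: word_value_def list_prod_carrier_update lval)
  qed
  have FX: "w \<in> carrier (free_group_on X)" if "w \<in> carrier ?F" for w
    using that Y by (auto simp: free_group_on_def)
  have iso: "word_value G \<in> hom (free_group_on X) G" "inj_on (word_value G) (carrier (free_group_on X))"
    using basis by (auto simp: is_basis_def iso_def bij_betw_def)
  have closed: "foldr letter_cons u v \<in> carrier ?F" if "u \<in> carrier ?F" "v \<in> carrier ?F" for u v
    using that foldr_letter_cons_reduced[of v u] set_foldr_letter_cons[of u v]
    by (auto simp: free_group_on_def)
  have lval_pm: "lval l \<in> pm G Y" if "l \<in> Y \<times> UNIV" for l using that by (auto simp: pm_def)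
  have in_gen: "word_value G w \<in> generate G Y" if "w \<in> carrier ?F" for w
  proof -
    have "set (map lval w) \<subseteq> pm G Y"
      using that lval_pm by (auto simp: free_group_on_def simp del: split_paired_All)
    then show ?thesis
      unfolding word_value_lval using generate_iff_list[OF subset_basis_carrier[OF Y]] by blast
  qed
  have surj: "\<exists>w\<in>carrier ?F. word_value G w = g" if g: "g \<in> generate G Y" for g
  proof -
    have gc: "g \<in> carrier G" using g generate_incl[OF subset_basis_carrier[OF Y]] by blast
    have "word_value G ` carrier (free_group_on X) = carrier G"
      using basis by (auto simp: is_basis_def iso_def bij_betw_def)
    then obtain w where w: "w \<in> carrier (free_group_on X)" "word_value G w = g"
      using gc imageE[of g "word_value G" "carrier (free_group_on X)"] by metis
    then have w': "set w \<subseteq> X \<times> UNIV" "successively (\<lambda>l m. \<not> cancelling l m) w"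
      by (auto simp: free_group_on_def)
    then have "reduced (map lval w)" using reduced_map_lval[of w] by blast
    from nword_list_prod[OF this] have "nword g = map lval w"
      using w(2) by (simp only: word_value_lval)
    then have l: "lval l \<in> pm G Y" if "l \<in> set w" for l
      using nword_generate[OF Y g] that by auto
    have "fst l \<in> Y" if "l \<in> set w" for l
    proof -
      obtain x e where xe: "l = (x, e)" by (cases l)
      have x: "x \<in> X" using w'(1) that xe by auto
      then have "x \<in> letters" by (simp add: letters_def pm_def)
      then have "x \<in> pm G Y" using l[OF that] mem_pm_iff_inv[OF Y, of x] by (cases e) (auto simp: xe)
      then show ?thesis using pm_Int_basis[OF Y] x xe by auto
    qed
    then have "set w \<subseteq> Y \<times> UNIV" by (auto simp: subset_iff)
    then show ?thesis using w w' by (intro bexI[of _ w]) (auto simp: free_group_on_def)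
  qed
  have "word_value ?H \<in> iso ?F ?H"
    unfolding iso_def bij_betw_def
  proof (intro CollectI conjI)
    have "word_value ?H (foldr letter_cons u v) = word_value ?H u \<otimes> word_value ?H v"
      if uv: "u \<in> carrier ?F" "v \<in> carrier ?F" for u v
      using iso(1) FX[OF uv(1)] FX[OF uv(2)] uv closed[OF uv]
      by (simp add: val hom_def) (simp add: free_group_on_def)
    then show "word_value ?H \<in> hom ?F ?H"
      using in_gen val by (auto simp: hom_def) (auto simp: free_group_on_def)
    show "inj_on (word_value ?H) (carrier ?F)"
      using iso(2) FX val by (auto simp: inj_on_def)
    show "word_value ?H ` carrier ?F = carrier ?H"
      using in_gen surj val by force
  qed
  moreover have "Y \<subseteq> generate G Y" using generate.incl[of _ Y G] by blast
  ultimately show ?thesis by (simp add: is_basis_def)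
qed

lemma conj_class_generate:
  assumes Y: "Y \<subseteq> X" and h: "h \<in> generate G Y"
  shows "conj_class (G\<lparr>carrier := generate G Y\<rparr>) h = conj_class G h \<inter> generate G Y"
proof -
  have sub: "subgroup (generate G Y) G" using generate_is_subgroup[OF subset_basis_carrier[OF Y]] .
  interpret sub: subgroup "generate G Y" G by fact
  show ?thesis
  proof (intro equalityI subsetI)
    fix g assume "g \<in> conj_class (G\<lparr>carrier := generate G Y\<rparr>) h"
    then obtain c where c: "c \<in> generate G Y" "g = c \<otimes> h \<otimes> inv c"
      using m_inv_consistent[OF sub] by (auto simp: conj_class_def)
    then show "g \<in> conj_class G h \<inter> generate G Y"
      using h by (auto simp: conj_class_def)
  next
    fix g assume g: "g \<in> conj_class G h \<inter> generate G Y"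
    then obtain c where "c \<in> carrier G" "g = c \<otimes> h \<otimes> inv c" by (auto simp: conj_class_def)
    then obtain d where "d \<in> generate G Y" "g = d \<otimes> h \<otimes> inv d"
      using generate_conj[OF Y _ h] g by blast
    then show "g \<in> conj_class (G\<lparr>carrier := generate G Y\<rparr>) h"
      using m_inv_consistent[OF sub, of d] by (auto simp: conj_class_def intro!: exI[of _ d])
  qed
qed

text \<open>
  A word over \<open>Y\<close> that expresses \<open>r\<close> in the whole group expresses it in \<open>generate G Y\<close>, with the same
  turns. It must be nonempty, since for the empty word the padding consists of unspecified values.
\<close>

lemma support_generate:
  assumes Y: "Y \<subseteq> X" and supp: "support G X r \<subseteq> Y"
    and ne: "\<And>xs. expresses G X r xs \<Longrightarrow> xs \<noteq> []"
  shows "support G X r \<subseteq> support (G\<lparr>carrier := generate G Y\<rparr>) Y (view_in (generate G Y) r)"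
proof
  let ?H = "G\<lparr>carrier := generate G Y\<rparr>"
  have sub: "subgroup (generate G Y) G" using generate_is_subgroup[OF subset_basis_carrier[OF Y]] .
  have one: "\<one> \<in> generate G Y" by (rule generate.one)
  have inv: "inv\<^bsub>?H\<^esub> y = inv y" if "y \<in> generate G Y" for y
    using m_inv_consistent[OF sub that] .
  have Y_gen: "Y \<subseteq> generate G Y" using generate.incl[of _ Y G] by blast
  have pm: "pm ?H S = pm G S" if "S \<subseteq> generate G Y" for S
    using that inv by (auto simp: pm_def image_iff subset_iff)
  have pm_gen: "pm G Y \<subseteq> generate G Y"
    using Y_gen generate.inv[of _ Y G] by (auto simp: pm_def)
  fix x assume x: "x \<in> support G X r"
  then obtain xs where xs: "expresses G X r xs" "x \<in> pm G (set xs)" by (auto simp: support_def)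
  have "set xs \<subseteq> letters" using xs(1) by (simp add: expresses_def letters_def)
  moreover have "pm G (set xs) \<inter> X \<subseteq> Y" using supp xs(1) by (auto simp: support_def)
  ultimately have sxs: "set xs \<subseteq> pm G Y" using pm_Int_subset_iff[OF Y] by blast
  then have gxs: "set xs \<subseteq> generate G Y" using pm_gen by blast
  have "xs \<noteq> []" using ne xs(1) by blast
  have padded: "padded ?H (view_in (generate G Y) r) xs = padded G r xs"
    by (cases r) auto
  have "set (padded G r xs) \<subseteq> generate G Y"
    using gxs one \<open>xs \<noteq> []\<close> last_in_set[of xs] hd_in_set[of xs] by (cases r) auto
  moreover have "length (padded G r xs) = length xs + 2" by (cases r) auto
  ultimately have invs: "inv\<^bsub>?H\<^esub> (padded G r xs ! i) = inv (padded G r xs ! i)" if "i \<le> length xs" for i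
    using that inv by (simp add: subset_iff)
  have turns: "seq_turns ?H (view_in (generate G Y) r) xs = seq_turns G r xs"
    unfolding seq_turns_def padded by (rule Collect_cong, rule ex_cong1) (use invs in auto)
  have prod: "list_prod G xs \<in> generate G Y" using list_prod_in_subgroup[OF sub gxs] .
  have "expresses ?H Y (view_in (generate G Y) r) xs"
    unfolding expresses_def turns
    using xs(1) sxs prod pm[OF Y_gen] by (cases r) (auto simp: expresses_def)
  moreover have "x \<in> Y" using x supp by blast
  ultimately show "x \<in> support ?H Y (view_in (generate G Y) r)"
    using xs(2) pm[OF gxs] by (auto simp: support_def)
qed

end

section \<open>The blocks do not split\<close>

lemma (in group) factorization_two_factors:
  assumes fac: "is_factorization G \<K>" and neq: "\<K> \<noteq> {#carrier G#}" and nontriv: "carrier G \<noteq> {\<one>}"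
  shows "\<exists>i j. i \<in> {(H, k). k < count \<K> H} \<and> j \<in> {(H, k). k < count \<K> H} \<and> i \<noteq> j"
proof (rule ccontr)
  let ?I = "{(H, k). k < count \<K> H}"
  assume "\<not> ?thesis"
  then have unique: "i = j" if "i \<in> ?I" "j \<in> ?I" for i j using that by blast
  obtain \<phi> where "split_group G ?I fst \<phi>" using factorization_split[OF fac] by blast
  then interpret split_group G ?I fst \<phi> .
  obtain g where g: "g \<in> carrier G" "g \<noteq> \<one>" using nontriv one_closed by blast
  obtain s where s: "\<forall>(i, a)\<in>set s. i \<in> ?I \<and> a \<in> fst i \<and> a \<noteq> \<one>" "list_prod G (map snd s) = g"
    using normal_form[OF g(1)] by blast
  then have "s \<noteq> []" using g by auto
  then obtain i where i: "i \<in> ?I" using s(1) by (cases s) auto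
  obtain K k where K: "i = (K, k)" by (cases i)
  have "k < count \<K> K" using i K by simp
  then have "(K, 0) \<in> ?I" by (auto simp del: count_greater_zero_iff)
  then have "k = 0" using unique[OF i] K by auto
  have sub: "subgroup K G" using factor[OF i] K by simp
  have "count \<K> K = 1"
  proof (rule ccontr)
    assume "count \<K> K \<noteq> 1"
    then have "(K, 1) \<in> ?I" using \<open>k < count \<K> K\<close> by simp
    then show False using unique[OF i] K \<open>k = 0\<close> by auto
  qed
  moreover have "count \<K> L = 0" if "L \<noteq> K" for L
  proof (rule ccontr)
    assume "count \<K> L \<noteq> 0"
    then have "(L, 0) \<in> ?I" by (simp only: mem_Collect_eq prod.case neq0_conv)
    from unique[OF i this] show False using K that by simp
  qed
  ultimately have "\<K> = {#K#}" by (intro multiset_eqI) auto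
  moreover have "f \<in> K" if f: "f \<in> carrier G" for f
  proof -
    obtain s where s: "\<forall>(j, a)\<in>set s. j \<in> ?I \<and> a \<in> fst j \<and> a \<noteq> \<one>" "list_prod G (map snd s) = f"
      using normal_form[OF f] by blast
    have "a \<in> K" if "(j, a) \<in> set s" for j a
    proof -
      have "j \<in> ?I" "a \<in> fst j" using that s(1) by auto
      then show ?thesis using unique[OF i] K by auto
    qed
    then have "set (map snd s) \<subseteq> K" by auto
    then show ?thesis using list_prod_in_subgroup[OF sub] s(2) by blast
  qed
  then have "K = carrier G" using subgroup.subset[OF sub] by blast
  ultimately show False using neq by simp
qed

text \<open>
  All letters lie in factors and each support has a constant index, so the elements of one index
  form a part of the basis that separates the supports. It is not the whole basis, as otherwise one factor
  would be the whole group.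
\<close>

lemma (in based_group) splitting_separates_basis:
  assumes fin: "finite X" and "X \<noteq> {}"
    and fac: "is_factorization G \<K>" and nontriv: "\<And>K. K \<in># \<K> \<Longrightarrow> K \<noteq> {\<one>}" and neq: "\<K> \<noteq> {#carrier G#}"
    and alloc: "\<And>r. r \<in> R \<Longrightarrow> \<exists>K. K \<in># \<K> \<and> (\<exists>h\<in>K. h \<noteq> \<one> \<and> (r = Elt h \<or> r = Cls (conj_class G h)))"
    and nocut: "\<And>y. y \<in> pm G X \<Longrightarrow> \<not> cutvertex (whitehead_graph G X R) y"
    and cover: "X \<subseteq> (\<Union>r\<in>R. support G X r)"
  shows "\<exists>A. A \<subseteq> X \<and> A \<noteq> {} \<and> A \<noteq> X \<and> (\<forall>r\<in>R. support G X r \<subseteq> A \<or> support G X r \<subseteq> X - A)"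
proof -
  let ?I = "{(H, k). k < count \<K> H}"
  obtain x0 where x0: "x0 \<in> X" using \<open>X \<noteq> {}\<close> by blast
  have "carrier G \<noteq> {\<one>}" using x0 basis_carrier basis_neq_one by blast
  then obtain i j where ij: "i \<in> ?I" "j \<in> ?I" "i \<noteq> j"
    using factorization_two_factors[OF fac neq] by blast
  obtain \<phi> where split: "split_group G ?I fst \<phi>" using factorization_split[OF fac] by blast
  have "\<exists>i\<in>?I. \<exists>h\<in>fst i. h \<noteq> \<one> \<and> (r = Elt h \<or> r = Cls (conj_class G h))" if r: "r \<in> R" for r
  proof -
    obtain K h where K: "K \<in># \<K>" "h \<in> K" "h \<noteq> \<one>" "r = Elt h \<or> r = Cls (conj_class G h)"
      using alloc[OF r] by blast
    then have "(K, 0) \<in> ?I" by simp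
    then show ?thesis using K by (intro bexI[of _ "(K, 0)"]) auto
  qed
  then obtain Hs' \<phi>' where split': "split_group G ?I Hs' \<phi>'" and triv: "\<forall>i\<in>?I. Hs' i = {\<one>} \<longrightarrow> fst i = {\<one>}"
    and letters: "\<forall>x\<in>letters. \<exists>i\<in>?I. x \<in> Hs' i"
    and supp: "\<forall>r\<in>R. \<forall>x\<in>support G X r. \<forall>y\<in>support G X r. \<phi>' x = \<phi>' y"
    using no_cutvertex_imp_factors[OF fin \<open>X \<noteq> {}\<close> split _ _ cover] nocut unfolding letters_def by blast
  interpret S: split_group G ?I Hs' \<phi>' by fact
  define A where "A = {x \<in> X. \<phi>' x = \<phi>' x0}"
  have "A \<noteq> X"
  proof
    assume "A = X"
    define m where "m = \<phi>' x0"
    have m: "\<phi>' x = m" "x \<in> Hs' m" "m \<in> ?I" if "x \<in> X" for x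
    proof -
      show eq: "\<phi>' x = m" using that \<open>A = X\<close> by (auto simp: A_def m_def)
      have "x \<in> letters" using that by (simp add: letters_def pm_def)
      then obtain n where n: "n \<in> ?I" "x \<in> Hs' n" using letters by blast
      then have "\<phi>' x = n" using S.\<phi>_factor[OF n] basis_neq_one[OF that] by blast
      then show "x \<in> Hs' m" "m \<in> ?I" using n eq by auto
    qed
    have sub: "subgroup (Hs' m) G" using S.factor m(3)[OF x0] by blast
    have "generate G X \<subseteq> Hs' m" using generate_subgroup_incl[OF _ sub] m(2) by blast
    then have all: "carrier G \<subseteq> Hs' m" using basis_generates[OF basis] by simp
    obtain n where n: "n \<in> ?I" "n \<noteq> m" using ij by blast
    have "snd n < count \<K> (fst n)" using n(1) by auto
    then have "0 < count \<K> (fst n)" by linarith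
    then have "fst n \<noteq> {\<one>}" using nontriv by simp
    then have "Hs' n \<noteq> {\<one>}" using triv n(1) by blast
    moreover have "\<one> \<in> Hs' n" using subgroup.one_closed[OF S.factor[OF n(1)]] .
    ultimately obtain h where h: "h \<in> Hs' n" "h \<noteq> \<one>" by blast
    then have "h \<in> Hs' m" using all S.factor_carrier[OF n(1)] by blast
    then show False
      using S.\<phi>_factor[OF n(1) h] S.\<phi>_factor[OF m(3)[OF x0] _ h(2)] n(2) by simp
  qed
  moreover have "A \<subseteq> X" "x0 \<in> A" using x0 by (auto simp: A_def)
  moreover have "support G X r \<subseteq> A \<or> support G X r \<subseteq> X - A" if r: "r \<in> R" for r
  proof (cases "\<exists>x\<in>support G X r. \<phi>' x = \<phi>' x0")
    case True
    then have "\<phi>' y = \<phi>' x0" if "y \<in> support G X r" for y using supp r that by metis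
    then show ?thesis using support_subset[of G X r] by (auto simp: A_def)
  next
    case False
    then show ?thesis using support_subset[of G X r] by (auto simp: A_def)
  qed
  ultimately show ?thesis by blast
qed

section \<open>Allocation by the blocks\<close>

context based_group
begin

lemma expresses_exists:
  assumes r: "r \<in> elts_and_classes G (carrier G - {\<one>})"
  shows "\<exists>xs. expresses G X r xs"
    and "expresses G X r xs \<Longrightarrow> xs \<noteq> [] \<and> set xs \<subseteq> letters \<and> list_prod G xs \<noteq> \<one>"
proof -
  obtain g where g: "g \<in> carrier G" "g \<noteq> \<one>" "r = Elt g \<or> r = Cls (conj_class G g)"
    using r by (auto simp: elts_and_classes_def)
  have one: "\<one> \<notin> conj_class G g" using one_in_conj_class g by blast
  have ne: "nword g \<noteq> []" using nword_Nil_iff g by blast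
  show "\<exists>xs. expresses G X r xs"
    using g(3)
  proof
    assume "r = Elt g"
    then show ?thesis using expresses_Elt_iff[of g "nword g"] nword[OF g(1)] ne by blast
  next
    assume r: "r = Cls (conj_class G g)"
    obtain ys c where ys: "cyc_reduced ys" "c \<in> carrier G" "list_prod G ys = c \<otimes> g \<otimes> inv c"
      using cyc_reduced_exists[OF nword(1)[OF g(1)] ne] nword(2)[OF g(1)] by auto
    then have "list_prod G ys \<in> conj_class G g" by (auto simp: conj_class_def)
    then show ?thesis using expresses_Cls_iff[OF one] ys(1) r by blast
  qed
  assume e: "expresses G X r xs"
  then have "xs \<noteq> [] \<and> reduced xs"
    using g(3) expresses_Elt_iff[of g xs] expresses_Cls_iff[OF one, of xs] by (auto simp: cyc_reduced_def)
  then show "xs \<noteq> [] \<and> set xs \<subseteq> letters \<and> list_prod G xs \<noteq> \<one>"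
    using reduced_prod_one_iff by (auto simp: reduced_def)
qed

lemma support_nonempty:
  assumes r: "r \<in> elts_and_classes G (carrier G - {\<one>})"
  shows "support G X r \<noteq> {}"
proof -
  obtain xs where xs: "expresses G X r xs" using expresses_exists(1)[OF r] by blast
  then have "xs \<noteq> []" "set xs \<subseteq> letters" using expresses_exists(2)[OF r] by blast+
  then have "\<not> set xs \<subseteq> pm G {}" by (auto simp: pm_def)
  then have "\<not> pm G (set xs) \<inter> X \<subseteq> {}"
    using pm_Int_subset_iff[of "{}" "set xs"] \<open>set xs \<subseteq> letters\<close> by blast
  then show ?thesis using xs by (auto simp: support_def)
qed

lemma expresses_in_generate:
  assumes r: "r \<in> elts_and_classes G (carrier G - {\<one>})" and Y: "Y \<subseteq> X" "support G X r \<subseteq> Y"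
    and xs: "expresses G X r xs"
  shows "list_prod G xs \<in> generate G Y"
proof -
  have "set xs \<subseteq> letters" using expresses_exists(2)[OF r xs] by blast
  moreover have "pm G (set xs) \<inter> X \<subseteq> Y" using xs Y by (auto simp: support_def)
  ultimately have "set xs \<subseteq> pm G Y" using pm_Int_subset_iff[OF Y(1)] by blast
  then show ?thesis using generate_iff_list[OF subset_basis_carrier[OF Y(1)]] by blast
qed

end

lemma (in group) conj_class_eq:
  assumes "h \<in> carrier G" "g \<in> conj_class G h"
  shows "conj_class G g = conj_class G h"
proof -
  obtain c where c: "c \<in> carrier G" "g = c \<otimes> h \<otimes> inv c" using assms by (auto simp: conj_class_def)
  have cancel: "inv c \<otimes> (c \<otimes> z) = z" if "z \<in> carrier G" for z
    using that c by (simp flip: m_assoc)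
  show ?thesis
  proof (intro equalityI subsetI)
    fix k assume "k \<in> conj_class G g"
    then obtain d where d: "d \<in> carrier G" "k = d \<otimes> g \<otimes> inv d" by (auto simp: conj_class_def)
    then have "k = (d \<otimes> c) \<otimes> h \<otimes> inv (d \<otimes> c)"
      using c assms(1) by (simp add: m_assoc inv_mult_group)
    then show "k \<in> conj_class G h" using c d by (auto simp: conj_class_def intro!: exI[of _ "d \<otimes> c"])
  next
    fix k assume "k \<in> conj_class G h"
    then obtain d where d: "d \<in> carrier G" "k = d \<otimes> h \<otimes> inv d" by (auto simp: conj_class_def)
    then have "k = (d \<otimes> inv c) \<otimes> g \<otimes> inv (d \<otimes> inv c)"
      using c assms(1) by (simp add: m_assoc inv_mult_group cancel)
    then show "k \<in> conj_class G g" using c d by (auto simp: conj_class_def intro!: exI[of _ "d \<otimes> inv c"])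
  qed
qed

locale allocation_data = based_group F X for F (structure) and X :: "'a set" +
  fixes R :: "'a elt_or_class set"
  assumes finite_basis: "finite X"
    and nontrivial: "R \<subseteq> elts_and_classes F (carrier F - {\<one>})"
begin

abbreviation blocks where "blocks \<equiv> finest_partition F X R"

lemma supports: "r \<in> R \<Longrightarrow> support F X r \<noteq> {}"
  using support_nonempty nontrivial by blast

lemma blocks: "support_partition F X R blocks"
  by (rule finest_partition(1)[OF supports])

lemma blocks_partition: "partition_on X blocks"
  using blocks by (simp add: support_partition_def)

lemma block_subset: "Y \<in> blocks \<Longrightarrow> Y \<subseteq> X"
  using blocks_partition by (auto simp: partition_on_def)

lemma block_nonempty: "Y \<in> blocks \<Longrightarrow> Y \<noteq> {}"
  using blocks_partition by (auto simp: partition_on_def)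

lemma blocks_disjoint: "Y \<in> blocks \<Longrightarrow> Z \<in> blocks \<Longrightarrow> Y \<noteq> Z \<Longrightarrow> Y \<inter> Z = {}"
  using blocks_partition by (auto simp: partition_on_def disjoint_def)

lemma finite_blocks: "finite blocks"
  using blocks_partition finite_basis finite_elements by blast

lemma inj_generate: "inj_on (generate F) blocks"
proof (rule inj_onI, rule ccontr)
  fix Y Z assume YZ: "Y \<in> blocks" "Z \<in> blocks" "generate F Y = generate F Z" "Y \<noteq> Z"
  then have "generate F Y = {\<one>}"
    using generate_Int[OF block_subset[OF YZ(1)] block_subset[OF YZ(2)] blocks_disjoint[OF YZ(1,2,4)]]
    by simp
  moreover obtain y where "y \<in> Y" using block_nonempty[OF YZ(1)] by blast
  ultimately have "y = \<one>" using generate.incl[of y Y F] by blast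
  then show False using basis_neq_one \<open>y \<in> Y\<close> block_subset[OF YZ(1)] by blast
qed

abbreviation factors where "factors \<equiv> image_mset (generate F) (mset_set blocks)"

lemma factors_mset_set: "factors = mset_set (generate F ` blocks)"
  using image_mset_mset_set[OF inj_generate] .

lemma factors_factorization: "is_factorization F factors"
  unfolding factors_mset_set
proof (rule factorization_by_blocks)
  show "finite (generate F ` blocks)" using finite_blocks by simp
  show "subgroup K F" if "K \<in> generate F ` blocks" for K
    using that generate_is_subgroup subset_basis_carrier block_subset by auto
  show "set (nword a) \<subseteq> K" if K: "K \<in> generate F ` blocks" "a \<in> K" for K a
  proof -
    obtain Y where Y: "Y \<in> blocks" "K = generate F Y" using K by blast
    have "pm F Y \<subseteq> generate F Y"
      using generate.incl[of _ Y F] generate.inv[of _ Y F] by (auto simp: pm_def)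
    then show ?thesis using nword_generate[OF block_subset[OF Y(1)], of a] K(2) Y by blast
  qed
  show "K \<inter> L = {\<one>}" if KL: "K \<in> generate F ` blocks" "L \<in> generate F ` blocks" "K \<noteq> L" for K L
  proof -
    obtain Y Z where Y: "Y \<in> blocks" "K = generate F Y" and Z: "Z \<in> blocks" "L = generate F Z"
      using KL(1,2) by (elim imageE)
    then have "Y \<noteq> Z" using KL(3) by auto
    then have "Y \<inter> Z = {}" using blocks_disjoint Y Z by simp
    then show ?thesis using generate_Int[OF block_subset[OF Y(1)] block_subset[OF Z(1)]] Y Z by simp
  qed
  show "\<exists>K\<in>generate F ` blocks. x \<in> K" if x: "x \<in> letters" for x
  proof -
    have "x \<in> X \<or> (\<exists>y\<in>X. x = inv y)" using x by (auto simp: letters_def pm_def)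
    then obtain y where y: "y \<in> X" "x = y \<or> x = inv y" by blast
    then obtain Y where "Y \<in> blocks" "y \<in> Y" using blocks_partition by (auto simp: partition_on_def)
    then show ?thesis using y(2) generate.incl[of y Y F] generate.inv[of y Y F] by blast
  qed
qed

lemma factors_allocating: "is_allocating F R factors"
  unfolding is_allocating_def
proof (intro conjI ballI factors_factorization)
  fix K assume "K \<in># factors"
  then obtain Y where Y: "Y \<in> blocks" "K = generate F Y" using finite_blocks by auto
  obtain y where "y \<in> Y" using block_nonempty[OF Y(1)] by blast
  then have "y \<in> K" "y \<noteq> \<one>"
    using Y generate.incl[of y Y F] block_subset[OF Y(1)] basis_neq_one by blast+
  then show "K \<noteq> {\<one>}" by blast
next
  show "R \<subseteq> elts_and_classes F (\<Union>H\<in>set_mset factors. H)"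
  proof
    fix r assume "r \<in> R"
    then have r: "r \<in> elts_and_classes F (carrier F - {\<one>})" using nontrivial by blast
    obtain Y where Y: "Y \<in> blocks" "support F X r \<subseteq> Y"
      using blocks \<open>r \<in> R\<close> by (auto simp: support_partition_def)
    obtain xs where xs: "expresses F X r xs" using expresses_exists(1)[OF r] by blast
    have "list_prod F xs \<in> generate F Y"
      using expresses_in_generate[OF r block_subset[OF Y(1)] Y(2) xs] .
    then have gen: "list_prod F xs \<in> (\<Union>H\<in>set_mset factors. H)"
      using Y(1) finite_blocks by auto
    obtain g where g: "g \<in> carrier F" "r = Elt g \<or> r = Cls (conj_class F g)"
      using r by (auto simp: elts_and_classes_def)
    then have "r = Elt (list_prod F xs) \<or> r = Cls (conj_class F (list_prod F xs))"
      using xs conj_class_eq[OF g(1)] by (auto simp: expresses_def)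
    then show "r \<in> elts_and_classes F (\<Union>H\<in>set_mset factors. H)"
      using gen unfolding elts_and_classes_def by blast
  qed
qed

text \<open>
  Let \<open>\<K>\<close> be a nontrivial splitting of the block's subgroup. If the supports within the block cover it,
  then \<open>splitting_separates_basis\<close> refines the partition, contrary to the choice of the finest one. An
  uncovered element of \<open>Y\<close> could be split off as a block of its own, so it is the whole of \<open>Y\<close>; then
  the subgroup is cyclic, and elements of different factors would commute.
\<close>

lemma block_factor_atomic:
  assumes Y: "Y \<in> blocks"
    and nocut: "\<And>v. v \<in> pm (F\<lparr>carrier := generate F Y\<rparr>) Y \<Longrightarrow>
      \<not> cutvertex (whitehead_graph (F\<lparr>carrier := generate F Y\<rparr>) Y (restricted_to F X R Y)) v"
    and fac: "is_factorization (F\<lparr>carrier := generate F Y\<rparr>) \<K>"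
    and nontriv: "\<And>K. K \<in># \<K> \<Longrightarrow> K \<noteq> {\<one>}"
    and alloc: "\<And>r. r \<in> R \<Longrightarrow> support F X r \<subseteq> Y \<Longrightarrow>
      \<exists>K. K \<in># \<K> \<and> (\<exists>h\<in>K. h \<noteq> \<one> \<and> (r = Elt h \<or> r = Cls (conj_class F h)))"
  shows "\<K> = {#generate F Y#}"
proof (rule ccontr)
  assume neq: "\<K> \<noteq> {#generate F Y#}"
  let ?H = "F\<lparr>carrier := generate F Y\<rparr>"
  let ?RY = "restricted_to F X R Y"
  note YX = block_subset[OF Y]
  have sub: "subgroup (generate F Y) F" using generate_is_subgroup[OF subset_basis_carrier[OF YX]] .
  interpret H: based_group ?H Y
    using subgroup.subgroup_is_group[OF sub group_axioms] generate_is_basis[OF YX]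
    by (simp add: based_group_def based_group_axioms_def)
  have finY: "finite Y" using finite_subset[OF YX finite_basis] .
  have K_sub: "K \<subseteq> generate F Y" if "K \<in># \<K>" for K
    using fac that subgroup.subset[of K ?H] by (auto simp: is_factorization_def)
  have supp: "support F X r \<subseteq> support ?H Y (view_in (generate F Y) r)"
    if r: "r \<in> R" "support F X r \<subseteq> Y" for r
    using support_generate[OF YX r(2)] expresses_exists(2) nontrivial r(1) by blast
  have RY: "view_in (generate F Y) r \<in> ?RY" if "r \<in> R" "support F X r \<subseteq> Y" for r
    using that by (auto simp: restricted_to_def)
  have covered: "Y \<subseteq> (\<Union>r\<in>?RY. support ?H Y r)"
  proof (rule ccontr)
    assume "\<not> ?thesis"
    then obtain y where y: "y \<in> Y" "\<And>r. r \<in> ?RY \<Longrightarrow> y \<notin> support ?H Y r" by blast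
    have sep: "support F X r \<subseteq> {y} \<or> support F X r \<subseteq> Y - {y}" if r: "r \<in> R" "support F X r \<subseteq> Y" for r
      using y(2)[OF RY[OF r]] supp[OF r] r(2) by blast
    have "Y = {y}"
    proof (rule ccontr)
      assume "Y \<noteq> {y}"
      then show False
        using finest_partition_split[OF supports Y, of "{y}"] y(1) sep by blast
    qed
    have yc: "y \<in> carrier F" using y(1) YX basis_carrier by blast
    have comm: "h \<otimes> k = k \<otimes> h" if hk: "h \<in> generate F Y" "k \<in> generate F Y" for h k
    proof -
      obtain a b :: int where "h = y [^] a" "k = y [^] b"
        using hk generate_pow[OF yc] \<open>Y = {y}\<close> by auto
      then show ?thesis using yc by (simp add: int_pow_mult[symmetric] add.commute)
    qed
    have "generate F Y \<noteq> {\<one>}"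
      using generate.incl[OF y(1), of F] basis_neq_one[of y] y(1) YX by blast
    then obtain i j where ij: "i \<in> {(H, k). k < count \<K> H}" "j \<in> {(H, k). k < count \<K> H}" "i \<noteq> j"
      using H.factorization_two_factors[OF fac] neq by auto
    obtain \<phi> where "split_group ?H {(H, k). k < count \<K> H} fst \<phi>"
      using H.factorization_split[OF fac] by blast
    then interpret S: split_group ?H "{(H, k). k < count \<K> H}" fst \<phi> .
    have ex: "\<exists>h\<in>fst i. h \<noteq> \<one>" if i: "i \<in> {(H, k). k < count \<K> H}" for i
    proof -
      have "snd i < count \<K> (fst i)" using i by auto
      then have "0 < count \<K> (fst i)" by linarith
      then have "fst i \<noteq> {\<one>}" using nontriv by simp
      moreover have "\<one> \<in> fst i" using subgroup.one_closed[OF S.factor[OF i]] by simp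
      ultimately show ?thesis by blast
    qed
    obtain h k where hk: "h \<in> fst i" "h \<noteq> \<one>" "k \<in> fst j" "k \<noteq> \<one>" using ex ij by blast
    then have "h \<otimes> k \<noteq> k \<otimes> h" using S.factors_not_commuting[OF ij] by simp
    moreover have "h \<in> generate F Y" "k \<in> generate F Y"
      using S.factor_carrier[OF ij(1) hk(1)] S.factor_carrier[OF ij(2) hk(3)] by auto
    ultimately show False using comm by blast
  qed
  have "\<exists>K. K \<in># \<K> \<and> (\<exists>h\<in>K. h \<noteq> \<one>\<^bsub>?H\<^esub> \<and> (r = Elt h \<or> r = Cls (conj_class ?H h)))" if rY: "r \<in> ?RY" for r
  proof -
    obtain s where s: "s \<in> R" "support F X s \<subseteq> Y" "r = view_in (generate F Y) s"
      using rY by (auto simp: restricted_to_def)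
    obtain K h where K: "K \<in># \<K>" "h \<in> K" "h \<noteq> \<one>" "s = Elt h \<or> s = Cls (conj_class F h)"
      using alloc[OF s(1,2)] by blast
    then have "h \<in> generate F Y" using K_sub by blast
    then have "r = Elt h \<or> r = Cls (conj_class ?H h)"
      using s(3) K(4) conj_class_generate[OF YX] by auto
    then show ?thesis using K by auto
  qed
  then obtain A where A: "A \<subseteq> Y" "A \<noteq> {}" "A \<noteq> Y"
    "\<forall>r\<in>?RY. support ?H Y r \<subseteq> A \<or> support ?H Y r \<subseteq> Y - A"
    using H.splitting_separates_basis[OF finY block_nonempty[OF Y] fac _ _ _ nocut covered] nontriv neq by auto
  have "support F X r \<subseteq> A \<or> support F X r \<subseteq> Y - A" if r: "r \<in> R" "support F X r \<subseteq> Y" for r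
    using A(4) RY[OF r] supp[OF r] by blast
  then show False using finest_partition_split[OF supports Y A(1-3)] by blast
qed

text \<open>
  A proper refinement splits the subgroup of some block \<open>Y\<close>. What has to be seen is that it still
  allocates the members of \<open>R\<close> supported in \<open>Y\<close> within the factors into which this subgroup was
  split, and not elsewhere: subgroups of other blocks contain no conjugate of them.
\<close>

lemma factors_not_refinable:
  assumes nocut: "\<And>Y v. Y \<in> blocks \<Longrightarrow> v \<in> pm (F\<lparr>carrier := generate F Y\<rparr>) Y \<Longrightarrow>
      \<not> cutvertex (whitehead_graph (F\<lparr>carrier := generate F Y\<rparr>) Y (restricted_to F X R Y)) v"
    and ref: "proper_refinement F factors \<H>" and alloc: "is_allocating F R \<H>"
  shows False
proof -
  obtain \<C> where \<C>: "image_mset fst \<C> = factors" "\<H> = \<Sum>\<^sub># (image_mset snd \<C>)"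
    "\<forall>(H, \<K>)\<in>set_mset \<C>. is_factorization (F\<lparr>carrier := H\<rparr>) \<K> \<and> (\<forall>K\<in>#\<K>. K \<noteq> {\<one>})"
    "\<exists>(H, \<K>)\<in>set_mset \<C>. \<K> \<noteq> {#H#}"
    using ref unfolding proper_refinement_def by (elim exE conjE) blast
  then obtain H \<K> where HK: "(H, \<K>) \<in># \<C>" "\<K> \<noteq> {#H#}" by blast
  have in_factors: "\<exists>Y\<in>blocks. H = generate F Y" if "(H, \<K>) \<in># \<C>" for H \<K>
  proof -
    have "H \<in># image_mset fst \<C>" using that by force
    then show ?thesis using \<C>(1) finite_blocks by auto
  qed
  obtain Y where Y: "Y \<in> blocks" "H = generate F Y" using in_factors[OF HK(1)] by blast
  have unique: "\<L> = \<K>" if L: "(H, \<L>) \<in># \<C>" for \<L>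
  proof (rule ccontr)
    assume neq: "\<L> \<noteq> \<K>"
    obtain \<D> where D: "\<C> = add_mset (H, \<K>) \<D>" using HK(1) by (meson multi_member_split)
    then have "(H, \<L>) \<in># \<D>" using L neq by auto
    then have "H \<in># image_mset fst \<D>" by force
    then have "count (image_mset fst \<C>) H \<ge> 2"
      by (simp add: D Suc_le_eq)
    \<comment> \<open>distinct blocks generate distinct subgroups, so no factor is repeated\<close>
    moreover have "count factors H \<le> 1"
      unfolding factors_mset_set by (simp add: count_mset_set')
    ultimately show False using \<C>(1) by simp
  qed
  have "\<K> = {#generate F Y#}"
  proof (rule block_factor_atomic[OF Y(1) nocut[OF Y(1)]])
    show "is_factorization (F\<lparr>carrier := generate F Y\<rparr>) \<K>" using \<C>(3) HK(1) Y(2) by blast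
    show "K \<noteq> {\<one>}" if "K \<in># \<K>" for K using \<C>(3) HK(1) that by blast
    fix r assume rR: "r \<in> R" and supp: "support F X r \<subseteq> Y"
    then have r: "r \<in> elts_and_classes F (carrier F - {\<one>})" using nontrivial by blast
    have "r \<in> elts_and_classes F (\<Union>H\<in>set_mset \<H>. H)"
      using alloc rR by (auto simp: is_allocating_def)
    then obtain L h where h: "L \<in># \<H>" "h \<in> L" "r = Elt h \<or> r = Cls (conj_class F h)"
      by (auto simp: elts_and_classes_def)
    then obtain H' \<L> where H': "(H', \<L>) \<in># \<C>" "L \<in># \<L>" using \<C>(2) by auto
    obtain Z where Z: "Z \<in> blocks" "H' = generate F Z" using in_factors[OF H'(1)] by blast
    have "is_factorization (F\<lparr>carrier := H'\<rparr>) \<L>" using \<C>(3) H'(1) by blast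
    then have "L \<subseteq> H'"
      using H'(2) subgroup.subset[of L "F\<lparr>carrier := H'\<rparr>"] by (auto simp: is_factorization_def)
    then have hZ: "h \<in> generate F Z" using h Z by blast
    then have hc: "h \<in> carrier F"
      using generate_incl[OF subset_basis_carrier[OF block_subset[OF Z(1)]]] by blast
    obtain xs where xs: "expresses F X r xs" using expresses_exists(1)[OF r] by blast
    have prod: "list_prod F xs \<in> generate F Y" "list_prod F xs \<noteq> \<one>"
      using expresses_in_generate[OF r block_subset[OF Y(1)] supp xs] expresses_exists(2)[OF r xs] by auto
    have "list_prod F xs \<in> conj_class F h"
      using xs h(3) self_in_conj_class[OF hc] by (auto simp: expresses_def)
    then obtain c where c: "c \<in> carrier F" "list_prod F xs = c \<otimes> h \<otimes> inv c"
      by (auto simp: conj_class_def)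
    have "Y = Z"
    proof (rule ccontr)
      assume "Y \<noteq> Z"
      then have "Y \<inter> Z = {}" using blocks_disjoint Y Z by blast
      from generate_disjoint_conj[OF block_subset[OF Y(1)] block_subset[OF Z(1)] this prod(1) hZ c]
      show False using prod(2) by simp
    qed
    then have "\<L> = \<K>" using unique[of \<L>] H'(1) Y Z by simp
    moreover have "h \<noteq> \<one>" using c prod(2) by auto
    ultimately show "\<exists>K. K \<in># \<K> \<and> (\<exists>h\<in>K. h \<noteq> \<one> \<and> (r = Elt h \<or> r = Cls (conj_class F h)))"
      using h H'(2) by blast
  qed
  then show False using HK(2) Y(2) by simp
qed

end

theorem mainTheorem6:
  fixes F :: "('a, 'b) monoid_scheme"
    and R :: "'a elt_or_class set"
    and X :: "'a set"
  assumes "finite_rank_free_group F"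
    and "finite R"
    and "R \<subseteq> elts_and_classes F (carrier F - {\<one>\<^bsub>F\<^esub>})"
    and "cutvertex_free_basis F R X"
  shows "is_atomic_allocating F R
           (image_mset (generate F) (mset_set (finest_partition F X R)))"
proof -
  obtain B where B: "group F" "finite B" "is_basis F B"
    using assms(1) by (auto simp: finite_rank_free_group_def)
  interpret based_group F X
    using assms(4) B(1) by (simp add: based_group_def based_group_axioms_def cutvertex_free_basis_def)
  interpret allocation_data F X R
    using finite_of_finite_basis[OF B(3,2)] assms(3) by unfold_locales
  show ?thesis
    unfolding is_atomic_allocating_def
    using factors_allocating factors_not_refinable assms(4)
    unfolding cutvertex_free_basis_def Let_def by blast
qed

end
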